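(* Consider the extremal Reissner-Nordström black hole ($e=m>0$) with the foliation $\Sigma_\tau=\{t^*=\tau\}$ of its exterior and the timelike vector field $N=-(dt^* )^\sharp$ described in the context. Let $\mathcal{U}$ be any open neighbourhood of the event horizon $\mathcal{H}^+$ in the maximal analytic extension and let $\mathcal{T}=\mathcal{U}\cap\mathcal{D}(\Sigma_0)$. Then there is no local energy decay statement and no integrated local energy decay statement without loss of derivatives for $\mathcal{T}$: there is no function $P:[0,\infty)\to(0,\infty)$ with $P(\tau)\to0$ for $\tau\to\infty$ such that $$E^N_{\tau,\mathcal{T}\cap\Sigma_\tau}(u)\le P(\tau)\,E^N_0(u)\qquad\text{for all }\tau\ge0$$ holds for all solutions $u$ of the wave equation $\Box_gu=0$ on $\mathcal{D}(\Sigma_0)$, and there is no constant $C>0$ such that $$\int_0^\infty E^N_{\tau,\mathcal{T}\cap\Sigma_\tau}(u)\,d\tau\le C\,E^N_0(u)$$ holds for all solutions $u$ of the wave equation on $\mathcal{D}(\Sigma_0)$.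
   Context: Let $m>0$ and $D(r)=\frac{(r-m)^2}{r^2}$. The exterior is $M=\mathbb{R}\times(m,\infty)\times\mathbb{S}^2$ with $g=-D\,dt^2+D^{-1}dr^2+r^2d\theta^2+r^2\sin^2\theta\,d\varphi^2$. Put $v=t+r^*$, $\frac{dr^*}{dr}=\frac1D$, and $t^*=v-r$. In coordinates $(t^*,r,\theta,\varphi)$ the metric is $$g=-D(dt^* )^2+(1-D)(dt^*\otimes dr+dr\otimes dt^* )+(2-D)dr^2+r^2d\theta^2+r^2\sin^2\theta\,d\varphi^2,$$ which extends across the event horizon $\mathcal{H}^+=\{r=m\}$ to $r\in(0,\infty)$ (part of the maximal analytic extension). $\Sigma_\tau=\{t^*=\tau,\ r>m\}$ are spacelike slices of the exterior; $N=-(dt^* )^\sharp$ is timelike and taken to be future directed. $\mathcal{D}(\Sigma_0)$ is the domain of dependence of $\Sigma_0$ in $(M,g)$. Energy. $n_{\Sigma_\tau}$ is the future directed unit normal, $\bar g_\tau$ the induced metric; $\mathbb{T}(u)=\frac12\overline{du}\otimes du+\frac12du\otimes\overline{du}-\frac12g\,g^{-1}(du,\overline{du})$, $J^N(u)=[\mathbb{T}(u)(N,\cdot)]^\sharp$; for $A\subseteq\Sigma_\tau$, $E^N_{\tau,A}(u)=\int_Ag(J^N(u),n_{\Sigma_\tau})\,\mathrm{vol}_{\bar g_\tau}$ and $E^N_\tau(u)=E^N_{\tau,\Sigma_\tau}(u)$. Solutions are smooth (complex valued). *)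

theory Defs
  imports "HOL-Analysis.Analysis"
begin

section \<open>Lorentzian geometry on open subsets of \<open>\<real>\<^sup>4\<close>\<close>

text \<open>A metric on an open subset of \<open>\<real>\<^sup>4\<close> is a matrix field \<^typ>\<open>real^4 \<Rightarrow> real^4^4\<close>, with
  signature \<open>(-,+,+,+)\<close>; covectors are identified with their coordinate vectors.\<close>

definition metric_ip :: "real^4^4 \<Rightarrow> real^4 \<Rightarrow> real^4 \<Rightarrow> real" where
  "metric_ip G X Y = (\<Sum>i\<in>UNIV. \<Sum>j\<in>UNIV. G $ i $ j * X $ i * Y $ j)"

definition sharp :: "real^4^4 \<Rightarrow> real^4 \<Rightarrow> real^4" where
  "sharp G \<alpha> = matrix_inv G *v \<alpha>"

definition partial :: "4 \<Rightarrow> (real^4 \<Rightarrow> 'b::real_normed_vector) \<Rightarrow> real^4 \<Rightarrow> 'b" where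
  "partial i f p = frechet_derivative f (at p) (axis i 1)"

text \<open>Only meant for open \<open>S\<close>: derivatives are two-sided.\<close>

fun Ck_on :: "nat \<Rightarrow> (real^4) set \<Rightarrow> (real^4 \<Rightarrow> 'b::real_normed_vector) \<Rightarrow> bool" where
  "Ck_on 0 S f \<longleftrightarrow> continuous_on S f"
| "Ck_on (Suc k) S f \<longleftrightarrow> (\<forall>p\<in>S. f differentiable (at p)) \<and> (\<forall>i. Ck_on k S (partial i f))"

definition smooth_on :: "(real^4) set \<Rightarrow> (real^4 \<Rightarrow> 'b::real_normed_vector) \<Rightarrow> bool" where
  "smooth_on S f \<longleftrightarrow> (\<forall>k. Ck_on k S f)"

definition wave_op :: "(real^4 \<Rightarrow> real^4^4) \<Rightarrow> (real^4 \<Rightarrow> complex) \<Rightarrow> real^4 \<Rightarrow> complex" where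
  "wave_op g u p =
     (\<Sum>i\<in>UNIV. partial i
        (\<lambda>q. \<Sum>j\<in>UNIV. (sqrt \<bar>det (g q)\<bar> * matrix_inv (g q) $ i $ j) *\<^sub>R partial j u q) p)
     /\<^sub>R sqrt \<bar>det (g p)\<bar>"

text \<open>The complex expression below is real because the metric is symmetric; \<^const>\<open>Re\<close> only
  changes its type.\<close>

definition stress_energy ::
  "(real^4 \<Rightarrow> real^4^4) \<Rightarrow> (real^4 \<Rightarrow> complex) \<Rightarrow> real^4 \<Rightarrow> real^4 \<Rightarrow> real^4 \<Rightarrow> real" where
  "stress_energy g u p X Y =
     (let du = frechet_derivative u (at p) in
      Re (cnj (du X) * du Y / 2 + du X * cnj (du Y) / 2
          - of_real (metric_ip (g p) X Y) *
            (\<Sum>i\<in>UNIV. \<Sum>j\<in>UNIV. of_real (matrix_inv (g p) $ i $ j)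
                * du (axis i 1) * cnj (du (axis j 1))) / 2))"

definition current ::
  "(real^4 \<Rightarrow> real^4^4) \<Rightarrow> (real^4 \<Rightarrow> real^4) \<Rightarrow> (real^4 \<Rightarrow> complex) \<Rightarrow> real^4 \<Rightarrow> real^4" where
  "current g V u p = sharp (g p) (\<chi> j. stress_energy g u p (V p) (axis j 1))"

text \<open>The time orientation is given by a timelike vector field \<open>V\<close>.\<close>

definition future_causal :: "real^4^4 \<Rightarrow> real^4 \<Rightarrow> real^4 \<Rightarrow> bool" where
  "future_causal G V X \<longleftrightarrow> X \<noteq> 0 \<and> metric_ip G X X \<le> 0 \<and> metric_ip G X V < 0"

text \<open>Piecewise \<open>C\<^sup>1\<close> causal curves \<open>\<gamma>: [0,1) \<rightarrow> M\<close> that start at \<open>p\<close> and have no endpoint in \<open>M\<close>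
  as the parameter tends to 1; future directed for \<open>\<epsilon> = 1\<close>, past directed for \<open>\<epsilon> = -1\<close>. The
  breakpoints are locally finite in \<open>[0,1)\<close>.\<close>

definition inextendible_causal_curve ::
  "(real^4) set \<Rightarrow> (real^4 \<Rightarrow> real^4^4) \<Rightarrow> (real^4 \<Rightarrow> real^4) \<Rightarrow> real \<Rightarrow> real^4 \<Rightarrow> (real \<Rightarrow> real^4) \<Rightarrow> bool"
where
  "inextendible_causal_curve M g V \<epsilon> p \<gamma> \<longleftrightarrow>
     \<gamma> 0 = p \<and> \<gamma> ` {0..<1} \<subseteq> M \<and>
     (\<forall>b<1. \<gamma> piecewise_C1_differentiable_on {0..b}) \<and>
     (\<forall>s\<in>{0<..<1}. \<gamma> differentiable (at s) \<longrightarrow>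
        future_causal (g (\<gamma> s)) (V (\<gamma> s)) (\<epsilon> *\<^sub>R vector_derivative \<gamma> (at s))) \<and>
     \<not> (\<exists>q\<in>M. (\<gamma> \<longlongrightarrow> q) (at_left 1))"

definition domain_of_dependence ::
  "(real^4) set \<Rightarrow> (real^4 \<Rightarrow> real^4^4) \<Rightarrow> (real^4 \<Rightarrow> real^4) \<Rightarrow> (real^4) set \<Rightarrow> (real^4) set" where
  "domain_of_dependence M g V S =
     {p\<in>M. \<forall>\<gamma>. inextendible_causal_curve M g V (-1) p \<gamma> \<longrightarrow> (\<exists>s\<in>{0..<1}. \<gamma> s \<in> S)} \<union>
     {p\<in>M. \<forall>\<gamma>. inextendible_causal_curve M g V 1 p \<gamma> \<longrightarrow> (\<exists>s\<in>{0..<1}. \<gamma> s \<in> S)}"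

section \<open>Extremal Reissner-Nordstroem\<close>

text \<open>The manifold \<open>\<real> \<times> (0,\<infinity>) \<times> S\<^sup>2\<close> with coordinates \<open>t\<^sup>*\<close>, \<open>r\<close>, \<open>\<omega>\<close> is identified with
  \<open>\<real> \<times> (\<real>\<^sup>3 - {0})\<close> by \<open>(t\<^sup>*, r, \<omega>) \<mapsto> (t\<^sup>*, r \<omega>)\<close>, a single chart that also covers the poles of the
  spheres. Component 1 is \<open>t\<^sup>*\<close>; components 2, 3, 4 are the Cartesian coordinates of \<open>r \<omega>\<close>.\<close>

definition rad :: "real^4 \<Rightarrow> real" where
  "rad p = sqrt ((p $ 2)\<^sup>2 + (p $ 3)\<^sup>2 + (p $ 4)\<^sup>2)"

definition ern_D :: "real \<Rightarrow> real \<Rightarrow> real" where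
  "ern_D m r = (r - m)\<^sup>2 / r\<^sup>2"

definition dt_form :: "real^4" where
  "dt_form = axis 1 1"

definition dr_form :: "real^4 \<Rightarrow> real^4" where
  "dr_form p = (\<chi> i. if i = 1 then 0 else p $ i / rad p)"

text \<open>The last summand is \<open>r\<^sup>2 d\<theta>\<^sup>2 + r\<^sup>2 sin\<^sup>2 \<theta> d\<phi>\<^sup>2\<close>, which equals
  \<open>dx\<^sup>2 + dy\<^sup>2 + dz\<^sup>2 - dr\<^sup>2\<close>; see \<open>ern_metric_spherical\<close> below.\<close>

definition ern_metric :: "real \<Rightarrow> real^4 \<Rightarrow> real^4^4" where
  "ern_metric m p = (\<chi> i j.
     let D = ern_D m (rad p); dt = dt_form; dr = dr_form p in
       - D * dt $ i * dt $ j
       + (1 - D) * (dt $ i * dr $ j + dr $ i * dt $ j)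
       + (2 - D) * dr $ i * dr $ j
       + ((if i = j then 1 else 0) - dt $ i * dt $ j - dr $ i * dr $ j))"

definition sph_chart :: "real \<Rightarrow> real \<Rightarrow> real \<Rightarrow> real \<Rightarrow> real^4" where
  "sph_chart t r \<theta> \<phi> = vector [t, r * sin \<theta> * cos \<phi>, r * sin \<theta> * sin \<phi>, r * cos \<theta>]"

definition sph_chart_deriv ::
  "real \<Rightarrow> real \<Rightarrow> real \<Rightarrow> real \<times> real \<times> real \<times> real \<Rightarrow> real^4" where
  "sph_chart_deriv r \<theta> \<phi> = (\<lambda>(a, b, c, d). vector
     [a,
      b * sin \<theta> * cos \<phi> + c * r * cos \<theta> * cos \<phi> - d * r * sin \<theta> * sin \<phi>,
      b * sin \<theta> * sin \<phi> + c * r * cos \<theta> * sin \<phi> + d * r * sin \<theta> * cos \<phi>,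
      b * cos \<theta> - c * r * sin \<theta>])"

lemma vector_4_nth:
  "(vector [a, b, c, d] :: 'a::zero^4) $ 1 = a"
  "(vector [a, b, c, d] :: 'a::zero^4) $ 2 = b"
  "(vector [a, b, c, d] :: 'a::zero^4) $ 3 = c"
  "(vector [a, b, c, d] :: 'a::zero^4) $ 4 = d"
  unfolding vector_def by simp_all

lemma ern_metric_spherical:
  assumes "r > 0"
  shows "((\<lambda>(t, r, \<theta>, \<phi>). sph_chart t r \<theta> \<phi>) has_derivative sph_chart_deriv r \<theta> \<phi>) (at (t, r, \<theta>, \<phi>))"
    and "metric_ip (ern_metric m (sph_chart t r \<theta> \<phi>))
           (sph_chart_deriv r \<theta> \<phi> (a, b, c, d)) (sph_chart_deriv r \<theta> \<phi> (a', b', c', d'))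
         = - ern_D m r * a * a' + (1 - ern_D m r) * (a * b' + b * a') + (2 - ern_D m r) * b * b'
           + r\<^sup>2 * c * c' + r\<^sup>2 * (sin \<theta>)\<^sup>2 * d * d'"
proof -
  have vec: "(vector [a, b, c, d] :: real^4) = a *\<^sub>R axis 1 1 + b *\<^sub>R axis 2 1 + c *\<^sub>R axis 3 1 + d *\<^sub>R axis 4 1"
    for a b c d
    by (simp add: vec_eq_iff forall_4 vector_4_nth axis_def)
  show "((\<lambda>(t, r, \<theta>, \<phi>). sph_chart t r \<theta> \<phi>) has_derivative sph_chart_deriv r \<theta> \<phi>) (at (t, r, \<theta>, \<phi>))"
    unfolding sph_chart_def sph_chart_deriv_def vec case_prod_beta
    by (rule has_derivative_eq_rhs, (rule derivative_intros)+)
       (auto simp: fun_eq_iff algebra_simps)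
next
  have cs: "cos \<theta> * cos \<theta> = 1 - sin \<theta> * sin \<theta>" "cos \<phi> * cos \<phi> = 1 - sin \<phi> * sin \<phi>"
    using sin_cos_squared_add[of \<theta>] sin_cos_squared_add[of \<phi>] by (auto simp: power2_eq_square)
  have "(r * sin \<theta> * cos \<phi>)\<^sup>2 + (r * sin \<theta> * sin \<phi>)\<^sup>2 + (r * cos \<theta>)\<^sup>2 = r\<^sup>2"
    using cs by algebra
  then have rad: "rad (sph_chart t r \<theta> \<phi>) = r"
    using assms by (simp add: rad_def sph_chart_def vector_4_nth)
  define X where "X = sph_chart_deriv r \<theta> \<phi> (a, b, c, d)"
  define Y where "Y = sph_chart_deriv r \<theta> \<phi> (a', b', c', d')"
  define e where "e = dr_form (sph_chart t r \<theta> \<phi>)"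
  have e: "e $ 1 = 0" "e $ 2 = sin \<theta> * cos \<phi>" "e $ 3 = sin \<theta> * sin \<phi>" "e $ 4 = cos \<theta>"
    using assms unfolding e_def dr_form_def rad by (simp_all add: sph_chart_def vector_4_nth)
  note X = X_def[unfolded sph_chart_deriv_def prod.case] and Y = Y_def[unfolded sph_chart_deriv_def prod.case]
  have t: "X $ 1 = a" "Y $ 1 = a'"
    by (simp_all add: X Y vector_4_nth)
  have eX: "e $ 2 * X $ 2 + e $ 3 * X $ 3 + e $ 4 * X $ 4 = b"
    unfolding e X vector_4_nth using cs by algebra
  have eY: "e $ 2 * Y $ 2 + e $ 3 * Y $ 3 + e $ 4 * Y $ 4 = b'"
    unfolding e Y vector_4_nth using cs by algebra
  have XY: "X $ 2 * Y $ 2 + X $ 3 * Y $ 3 + X $ 4 * Y $ 4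
      = b * b' + r\<^sup>2 * c * c' + r\<^sup>2 * (sin \<theta>)\<^sup>2 * d * d'"
    unfolding X Y vector_4_nth using cs by algebra
  have "metric_ip (ern_metric m (sph_chart t r \<theta> \<phi>)) X Y
      = - ern_D m r * X $ 1 * Y $ 1
        + (1 - ern_D m r) * (X $ 1 * (e $ 2 * Y $ 2 + e $ 3 * Y $ 3 + e $ 4 * Y $ 4)
                             + (e $ 2 * X $ 2 + e $ 3 * X $ 3 + e $ 4 * X $ 4) * Y $ 1)
        + (1 - ern_D m r) * (e $ 2 * X $ 2 + e $ 3 * X $ 3 + e $ 4 * X $ 4)
                          * (e $ 2 * Y $ 2 + e $ 3 * Y $ 3 + e $ 4 * Y $ 4)
        + (X $ 2 * Y $ 2 + X $ 3 * Y $ 3 + X $ 4 * Y $ 4)"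
    unfolding metric_ip_def ern_metric_def sum_4 rad e_def[symmetric] Let_def
    by (simp add: dt_form_def axis_def e(1) algebra_simps)
  also have "\<dots> = - ern_D m r * a * a' + (1 - ern_D m r) * (a * b' + b * a') + (2 - ern_D m r) * b * b'
           + r\<^sup>2 * c * c' + r\<^sup>2 * (sin \<theta>)\<^sup>2 * d * d'"
    unfolding t eX eY XY by (simp add: algebra_simps)
  finally show "metric_ip (ern_metric m (sph_chart t r \<theta> \<phi>))
           (sph_chart_deriv r \<theta> \<phi> (a, b, c, d)) (sph_chart_deriv r \<theta> \<phi> (a', b', c', d'))
         = - ern_D m r * a * a' + (1 - ern_D m r) * (a * b' + b * a') + (2 - ern_D m r) * b * b'
           + r\<^sup>2 * c * c' + r\<^sup>2 * (sin \<theta>)\<^sup>2 * d * d'"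
    unfolding X_def Y_def .
qed

definition ern_extended :: "(real^4) set" where
  "ern_extended = {p. rad p > 0}"

definition ern_exterior :: "real \<Rightarrow> (real^4) set" where
  "ern_exterior m = {p. rad p > m}"

definition ern_horizon :: "real \<Rightarrow> (real^4) set" where
  "ern_horizon m = {p. rad p = m}"

definition ern_slice :: "real \<Rightarrow> real \<Rightarrow> (real^4) set" where
  "ern_slice m \<tau> = {p. p $ 1 = \<tau> \<and> rad p > m}"

definition ern_N :: "real \<Rightarrow> real^4 \<Rightarrow> real^4" where
  "ern_N m p = - sharp (ern_metric m p) dt_form"

definition ern_dod :: "real \<Rightarrow> (real^4) set" where
  "ern_dod m = domain_of_dependence (ern_exterior m) (ern_metric m) (ern_N m) (ern_slice m 0)"

text \<open>Vectors tangent to the slices are those with vanishing first component.\<close>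

definition ern_unit_normal :: "real \<Rightarrow> real^4 \<Rightarrow> real^4" where
  "ern_unit_normal m p = (THE n.
     metric_ip (ern_metric m p) n n = -1 \<and>
     (\<forall>X. X $ 1 = 0 \<longrightarrow> metric_ip (ern_metric m p) n X = 0) \<and>
     future_causal (ern_metric m p) (ern_N m p) n)"

definition slice_pt :: "real \<Rightarrow> real^3 \<Rightarrow> real^4" where
  "slice_pt \<tau> y = vector [\<tau>, y $ 1, y $ 2, y $ 3]"

text \<open>\<^term>\<open>slice_pt 0\<close> is the differential of the parametrisation \<^term>\<open>slice_pt \<tau>\<close> of the
  hypersurface \<open>{t\<^sup>* = \<tau>}\<close>.\<close>

definition ern_induced_metric :: "real \<Rightarrow> real \<Rightarrow> real^3 \<Rightarrow> real^3^3" where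
  "ern_induced_metric m \<tau> y = (\<chi> i j.
     metric_ip (ern_metric m (slice_pt \<tau> y)) (slice_pt 0 (axis i 1)) (slice_pt 0 (axis j 1)))"

text \<open>The energy is \<open>\<infinity>\<close> where the (nonnegative) energy density is not integrable.\<close>

definition ern_energy :: "real \<Rightarrow> real \<Rightarrow> (real^4) set \<Rightarrow> (real^4 \<Rightarrow> complex) \<Rightarrow> ennreal" where
  "ern_energy m \<tau> A u = (\<integral>\<^sup>+ y \<in> {y. slice_pt \<tau> y \<in> A}.
     (let p = slice_pt \<tau> y in
      ennreal (metric_ip (ern_metric m p) (current (ern_metric m) (ern_N m) u p) (ern_unit_normal m p)
               * sqrt (det (ern_induced_metric m \<tau> y)))) \<partial>lborel)"

definition ern_wave_solution :: "real \<Rightarrow> (real^4 \<Rightarrow> complex) \<Rightarrow> bool" where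
  "ern_wave_solution m u \<longleftrightarrow>
     smooth_on (ern_dod m) u \<and> (\<forall>p\<in>ern_dod m. wave_op (ern_metric m) u p = 0)"

end

theory Submission
  imports Defs
begin

text \<open>The counterexamples are spherically symmetric modes \<open>u = exp (- \<kappa> (t\<^sup>* + r)) S(r)\<close> with \<open>\<kappa> > 0\<close> small,
  for which the wave equation is \<open>((r - m)\<^sup>2 S')' = 2 \<kappa> r (r S)'\<close>. For \<open>\<kappa> = 0\<close> the solution that decays
  at infinity is \<open>1 / (r - m)\<close>, whose energy is infinite only because of the horizon. For \<open>\<kappa> > 0\<close> the
  decaying solution has finite energy, but by comparison with \<open>1 / (r - m)\<close> this energy concentrates
  at the horizon as \<open>\<kappa> \<rightarrow> 0\<close>. Since the energy of a mode on \<open>\<Sigma>\<^sub>\<tau>\<close> is exactly \<open>exp (- 2 \<kappa> \<tau>)\<close> times its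
  initial energy, a fixed fraction of it stays arbitrarily close to the horizon for an arbitrarily
  long time.\<close>

section \<open>The radial equation\<close>

text \<open>The static solution \<open>1 / (r - m)\<close> has a derivative of size
  \<open>(r - m)^-2\<close>, so its energy outside distance \<open>s\<close> from the horizon grows
  like \<open>s^-3\<close>. A positive \<kappa> cuts this off at the scale
  \<open>r - m ~ m^2 \<kappa>\<close>: a shell at that distance and of that thickness has energy
  density of order \<open>\<kappa>^-4\<close>, hence energy of order \<open>\<kappa>^-3\<close>. Two
  obstacles shape the proof. Since \<kappa> tends to 0, the comparison with the static solution
  needs bounds that are free of \<kappa> or explicit in it; the radial solution is therefore built
  by an iteration that stays below the static one, from which the bounds can be read off. Secondly,
  a neighbourhood of the horizon may become thinner and thinner as t* grows, so that it contains a
  collar \<open>m < r < m + \<delta>\<close> only over a bounded window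
  \<open>0 \<le> t* \<le> \<tau>0\<close>. The choices are made in the order \<tau>0, \<delta>,
  \<kappa>: one mode is needed for each window, and it has to work for an arbitrarily thin
  collar.\<close>

text \<open>With \<open>x = 1 / (r - m)\<close> and \<open>g = r S\<close> the equation \<open>((r - m)\<^sup>2 S')' = 2 \<kappa> r (r S)'\<close> of a mode becomes
  \<open>(a g')' + 2 \<kappa> g' = c g\<close>. The function \<open>E\<close> is \<open>exp (- 2 \<kappa> r\<^sup>*)\<close>, so that \<open>E' = 2 \<kappa> E / a\<close>; two
  integrations from \<open>x = 0\<close> (spatial infinity), where \<open>g = 1\<close>, and an exchange of their order give
  the Volterra equation \<open>g = volterra g\<close>.\<close>

locale ern_mode =
  fixes m \<kappa> :: real
  assumes m_pos: "0 < m" and \<kappa>_pos: "0 < \<kappa>"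
begin

text \<open>In terms of \<open>r\<close> these are \<open>a = 1 / r^2\<close> and
  \<open>c = 2 m (r - m)^3 / r^4\<close>. Since d/dr* = - a d/dx, the product \<open>a c\<close> is
  D D' / r, the Regge-Wheeler potential of spherically symmetric waves.\<close>

definition a :: "real \<Rightarrow> real" where "a x = x\<^sup>2 / (1 + m * x)\<^sup>2"
definition c :: "real \<Rightarrow> real" where "c x = 2 * m * x / (1 + m * x) ^ 4"
definition E :: "real \<Rightarrow> real" where
  "E x = (if x \<le> 0 then 0 else exp (2 * \<kappa> * (m\<^sup>2 * x + 2 * m * ln x - 1 / x)))"

lemma one_mx_pos: "0 \<le> x \<Longrightarrow> 0 < 1 + m * x"
  using m_pos by (simp add: add_pos_nonneg)

lemma a_pos: "0 < x \<Longrightarrow> 0 < a x"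
  using one_mx_pos[of x] by (simp add: a_def)

lemma c_nonneg: "0 \<le> x \<Longrightarrow> 0 \<le> c x"
  using m_pos by (simp add: c_def)

lemma E_pos: "0 < x \<Longrightarrow> 0 < E x" by (simp add: E_def)
lemma E_nonneg: "0 \<le> E x" by (simp add: E_def)

lemma E_has_derivative:
  assumes "0 < x"
  shows "(E has_real_derivative 2 * \<kappa> * E x / a x) (at x)"
proof -
  have "((\<lambda>x. exp (2 * \<kappa> * (m\<^sup>2 * x + 2 * m * ln x - 1 / x))) has_real_derivative
      2 * \<kappa> * E x / a x) (at x)"
    using assms one_mx_pos[of x]
    by (auto intro!: derivative_eq_intros simp: E_def a_def field_simps power2_eq_square)
  then show ?thesis
    by (rule has_field_derivative_transform_within_open[where S="{0<..}"]) (use assms in \<open>auto simp: E_def\<close>)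
qed

lemma a_has_derivative:
  assumes "0 \<le> x"
  shows "(a has_real_derivative 2 * x / (1 + m * x) ^ 3) (at x)"
  unfolding a_def using one_mx_pos[OF assms]
  by (auto intro!: derivative_eq_intros simp: divide_simps) algebra

lemma E_mono:
  assumes "0 \<le> s" "s \<le> x"
  shows "E s \<le> E x"
proof (cases "s = 0")
  case False
  then have "s > 0" using assms by simp
  show ?thesis
  proof (rule DERIV_nonneg_imp_nondecreasing[OF assms(2)])
    fix y assume "s \<le> y"
    with \<open>s > 0\<close> have "y > 0" by simp
    then have "(E has_real_derivative 2 * \<kappa> * E y / a y) (at y)" "0 \<le> 2 * \<kappa> * E y / a y"
      using E_has_derivative a_pos[of y] E_nonneg[of y] \<kappa>_pos by auto
    then show "\<exists>d. (E has_real_derivative d) (at y) \<and> 0 \<le> d" by blast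
  qed
qed (use E_nonneg[of x] in \<open>simp add: E_def\<close>)

text \<open>Only \<open>x = 0\<close> is not covered by differentiability. There
  \<open>exp (- 2 \<kappa> / x) \<le> x / (2 \<kappa>)\<close> squeezes \<open>E\<close>, the
  logarithm having the favourable sign on (0, 1].\<close>

lemma E_continuous: "continuous_on {0..} E"
proof -
  have "isCont E x" if "x > 0" for x
    using E_has_derivative[OF that] by (rule DERIV_isCont)
  moreover have "(E \<longlongrightarrow> E 0) (at 0 within {0..})"
  proof -
    have bd: "E x \<le> exp (2 * \<kappa> * m\<^sup>2) * x / (2 * \<kappa>)" if "0 < x" "x \<le> 1" for x
    proof -
      have "2 * \<kappa> / x \<le> exp (2 * \<kappa> / x)"
        using exp_ge_add_one_self[of "2 * \<kappa> / x"] by linarith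
      then have e: "exp (- (2 * \<kappa> / x)) \<le> x / (2 * \<kappa>)"
        using that \<kappa>_pos by (simp add: exp_minus field_simps)
      have "m\<^sup>2 * x + 2 * m * ln x - 1 / x \<le> m\<^sup>2 * 1 + 0 - 1 / x"
        using that m_pos by (intro diff_mono add_mono mult_left_mono) (auto intro!: mult_nonneg_nonpos)
      then have "2 * \<kappa> * (m\<^sup>2 * x + 2 * m * ln x - 1 / x) \<le> 2 * \<kappa> * (m\<^sup>2 - 1 / x)"
        using \<kappa>_pos by (intro mult_left_mono) auto
      then have "E x \<le> exp (2 * \<kappa> * m\<^sup>2) * exp (- (2 * \<kappa> / x))"
        using that by (simp add: E_def exp_add[symmetric] algebra_simps)
      also have "\<dots> \<le> exp (2 * \<kappa> * m\<^sup>2) * (x / (2 * \<kappa>))"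
        using e by (intro mult_left_mono) auto
      finally show ?thesis by simp
    qed
    have "(E \<longlongrightarrow> 0) (at 0 within {0..})"
    proof (rule tendsto_sandwich)
      show "\<forall>\<^sub>F x in at 0 within {0..}. 0 \<le> E x" by (simp add: E_nonneg)
      show "\<forall>\<^sub>F x in at 0 within {0..}. E x \<le> exp (2 * \<kappa> * m\<^sup>2) * x / (2 * \<kappa>)"
        unfolding eventually_at by (rule exI[of _ 1]) (auto simp: dist_real_def intro!: bd)
      show "((\<lambda>x. exp (2 * \<kappa> * m\<^sup>2) * x / (2 * \<kappa>)) \<longlongrightarrow> 0) (at 0 within {0..})"
        using \<kappa>_pos by (auto intro!: tendsto_eq_intros)
    qed auto
    then show ?thesis by (simp add: E_def)
  qed
  ultimately have "(E \<longlongrightarrow> E x) (at x within {0..})" if "0 \<le> x" for x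
    using that by (cases "x = 0") (auto simp: isCont_def intro: tendsto_within_subset[where S=UNIV])
  then show ?thesis by (simp add: continuous_on_def)
qed

section \<open>The Volterra operator and its fixed point\<close>

lemma c_continuous: "continuous_on {0..} c"
proof -
  have "1 + m * x \<noteq> 0" if "x \<in> {0..}" for x
    using one_mx_pos[of x] that by simp
  then show ?thesis
    unfolding c_def by (intro continuous_intros) auto
qed

text \<open>Integrability is asked for instead of continuity because the limit of the iteration is
  at first only a pointwise limit. Dominated convergence makes it admissible; its continuity then
  follows from its being a value of \<open>volterra\<close>. The bounds describe the order interval
  that \<open>volterra\<close> maps into itself.\<close>

definition admissible :: "(real \<Rightarrow> real) \<Rightarrow> bool" where
  "admissible h \<longleftrightarrow> (\<forall>b\<ge>0. (\<lambda>s. c s * h s) integrable_on {0..b} \<and> (\<lambda>s. E s * (c s * h s)) integrable_on {0..b})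
    \<and> (\<forall>x\<ge>0. 1 \<le> h x \<and> h x \<le> 1 + m * x)"

text \<open>The equation reads \<open>(a E g')' = E c g\<close>, and
  \<open>- 1 / (2 \<kappa> E)\<close> is a primitive of \<open>1 / (a E)\<close>; this gives the
  kernel \<open>(1 - E s / E x) / (2 \<kappa>)\<close>. It is split so that \<open>x\<close> does
  not occur in the integrands. At \<open>x = 0\<close> both integrals vanish and the quotient by
  \<open>E 0 = 0\<close> is 0.\<close>

definition volterra :: "(real \<Rightarrow> real) \<Rightarrow> real \<Rightarrow> real" where
  "volterra h x = 1 + (integral {0..x} (\<lambda>s. c s * h s)
      - integral {0..x} (\<lambda>s. E s * (c s * h s)) / E x) / (2 * \<kappa>)"

lemma admissible_continuous:
  assumes "continuous_on {0..} h" "\<And>x. 0 \<le> x \<Longrightarrow> 1 \<le> h x" "\<And>x. 0 \<le> x \<Longrightarrow> h x \<le> 1 + m * x"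
  shows "admissible h"
proof -
  have "continuous_on {0..} (\<lambda>s. c s * h s)" "continuous_on {0..} (\<lambda>s. E s * (c s * h s))"
    using assms(1) c_continuous E_continuous by (auto intro!: continuous_intros)
  then show ?thesis
    unfolding admissible_def using assms(2,3)
    by (auto intro!: integrable_continuous_interval intro: continuous_on_subset)
qed

lemma admissible_linear: "admissible (\<lambda>x. 1 + m * x)"
  using m_pos by (intro admissible_continuous) (auto intro!: continuous_intros)

lemma kernel_has_integral:
  assumes "admissible h" "0 < x"
  shows "((\<lambda>s. (1 - E s / E x) * (c s * h s)) has_integral (2 * \<kappa> * (volterra h x - 1))) {0..x}"
proof -
  have "((\<lambda>s. c s * h s) has_integral integral {0..x} (\<lambda>s. c s * h s)) {0..x}"
    "((\<lambda>s. E s * (c s * h s)) has_integral integral {0..x} (\<lambda>s. E s * (c s * h s))) {0..x}"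
    using assms by (auto simp: admissible_def)
  from has_integral_diff[OF this(1) has_integral_divide[OF this(2), of "E x"]]
  have "((\<lambda>s. c s * h s - E s * (c s * h s) / E x) has_integral 2 * \<kappa> * (volterra h x - 1)) {0..x}"
    using \<kappa>_pos by (simp add: volterra_def)
  then show ?thesis
    by (rule has_integral_eq[rotated]) (simp add: algebra_simps)
qed

lemma kernel_nonneg: "0 \<le> s \<Longrightarrow> s \<le> x \<Longrightarrow> 0 < x \<Longrightarrow> 0 \<le> 1 - E s / E x"
  using E_mono[of s x] E_pos[of x] by (simp add: field_simps)

lemma volterra_0: "volterra h 0 = 1"
  by (simp add: volterra_def)

lemma volterra_ge_1:
  assumes "admissible h" "0 \<le> x"
  shows "1 \<le> volterra h x"
proof (cases "x = 0")
  case False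
  then have x: "x > 0" using assms by simp
  have "0 \<le> 2 * \<kappa> * (volterra h x - 1)"
  proof (rule has_integral_nonneg[OF kernel_has_integral[OF assms(1) x]])
    fix s assume "s \<in> {0..x}"
    then have "0 \<le> 1 - E s / E x" "0 \<le> c s" "1 \<le> h s"
      using kernel_nonneg[of s x] c_nonneg[of s] x assms(1) by (auto simp: admissible_def)
    then show "0 \<le> (1 - E s / E x) * (c s * h s)" by simp
  qed
  then show ?thesis using \<kappa>_pos by (simp add: zero_le_mult_iff)
qed (simp add: volterra_0)

lemma volterra_mono:
  assumes "admissible h" "admissible k" "\<And>s. 0 \<le> s \<Longrightarrow> h s \<le> k s" "0 \<le> x"
  shows "volterra h x \<le> volterra k x"
proof (cases "x = 0")
  case False
  then have x: "x > 0" using assms by simp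
  have "2 * \<kappa> * (volterra h x - 1) \<le> 2 * \<kappa> * (volterra k x - 1)"
  proof (rule has_integral_le[OF kernel_has_integral[OF assms(1) x] kernel_has_integral[OF assms(2) x]])
    fix s assume "s \<in> {0..x}"
    then show "(1 - E s / E x) * (c s * h s) \<le> (1 - E s / E x) * (c s * k s)"
      using kernel_nonneg[of s x] c_nonneg[of s] x assms(3)[of s] by (intro mult_left_mono) auto
  qed
  then show ?thesis using \<kappa>_pos by simp
qed (simp add: volterra_0)

lemma c_times_linear: "0 \<le> s \<Longrightarrow> c s * (1 + m * s) = m * (2 * s / (1 + m * s) ^ 3)"
  using one_mx_pos[of s] by (simp add: c_def divide_simps) (simp add: eval_nat_numeral)

lemma c_linear_has_integral:
  assumes "0 \<le> x"
  shows "((\<lambda>s. c s * (1 + m * s)) has_integral m * a x) {0..x}"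
proof -
  have "((\<lambda>s. m * (2 * s / (1 + m * s) ^ 3)) has_integral m * a x - m * a 0) {0..x}"
  proof (rule fundamental_theorem_of_calculus[OF assms])
    fix s assume "s \<in> {0..x}"
    then have "((\<lambda>s. m * a s) has_real_derivative m * (2 * s / (1 + m * s) ^ 3)) (at s)"
      by (intro DERIV_cmult a_has_derivative) simp
    then show "((\<lambda>s. m * a s) has_vector_derivative m * (2 * s / (1 + m * s) ^ 3)) (at s within {0..x})"
      by (simp add: has_real_derivative_iff_has_vector_derivative has_vector_derivative_at_within)
  qed
  then have "((\<lambda>s. m * (2 * s / (1 + m * s) ^ 3)) has_integral m * a x) {0..x}"
    by (simp add: a_def)
  then show ?thesis
    by (rule has_integral_eq[rotated]) (simp add: c_times_linear)
qed

text \<open>The function \<open>1 + m x\<close> solves the equation for \<open>\<kappa> = 0\<close>; it bounds the monotone iteration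
  uniformly in \<open>\<kappa>\<close>.\<close>

lemma volterra_linear_le:
  assumes "0 \<le> x"
  shows "volterra (\<lambda>x. 1 + m * x) x \<le> 1 + m * x"
proof (cases "x = 0")
  case False
  then have x: "x > 0" using assms by simp
  have aE: "continuous_on {0..x} (\<lambda>s. m * (E s * a s))"
  proof -
    have "continuous_on {0..x} a"
      using a_has_derivative by (intro DERIV_continuous_on) (auto intro: DERIV_subset)
    moreover have "continuous_on {0..x} E"
      by (rule continuous_on_subset[OF E_continuous]) auto
    ultimately show ?thesis by (intro continuous_intros)
  qed
  \<comment> \<open>For \<open>g = 1 + m x\<close> the derivative of \<open>E a g' = m E a\<close>
    is the static term \<open>E c g\<close> plus \<open>2 \<kappa> m E\<close>. By monotonicity of
    \<open>E\<close> the integral of the latter is at most \<open>2 \<kappa> m x E x\<close>, and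
    division by \<open>2 \<kappa> E x\<close> leaves exactly \<open>m x\<close>. The interior form
    of the fundamental theorem is used because differentiability of \<open>E\<close> is available
    only for positive arguments.\<close>
  have i1: "((\<lambda>s. 2 * \<kappa> * m * E s + E s * (c s * (1 + m * s))) has_integral m * (E x * a x) - m * (E 0 * a 0)) {0..x}"
  proof (rule fundamental_theorem_of_calculus_interior[OF _ aE])
    fix s assume s: "s \<in> {0<..<x}"
    then have "((\<lambda>s. m * (E s * a s)) has_real_derivative
        m * (E s * (2 * s / (1 + m * s) ^ 3) + 2 * \<kappa> * E s / a s * a s)) (at s)"
      by (intro DERIV_cmult DERIV_mult' E_has_derivative a_has_derivative) auto
    then show "((\<lambda>s. m * (E s * a s)) has_vector_derivative 2 * \<kappa> * m * E s + E s * (c s * (1 + m * s))) (at s)"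
      using s a_pos[of s] c_times_linear[of s]
      by (simp add: has_real_derivative_iff_has_vector_derivative algebra_simps)
  qed (use x in auto)
  have i2: "((\<lambda>s. E s * (c s * (1 + m * s))) has_integral integral {0..x} (\<lambda>s. E s * (c s * (1 + m * s)))) {0..x}"
    using admissible_linear assms by (auto simp: admissible_def)
  have "((\<lambda>s. 2 * \<kappa> * m * E s) has_integral m * (E x * a x) - integral {0..x} (\<lambda>s. E s * (c s * (1 + m * s)))) {0..x}"
    using has_integral_diff[OF i1 i2] by (simp add: E_def)
  moreover have "((\<lambda>s. 2 * \<kappa> * m * E x) has_integral x * (2 * \<kappa> * m * E x)) {0..x}"
    using has_integral_const_real[of "2 * \<kappa> * m * E x" 0 x] x by simp
  ultimately have "m * (E x * a x) - integral {0..x} (\<lambda>s. E s * (c s * (1 + m * s))) \<le> x * (2 * \<kappa> * m * E x)"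
    by (rule has_integral_le) (use E_mono \<kappa>_pos m_pos in auto)
  then have "m * a x - integral {0..x} (\<lambda>s. E s * (c s * (1 + m * s))) / E x \<le> x * (2 * \<kappa> * m)"
    using E_pos[OF x] by (simp add: field_simps)
  then show ?thesis
    using \<kappa>_pos c_linear_has_integral[OF assms, THEN integral_unique]
    by (simp add: volterra_def field_simps)
qed (simp add: volterra_0)

lemma volterra_le_linear:
  assumes "admissible h" "0 \<le> x"
  shows "volterra h x \<le> 1 + m * x"
  using volterra_mono[OF assms(1) admissible_linear _ assms(2)] volterra_linear_le[OF assms(2)] assms(1)
  by (force simp: admissible_def)

text \<open>For \<open>x > 0\<close> every term is continuous. At 0 the quotient by \<open>E\<close>
  cannot be treated termwise; there the bounds 1 and \<open>1 + m x\<close> squeeze the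
  function.\<close>

lemma volterra_continuous:
  assumes "admissible h"
  shows "continuous_on {0..} (volterra h)"
proof -
  have pos: "(volterra h \<longlongrightarrow> volterra h x) (at x within {0..})" if x: "x > 0" for x
  proof -
    have i: "(\<lambda>s. c s * h s) integrable_on {0..x + 1}" "(\<lambda>s. E s * (c s * h s)) integrable_on {0..x + 1}"
      using assms x by (auto simp: admissible_def)
    have "continuous_on {0<..<x + 1} (volterra h)"
    proof -
      have "continuous_on {0<..<x + 1} (\<lambda>x. integral {0..x} (\<lambda>s. c s * h s))"
        "continuous_on {0<..<x + 1} (\<lambda>x. integral {0..x} (\<lambda>s. E s * (c s * h s)))"
        "continuous_on {0<..<x + 1} E"
        by (rule continuous_on_subset[OF indefinite_integral_continuous_1[OF i(1)]]
            continuous_on_subset[OF indefinite_integral_continuous_1[OF i(2)]]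
            continuous_on_subset[OF E_continuous]; force)+
      moreover have "\<forall>y\<in>{0<..<x + 1}. E y \<noteq> 0" using E_pos by fastforce
      ultimately show ?thesis
        unfolding volterra_def using \<kappa>_pos by (intro continuous_intros) auto
    qed
    then have "isCont (volterra h) x"
      using x by (simp add: continuous_on_eq_continuous_at)
    then show ?thesis
      by (auto simp: isCont_def intro: tendsto_within_subset[where S=UNIV])
  qed
  have "(volterra h \<longlongrightarrow> 1) (at 0 within {0..})"
  proof (rule tendsto_sandwich)
    show "\<forall>\<^sub>F x in at 0 within {0..}. 1 \<le> volterra h x"
      using volterra_ge_1[OF assms] by (auto simp: eventually_at_filter)
    show "\<forall>\<^sub>F x in at 0 within {0..}. volterra h x \<le> 1 + m * x"
      using volterra_le_linear[OF assms] by (auto simp: eventually_at_filter)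
    show "((\<lambda>x. 1 + m * x) \<longlongrightarrow> 1) (at 0 within {0..})"
      by (auto intro!: tendsto_eq_intros)
  qed auto
  then have "(volterra h \<longlongrightarrow> volterra h x) (at x within {0..})" if "0 \<le> x" for x
    using that pos[of x] by (cases "x = 0") (auto simp: volterra_0)
  then show ?thesis by (simp add: continuous_on_def)
qed

lemma admissible_volterra: "admissible h \<Longrightarrow> admissible (volterra h)"
  by (rule admissible_continuous) (simp_all add: volterra_continuous volterra_ge_1 volterra_le_linear)

text \<open>The kernel is nonnegative, so the iterates of the constant 1 increase, and the
  supersolution \<open>1 + m x\<close> stays above them. The limit inherits bounds free of \<kappa>,
  and the same \<open>1 + m x\<close> dominates the integrands when passing to the limit.\<close>

lemma volterra_fixpoint:
  obtains g where "continuous_on {0..} g" "\<And>x. 0 \<le> x \<Longrightarrow> g x = volterra g x"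
    "\<And>x. 0 \<le> x \<Longrightarrow> 1 \<le> g x" "\<And>x. 0 \<le> x \<Longrightarrow> g x \<le> 1 + m * x"
proof -
  define G where "G n = (volterra ^^ n) (\<lambda>_. 1)" for n :: nat
  have G: "G 0 = (\<lambda>_. 1)" "\<And>n. G (Suc n) = volterra (G n)"
    by (simp_all add: G_def)
  have adm: "admissible (G n)" for n
    by (induction n) (use m_pos in \<open>auto simp: G intro!: admissible_continuous admissible_volterra\<close>)
  have inc: "G n x \<le> G (Suc n) x" if "0 \<le> x" for n x
    using that
  proof (induction n arbitrary: x)
    case 0
    then show ?case using adm[of "Suc 0"] by (simp add: G(1) admissible_def)
  next
    case (Suc n)
    have "volterra (G n) x \<le> volterra (G (Suc n)) x"
      using Suc by (intro volterra_mono adm)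
    then show ?case by (simp only: G(2))
  qed
  define g where "g x = lim (\<lambda>n. G n x)" for x
  have lim: "(\<lambda>n. G n x) \<longlonglongrightarrow> g x" if "0 \<le> x" for x
  proof -
    have "incseq (\<lambda>n. G n x)" using inc[OF that] by (simp add: incseq_Suc_iff)
    moreover have "G n x \<le> 1 + m * x" for n using adm[of n] that by (simp add: admissible_def)
    ultimately show ?thesis
      unfolding g_def by (metis incseq_convergent limI)
  qed
  have g1: "1 \<le> g x" "g x \<le> 1 + m * x" if "0 \<le> x" for x
    using LIMSEQ_le_const[OF lim[OF that]] LIMSEQ_le_const2[OF lim[OF that]] adm that
    by (auto simp: admissible_def)
  have bd: "norm (c s * G n s) \<le> c s * (1 + m * s)" if "0 \<le> s" for n s
    using adm[of n] c_nonneg[OF that] that by (force simp: admissible_def abs_mult intro!: mult_left_mono)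
  have J: "(\<lambda>s. c s * g s) integrable_on {0..x}"
    "(\<lambda>n. integral {0..x} (\<lambda>s. c s * G n s)) \<longlonglongrightarrow> integral {0..x} (\<lambda>s. c s * g s)" if "0 \<le> x" for x
  proof -
    have "(\<lambda>s. c s * G n s) integrable_on {0..x}" "(\<lambda>s. c s * (1 + m * s)) integrable_on {0..x}" for n
      using adm[of n] admissible_linear that by (auto simp: admissible_def)
    moreover have "(\<lambda>n. c s * G n s) \<longlonglongrightarrow> c s * g s" if "s \<in> {0..x}" for s
      using that by (intro tendsto_intros lim) auto
    ultimately show "(\<lambda>s. c s * g s) integrable_on {0..x}"
      "(\<lambda>n. integral {0..x} (\<lambda>s. c s * G n s)) \<longlonglongrightarrow> integral {0..x} (\<lambda>s. c s * g s)"
      using dominated_convergence[of "\<lambda>n s. c s * G n s" "{0..x}" "\<lambda>s. c s * (1 + m * s)" "\<lambda>s. c s * g s"] bd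
      by simp_all
  qed
  have bd2: "norm (E s * (c s * G n s)) \<le> E s * (c s * (1 + m * s))" if "0 \<le> s" for n s
    using bd[OF that, of n] E_nonneg[of s] by (auto simp: abs_mult intro!: mult_left_mono)
  have Q: "(\<lambda>s. E s * (c s * g s)) integrable_on {0..x}"
    "(\<lambda>n. integral {0..x} (\<lambda>s. E s * (c s * G n s))) \<longlonglongrightarrow> integral {0..x} (\<lambda>s. E s * (c s * g s))" if "0 \<le> x" for x
  proof -
    have "(\<lambda>s. E s * (c s * G n s)) integrable_on {0..x}" "(\<lambda>s. E s * (c s * (1 + m * s))) integrable_on {0..x}" for n
      using adm[of n] admissible_linear that by (auto simp: admissible_def)
    moreover have "(\<lambda>n. E s * (c s * G n s)) \<longlonglongrightarrow> E s * (c s * g s)" if "s \<in> {0..x}" for s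
      using that by (intro tendsto_intros lim) auto
    ultimately show "(\<lambda>s. E s * (c s * g s)) integrable_on {0..x}"
      "(\<lambda>n. integral {0..x} (\<lambda>s. E s * (c s * G n s))) \<longlonglongrightarrow> integral {0..x} (\<lambda>s. E s * (c s * g s))"
      using dominated_convergence[of "\<lambda>n s. E s * (c s * G n s)" "{0..x}" "\<lambda>s. E s * (c s * (1 + m * s))" "\<lambda>s. E s * (c s * g s)"] bd2
      by simp_all
  qed
  have admg: "admissible g"
    unfolding admissible_def using J(1) Q(1) g1 by auto
  have fix_g: "g x = volterra g x" if "0 \<le> x" for x
  proof (cases "x = 0")
    case True
    with g1[of 0] show ?thesis by (simp add: volterra_0)
  next
    case False
    then have "E x \<noteq> 0" using that E_pos[of x] by simp
    then have "(\<lambda>n. volterra (G n) x) \<longlonglongrightarrow> volterra g x"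
      unfolding volterra_def using \<kappa>_pos by (intro tendsto_intros J(2) Q(2) that) auto
    moreover have "(\<lambda>n. volterra (G n) x) \<longlonglongrightarrow> g x"
      using LIMSEQ_Suc[OF lim[OF that]] by (simp add: G)
    ultimately show ?thesis by (rule LIMSEQ_unique[rotated])
  qed
  have "continuous_on {0..} g"
    using volterra_continuous[OF admg] by (rule continuous_on_eq) (simp add: fix_g)
  with fix_g g1 that show ?thesis by blast
qed

text \<open>The bounds serve two purposes. Those with explicit constants compare the mode with the
  static one as \<kappa> tends to 0. The constants of the two existential ones may blow up with
  \<kappa>; they only make the energy of a single mode finite at the horizon, where
  \<open>x^2 g'\<close> is \<open>- dg/dr\<close>.\<close>

lemma profile:
  obtains g g' where
    "\<And>x. 0 < x \<Longrightarrow> (g has_real_derivative g' x) (at x)"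
    "\<And>x. 0 < x \<Longrightarrow> (g' has_real_derivative
        (c x * g x - 2 * \<kappa> * g' x - 2 * x / (1 + m * x) ^ 3 * g' x) / a x) (at x)"
    "\<And>x. 0 < x \<Longrightarrow> 1 \<le> g x" "\<And>x. 0 < x \<Longrightarrow> g x \<le> 1 + m * x"
    "\<And>x. 0 < x \<Longrightarrow> 0 \<le> g' x" "\<And>x. 0 < x \<Longrightarrow> g' x \<le> m"
    "\<And>x. 1 / m \<le> x \<Longrightarrow> m\<^sup>2 * (1 / (12 * m) - 2 * \<kappa> * m * x) \<le> g' x"
    "\<exists>C. \<forall>x>0. g x \<le> C" "\<exists>K. \<forall>x>0. x\<^sup>2 * g' x \<le> K"
proof -
  obtain g where cont: "continuous_on {0..} g" and fix_g: "\<And>x. 0 \<le> x \<Longrightarrow> g x = volterra g x"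
    and g1: "\<And>x. 0 \<le> x \<Longrightarrow> 1 \<le> g x" and gu: "\<And>x. 0 \<le> x \<Longrightarrow> g x \<le> 1 + m * x"
    by (rule volterra_fixpoint) blast
  define J where "J x = integral {0..x} (\<lambda>s. c s * g s)" for x
  define Q where "Q x = integral {0..x} (\<lambda>s. E s * (c s * g s))" for x
  define g' where "g' x = Q x / (a x * E x)" for x
  have adm: "admissible g" using cont g1 gu by (rule admissible_continuous)
  have Jint: "((\<lambda>s. c s * g s) has_integral J x) {0..x}"
    and Qint: "((\<lambda>s. E s * (c s * g s)) has_integral Q x) {0..x}" if "0 \<le> x" for x
    using adm that by (auto simp: J_def Q_def admissible_def)
  have contJ: "continuous_on {0..} (\<lambda>s. c s * g s)" and contQ: "continuous_on {0..} (\<lambda>s. E s * (c s * g s))"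
    using cont c_continuous E_continuous by (auto intro!: continuous_intros)
  have dJ: "(J has_real_derivative c x * g x) (at x)"
    and dQ: "(Q has_real_derivative E x * (c x * g x)) (at x)" if "0 < x" for x
  proof -
    have "(J has_real_derivative c x * g x) (at x within {0..x+1})"
      "(Q has_real_derivative E x * (c x * g x)) (at x within {0..x+1})"
      unfolding J_def Q_def using that
      by (auto intro!: integral_has_real_derivative continuous_on_subset[OF contJ] continuous_on_subset[OF contQ])
    then show "(J has_real_derivative c x * g x) (at x)"
      "(Q has_real_derivative E x * (c x * g x)) (at x)"
      using that by (simp_all add: at_within_Icc_at)
  qed
  have g_eq: "g x = 1 + (J x - Q x / E x) / (2 * \<kappa>)" if "0 \<le> x" for x
    using fix_g[OF that] by (simp add: volterra_def J_def Q_def)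
  have dg: "(g has_real_derivative g' x) (at x)" if x: "0 < x" for x
  proof -
    have "((\<lambda>x. 1 + (J x - Q x / E x) / (2 * \<kappa>)) has_real_derivative g' x) (at x)"
      using x a_pos[OF x] E_pos[OF x] \<kappa>_pos
      by (auto intro!: derivative_eq_intros dJ dQ E_has_derivative simp: g'_def field_simps)
    then show ?thesis
      by (rule has_field_derivative_transform_within_open[where S="{0<..}"]) (use x in \<open>auto simp: g_eq\<close>)
  qed
  have dg': "(g' has_real_derivative
        (c x * g x - 2 * \<kappa> * g' x - 2 * x / (1 + m * x) ^ 3 * g' x) / a x) (at x)" if x: "0 < x" for x
  proof -
    have alg: "(e * cg * (A * e) - q * (A * (2 * \<kappa> * e / A) + a' * e)) / (A * e * (A * e))
        = (cg - 2 * \<kappa> * (q / (A * e)) - a' * (q / (A * e))) / A"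
      if "A > 0" "e > 0" for A e q a' cg :: real
      using that by (simp add: divide_simps) algebra
    have "(g' has_real_derivative ((E x * (c x * g x) * (a x * E x)
        - Q x * (a x * (2 * \<kappa> * E x / a x) + 2 * x / (1 + m * x) ^ 3 * E x)) / (a x * E x * (a x * E x)))) (at x)"
      unfolding g'_def[abs_def] using x a_pos[OF x] E_pos[OF x]
      by (intro DERIV_divide dQ DERIV_mult' E_has_derivative a_has_derivative) auto
    then show ?thesis
      unfolding alg[OF a_pos[OF x] E_pos[OF x]] by (simp add: g'_def)
  qed
  have Qnn: "0 \<le> Q x" if "0 \<le> x" for x
    by (rule has_integral_nonneg[OF Qint[OF that]]) (use E_nonneg c_nonneg g1 in \<open>force intro!: mult_nonneg_nonneg\<close>)
  have Q_le: "Q x \<le> E x * (m * a x)" if "0 \<le> x" for x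
  proof (rule has_integral_le[OF Qint[OF that] has_integral_mult_right[OF c_linear_has_integral[OF that]]])
    fix s assume "s \<in> {0..x}"
    then show "E s * (c s * g s) \<le> E x * (c s * (1 + m * s))"
      using E_mono[of s x] E_nonneg c_nonneg[of s] g1[of s] gu[of s]
      by (intro mult_mono mult_left_mono mult_nonneg_nonneg) auto
  qed
  have J_le: "J x \<le> m * a x" if "0 \<le> x" for x
    by (rule has_integral_le[OF Jint[OF that] c_linear_has_integral[OF that]])
      (use gu c_nonneg in \<open>auto intro!: mult_left_mono\<close>)
  have a_le: "a x \<le> 1 / m\<^sup>2" if "0 \<le> x" for x
  proof -
    have "(m * x)\<^sup>2 \<le> (1 + m * x)\<^sup>2" using m_pos that by (intro power_mono) auto
    then show ?thesis
      using one_mx_pos[OF that] m_pos by (simp add: a_def field_simps power_mult_distrib)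
  qed
  have g'_nn: "0 \<le> g' x" if "0 < x" for x
    using Qnn[of x] a_pos[OF that] E_nonneg[of x] that by (simp add: g'_def)
  have g'_le: "g' x \<le> m" if "0 < x" for x
    using Q_le[of x] a_pos[OF that] E_pos[OF that] that by (simp add: g'_def field_simps)
  \<comment> \<open>In \<open>a g' = J - 2 \<kappa> (g - 1)\<close> one has
    \<open>g - 1 \<le> m x\<close> and \<open>a \<le> 1 / m^2\<close>, and \<open>J\<close> is at
    least the integral of \<open>c\<close>. The primitive \<open>F\<close> of \<open>c\<close> rises
    from 0 towards \<open>1 / (3 m)\<close> and exceeds \<open>1 / (12 m)\<close> once
    \<open>m x \<ge> 1\<close>.\<close>
  have low: "m\<^sup>2 * (1 / (12 * m) - 2 * \<kappa> * m * x) \<le> g' x" if "1 / m \<le> x" for x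
  proof -
    have mx: "1 \<le> m * x" using that m_pos by (simp add: field_simps)
    have x: "0 < x" using that m_pos by (meson divide_pos_pos less_le_trans zero_less_one)
    define F where "F s = m / 3 * (s\<^sup>2 * (3 + m * s) / (1 + m * s) ^ 3)" for s
    have "(c has_integral F x - F 0) {0..x}"
    proof (rule fundamental_theorem_of_calculus)
      fix s assume "s \<in> {0..x}"
      then have "(F has_real_derivative c s) (at s)"
        unfolding F_def[abs_def] c_def using one_mx_pos[of s]
        by (auto intro!: derivative_eq_intros simp: divide_simps) algebra
      then show "(F has_vector_derivative c s) (at s within {0..x})"
        by (simp add: has_real_derivative_iff_has_vector_derivative has_vector_derivative_at_within)
    qed (use x in auto)
    then have "F x - F 0 \<le> J x"
      by (rule has_integral_le[OF _ Jint]) (use x c_nonneg g1 in \<open>auto simp: mult_le_cancel_left1 not_le[symmetric]\<close>)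
    moreover have "1 / (12 * m) \<le> F x"
    proof -
      have "(1 + m * x) ^ 3 = (1 + m * x)\<^sup>2 * (1 + m * x)" by (simp add: power3_eq_cube power2_eq_square)
      also have "\<dots> \<le> (2 * (m * x))\<^sup>2 * (3 + m * x)"
        using mx by (intro mult_mono power_mono) auto
      finally show ?thesis
        using m_pos one_mx_pos[of x] x by (simp add: F_def field_simps power2_eq_square)
    qed
    ultimately have J: "1 / (12 * m) \<le> J x" by (simp add: F_def)
    have "a x * g' x = J x - 2 * \<kappa> * (g x - 1)"
      using g_eq[of x] x a_pos[OF x] E_pos[OF x] \<kappa>_pos by (simp add: g'_def)
    moreover have "2 * \<kappa> * (g x - 1) \<le> 2 * \<kappa> * (m * x)"
      using gu[of x] x \<kappa>_pos by (intro mult_left_mono) auto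
    ultimately have "1 / (12 * m) - 2 * \<kappa> * m * x \<le> a x * g' x" using J by simp
    also have "\<dots> \<le> 1 / m\<^sup>2 * g' x"
      using a_le[of x] g'_nn x by (intro mult_right_mono) auto
    finally show ?thesis using m_pos by (simp add: field_simps)
  qed
  define C where "C = 1 + 1 / (2 * \<kappa> * m)"
  have gC: "g x \<le> C" if "0 < x" for x
  proof -
    have "g x \<le> 1 + J x / (2 * \<kappa>)"
    proof -
      have "0 \<le> Q x / E x" using Qnn[of x] E_pos[OF that] that by simp
      then have "(J x - Q x / E x) / (2 * \<kappa>) \<le> J x / (2 * \<kappa>)"
        using \<kappa>_pos by (intro divide_right_mono) auto
      then show ?thesis using g_eq[of x] that by simp
    qed
    also have "\<dots> \<le> 1 + (m * (1 / m\<^sup>2)) / (2 * \<kappa>)"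
      using order.trans[OF J_le mult_left_mono[OF a_le]] that m_pos \<kappa>_pos
      by (intro add_left_mono divide_right_mono) auto
    finally show ?thesis using m_pos by (simp add: C_def power2_eq_square mult.commute)
  qed
  have Cpos: "C > 0" unfolding C_def using m_pos \<kappa>_pos by (simp add: add_pos_pos)
  \<comment> \<open>A barrier argument: \<open>x^2 g' = (1 + m x)^2 Q / E\<close>, so
    \<open>x^2 g' \<le> K\<close> is equivalent to \<open>\<Theta> x \<ge> 0\<close>. The choice of
    \<open>x0\<close> makes the negative term in the derivative of \<open>E / (1 + m x)^2\<close>
    consume at most half of the positive term \<open>2 \<kappa> / x^2\<close>. The second summand of
    \<open>K\<close> lets the other half dominate \<open>c g\<close>; the first one makes
    \<open>\<Theta> x0\<close> nonnegative. Below \<open>x0\<close> the bound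
    \<open>g' \<le> m\<close> suffices.\<close>
  define x0 where "x0 = 2 / (\<kappa> * m\<^sup>2)"
  define K where "K = (1 + m * x0)\<^sup>2 / m + 2 * C / (\<kappa> * m ^ 3 * x0)"
  have x0: "x0 > 0" using m_pos \<kappa>_pos by (simp add: x0_def)
  have K: "K > 0" "(1 + m * x0)\<^sup>2 / m \<le> K" "2 * C / (\<kappa> * m ^ 3 * x0) \<le> K"
    using m_pos \<kappa>_pos x0 Cpos by (auto simp: K_def intro!: add_nonneg_pos)
  define \<Theta> where "\<Theta> x = K * (E x / (1 + m * x)\<^sup>2) - Q x" for x
  have \<Theta>: "0 \<le> \<Theta> x" if "x0 \<le> x" for x
  proof -
    have "\<Theta> x0 \<le> \<Theta> x"
    proof (rule DERIV_nonneg_imp_nondecreasing[OF that])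
      fix y assume "x0 \<le> y"
      then have y: "0 < y" using x0 by simp
      have my: "0 < m * y" using m_pos y by simp
      have d: "(\<Theta> has_real_derivative K * (E y * (2 * \<kappa> / y\<^sup>2 - 2 * m / (1 + m * y) ^ 3)) - E y * (c y * g y)) (at y)"
      proof -
        have "((\<lambda>x. E x / (1 + m * x)\<^sup>2) has_real_derivative
            (2 * \<kappa> * E y / a y * (1 + m * y)\<^sup>2 - E y * (2 * (1 + m * y) * m)) / ((1 + m * y)\<^sup>2 * (1 + m * y)\<^sup>2)) (at y)"
          using my by (auto intro!: derivative_eq_intros E_has_derivative y)
        moreover have "(2 * \<kappa> * E y / a y * (1 + m * y)\<^sup>2 - E y * (2 * (1 + m * y) * m)) / ((1 + m * y)\<^sup>2 * (1 + m * y)\<^sup>2)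
            = E y * (2 * \<kappa> / y\<^sup>2 - 2 * m / (1 + m * y) ^ 3)"
          using y one_mx_pos[of y] by (simp add: a_def divide_simps) algebra
        ultimately show ?thesis
          unfolding \<Theta>_def[abs_def] by (intro DERIV_diff DERIV_cmult dQ y) auto
      qed
      have pw: "(m * y) ^ n \<le> (1 + m * y) ^ n" for n using my by (intro power_mono) auto
      have "2 * m / (1 + m * y) ^ 3 \<le> 2 * m / (m * y) ^ 3"
        using my m_pos pw[of 3] by (intro divide_left_mono) auto
      also have "\<dots> = \<kappa> / y\<^sup>2 * (x0 / y)"
        using y m_pos \<kappa>_pos by (simp add: x0_def field_simps eval_nat_numeral)
      also have "\<dots> \<le> \<kappa> / y\<^sup>2 * 1"
        using \<open>x0 \<le> y\<close> y \<kappa>_pos by (intro mult_left_mono) auto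
      finally have 1: "\<kappa> / y\<^sup>2 \<le> 2 * \<kappa> / y\<^sup>2 - 2 * m / (1 + m * y) ^ 3" by simp
      have "0 < (1 + m * y) ^ 4 * (m * y) ^ 4" using my one_mx_pos[of y] y by (simp only: zero_less_power mult_pos_pos less_imp_le)
      then have "c y \<le> 2 * m * y / (m * y) ^ 4"
        unfolding c_def using pw[of 4] m_pos y by (intro divide_left_mono) simp_all
      then have "c y * g y \<le> 2 * m * y / (m * y) ^ 4 * C"
        using my m_pos y gC[OF y] g1[of y] by (intro mult_mono) auto
      also have "\<dots> = \<kappa> / y\<^sup>2 * (2 * C / (\<kappa> * m ^ 3 * y))"
        using y m_pos \<kappa>_pos by (simp add: field_simps eval_nat_numeral)
      also have "\<dots> \<le> \<kappa> / y\<^sup>2 * (2 * C / (\<kappa> * m ^ 3 * x0))"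
        using \<open>x0 \<le> y\<close> y x0 m_pos \<kappa>_pos Cpos by (intro mult_left_mono divide_left_mono) auto
      also have "\<dots> \<le> \<kappa> / y\<^sup>2 * K"
        using K(3) y \<kappa>_pos by (intro mult_left_mono) auto
      finally have 2: "c y * g y \<le> K * (\<kappa> / y\<^sup>2)" by (simp add: mult.commute)
      also have "\<dots> \<le> K * (2 * \<kappa> / y\<^sup>2 - 2 * m / (1 + m * y) ^ 3)"
        using 1 K(1) by (intro mult_left_mono) auto
      finally have "E y * (c y * g y) \<le> E y * (K * (2 * \<kappa> / y\<^sup>2 - 2 * m / (1 + m * y) ^ 3))"
        using E_nonneg by (intro mult_left_mono)
      with d show "\<exists>d. (\<Theta> has_real_derivative d) (at y) \<and> 0 \<le> d"
        by (intro exI[of _ "K * (E y * (2 * \<kappa> / y\<^sup>2 - 2 * m / (1 + m * y) ^ 3)) - E y * (c y * g y)"])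
          (simp add: algebra_simps)
    qed
    moreover have "0 \<le> \<Theta> x0"
    proof -
      have "Q x0 \<le> E x0 * (m * (1 / m\<^sup>2))"
        using order.trans[OF Q_le mult_left_mono[OF mult_left_mono[OF a_le]]] x0 m_pos E_nonneg by auto
      also have "\<dots> = (1 + m * x0)\<^sup>2 / m * (E x0 / (1 + m * x0)\<^sup>2)"
        using m_pos one_mx_pos[of x0] x0 by (simp add: power2_eq_square)
      also have "\<dots> \<le> K * (E x0 / (1 + m * x0)\<^sup>2)"
        using K(2) E_nonneg by (intro mult_right_mono) auto
      finally show ?thesis by (simp add: \<Theta>_def)
    qed
    ultimately show ?thesis by simp
  qed
  have "x\<^sup>2 * g' x \<le> max K (x0\<^sup>2 * m)" if x: "0 < x" for x
  proof (cases "x0 \<le> x")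
    case True
    have "Q x * (1 + m * x)\<^sup>2 \<le> K * E x"
      using \<Theta>[OF True] one_mx_pos[of x] x by (simp add: \<Theta>_def field_simps)
    then have "x\<^sup>2 * g' x \<le> K"
      using x E_pos[OF x] one_mx_pos[of x] by (simp add: g'_def a_def field_simps)
    then show ?thesis by simp
  next
    case False
    then have "x\<^sup>2 * g' x \<le> x0\<^sup>2 * m"
      using x g'_nn[OF x] g'_le[OF x] by (intro mult_mono power_mono) auto
    then show ?thesis by simp
  qed
  then have "\<exists>K. \<forall>x>0. x\<^sup>2 * g' x \<le> K" by blast
  moreover have "\<exists>C. \<forall>x>0. g x \<le> C" using gC by blast
  ultimately show ?thesis
    using that[of g g'] dg dg' g1 gu g'_nn g'_le low by simp
qed

text \<open>Return from \<open>x\<close> to \<open>r\<close>. The upper bounds are those of the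
  static solution \<open>1 / (r - m)\<close>; the lower one says that \<open>S'\<close> remains
  comparable to the static derivative down to the distance \<open>48 m^2 \<kappa>\<close> from the
  horizon, where \<kappa> begins to matter.\<close>

lemma radial_solution:
  obtains S S' where
    "\<And>r. m < r \<Longrightarrow> (S has_real_derivative S' r) (at r)"
    "\<And>r. m < r \<Longrightarrow> (S' has_real_derivative
        (2 * \<kappa> * r * (r * S' r + S r) - 2 * (r - m) * S' r) / (r - m)\<^sup>2) (at r)"
    "\<And>r. m < r \<Longrightarrow> 0 \<le> S r" "\<And>r. m < r \<Longrightarrow> S r \<le> 1 / (r - m)"
    "\<And>r. m < r \<Longrightarrow> S' r \<le> 0" "\<And>r. m < r \<Longrightarrow> - S' r \<le> 1 / (r - m)\<^sup>2"
    "\<And>r. m < r \<Longrightarrow> r \<le> 2 * m \<Longrightarrow> 48 * m\<^sup>2 * \<kappa> \<le> r - m \<Longrightarrow> 1 / (48 * (r - m)\<^sup>2) \<le> - S' r"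
    "\<exists>K. \<forall>r>m. S r \<le> K \<and> - S' r \<le> K"
proof -
  obtain g g' where dg: "\<And>x. 0 < x \<Longrightarrow> (g has_real_derivative g' x) (at x)"
    and dg': "\<And>x. 0 < x \<Longrightarrow> (g' has_real_derivative
        (c x * g x - 2 * \<kappa> * g' x - 2 * x / (1 + m * x) ^ 3 * g' x) / a x) (at x)"
    and g1: "\<And>x. 0 < x \<Longrightarrow> 1 \<le> g x" and gu: "\<And>x. 0 < x \<Longrightarrow> g x \<le> 1 + m * x"
    and g'_nn: "\<And>x. 0 < x \<Longrightarrow> 0 \<le> g' x" and g'_le: "\<And>x. 0 < x \<Longrightarrow> g' x \<le> m"
    and low: "\<And>x. 1 / m \<le> x \<Longrightarrow> m\<^sup>2 * (1 / (12 * m) - 2 * \<kappa> * m * x) \<le> g' x"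
    and bounded_g: "\<exists>C. \<forall>x>0. g x \<le> C" and bounded_g': "\<exists>K. \<forall>x>0. x\<^sup>2 * g' x \<le> K"
    by (rule profile) blast
  define S where "S r = g (1 / (r - m)) / r" for r
  define S' where "S' r = - (g' (1 / (r - m)) / ((r - m)\<^sup>2 * r)) - g (1 / (r - m)) / r\<^sup>2" for r
  show ?thesis
  proof (rule that[of S S'])
    fix r assume r: "m < r"
    then have x: "0 < 1 / (r - m)" and r0: "0 < r" using m_pos by auto
    define x where "x = 1 / (r - m)"
    have x0: "x > 0" using x by (simp add: x_def)
    have rx: "r - m = 1 / x" "r = (1 + m * x) / x" using r by (auto simp: x_def field_simps)
    have dx: "((\<lambda>r. 1 / (r - m)) has_real_derivative - (x\<^sup>2)) (at r)"
      using r by (auto intro!: derivative_eq_intros simp: x_def field_simps power2_eq_square)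
    have dgr: "((\<lambda>r. g (1 / (r - m))) has_real_derivative g' x * (- (x\<^sup>2))) (at r)"
      using DERIV_chain2[OF dg[OF x] dx] by (simp add: x_def)
    show "(S has_real_derivative S' r) (at r)"
    proof -
      have "(S has_real_derivative (g' x * (- (x\<^sup>2)) * r - g x * 1) / (r * r)) (at r)"
        unfolding S_def[abs_def] using DERIV_divide[OF dgr DERIV_ident] r0 by (simp add: x_def)
      moreover have "(g' x * (- (x\<^sup>2)) * r - g x * 1) / (r * r) = S' r"
        using r0 r by (simp add: S'_def x_def divide_simps) algebra
      ultimately show ?thesis by simp
    qed
    show "(S' has_real_derivative
        (2 * \<kappa> * r * (r * S' r + S r) - 2 * (r - m) * S' r) / (r - m)\<^sup>2) (at r)"
    proof -
      define g'' where "g'' = (c x * g x - 2 * \<kappa> * g' x - 2 * x / (1 + m * x) ^ 3 * g' x) / a x"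
      have dg'r: "((\<lambda>r. g' (1 / (r - m))) has_real_derivative g'' * (- (x\<^sup>2))) (at r)"
        using DERIV_chain2[OF dg'[OF x] dx] by (simp add: x_def g''_def)
      have "(S' has_real_derivative
          - ((g'' * (- (x\<^sup>2)) * ((r - m)\<^sup>2 * r) - g' x * (2 * (r - m) * r + (r - m)\<^sup>2)) / ((r - m)\<^sup>2 * r)\<^sup>2)
          - (g' x * (- (x\<^sup>2)) * r\<^sup>2 - g x * (2 * r)) / (r\<^sup>2)\<^sup>2) (at r)"
        unfolding S'_def[abs_def] using r r0
        by (auto intro!: derivative_eq_intros dgr dg'r simp: x_def[symmetric] power2_eq_square)
      moreover have "- ((g'' * (- (x\<^sup>2)) * ((r - m)\<^sup>2 * r) - g' x * (2 * (r - m) * r + (r - m)\<^sup>2)) / ((r - m)\<^sup>2 * r)\<^sup>2)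
          - (g' x * (- (x\<^sup>2)) * r\<^sup>2 - g x * (2 * r)) / (r\<^sup>2)\<^sup>2
          = (2 * \<kappa> * r * (r * S' r + S r) - 2 * (r - m) * S' r) / (r - m)\<^sup>2"
      proof -
        define y where "y = 1 + m * x"
        have y: "y > 0" using one_mx_pos[of x] x0 by (simp add: y_def)
        have mx: "m * x = y - 1" by (simp add: y_def)
        have g'': "g'' = (2 * (y - 1) / y ^ 4 * g x - 2 * \<kappa> * g' x - 2 * x / y ^ 3 * g' x) / (x\<^sup>2 / y\<^sup>2)"
          unfolding g''_def c_def a_def y_def by (simp add: mult.assoc)
        have S: "S r = g x / r" and S': "S' r = - (g' x / ((r - m)\<^sup>2 * r)) - g x / r\<^sup>2"
          by (simp_all add: S_def S'_def x_def)
        have ry: "r = y / x" using rx(2) by (simp add: y_def)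
        show ?thesis
          unfolding S S' g'' unfolding rx(1) unfolding ry using y x0
          by (simp add: field_simps) algebra
      qed
      ultimately show ?thesis by simp
    qed
    show "0 \<le> S r" using g1[OF x] r0 by (simp add: S_def)
    show "S r \<le> 1 / (r - m)"
      using gu[OF x] r0 r by (simp add: S_def field_simps)
    show "S' r \<le> 0"
    proof -
      have "0 \<le> g' (1 / (r - m)) / ((r - m)\<^sup>2 * r)" "0 \<le> g (1 / (r - m)) / r\<^sup>2"
        using g1[OF x] g'_nn[OF x] r0 by auto
      then show ?thesis by (simp add: S'_def)
    qed
    have S'_eq: "- S' r * (r - m)\<^sup>2 = g' x / r + g x * ((r - m)\<^sup>2 / r\<^sup>2)"
      using r r0 by (simp add: S'_def x_def field_simps)
    \<comment> \<open>The two summands are bounded by their values for \<open>g = 1 + m x\<close>,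
      that is, for \<open>S = 1 / (r - m)\<close>; these are \<open>m / r\<close> and
      \<open>1 - m / r\<close>, which add up to exactly 1.\<close>
    have "g' x / r \<le> m / r" using g'_le[OF x0] r0 by (simp add: divide_right_mono)
    moreover have "g x * ((r - m)\<^sup>2 / r\<^sup>2) \<le> (r / (r - m)) * ((r - m)\<^sup>2 / r\<^sup>2)"
      using gu[OF x0] r by (intro mult_right_mono) (auto simp: x_def field_simps)
    moreover have "(r / (r - m)) * ((r - m)\<^sup>2 / r\<^sup>2) = 1 - m / r"
      using r r0 by (simp add: field_simps power2_eq_square)
    ultimately have "- S' r * (r - m)\<^sup>2 \<le> 1" unfolding S'_eq by linarith
    then show "- S' r \<le> 1 / (r - m)\<^sup>2" using r by (simp add: field_simps)
    \<comment> \<open>The threshold makes \<open>2 \<kappa> m x\<close> at most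
      \<open>1 / (24 m)\<close>, half of the main term \<open>1 / (12 m)\<close>. This leaves
      \<open>g' \<ge> m / 24\<close>, and division by \<open>r \<le> 2 m\<close> gives
      \<open>1 / 48\<close>.\<close>
    show "1 / (48 * (r - m)\<^sup>2) \<le> - S' r" if "r \<le> 2 * m" "48 * m\<^sup>2 * \<kappa> \<le> r - m"
    proof -
      have "1 / m \<le> x" using that r m_pos by (simp add: x_def field_simps)
      from low[OF this] have l: "m\<^sup>2 * (1 / (12 * m) - 2 * \<kappa> * m * x) \<le> g' x" .
      have "2 * \<kappa> * m * x \<le> 1 / (24 * m)"
        using that(2) r m_pos by (simp add: x_def field_simps power2_eq_square)
      then have "m\<^sup>2 * (1 / (12 * m) - 1 / (24 * m)) \<le> m\<^sup>2 * (1 / (12 * m) - 2 * \<kappa> * m * x)"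
        using m_pos by (intro mult_left_mono) auto
      from order.trans[OF this l] have "m / 24 \<le> g' x"
        using m_pos by (simp add: field_simps power2_eq_square)
      then have "(m / 24) / (2 * m) \<le> g' x / r"
        using that m_pos r0 by (intro frac_le) auto
      moreover have "(m / 24) / (2 * m) = 1 / 48" using m_pos by simp
      moreover have "0 \<le> g x * ((r - m)\<^sup>2 / r\<^sup>2)" using g1[OF x0] by simp
      ultimately have "1 / 48 \<le> - S' r * (r - m)\<^sup>2" unfolding S'_eq by linarith
      then show ?thesis using r by (simp add: field_simps)
    qed
  next
    obtain C K where C: "\<And>x. 0 < x \<Longrightarrow> g x \<le> C" and K: "\<And>x. 0 < x \<Longrightarrow> x\<^sup>2 * g' x \<le> K"
      using bounded_g bounded_g' by blast
    have "S r \<le> C / m \<and> - S' r \<le> K / m + C / m\<^sup>2" if r: "m < r" for r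
    proof -
      have x: "0 < 1 / (r - m)" using r by simp
      have "S r \<le> C / m"
        unfolding S_def using C[OF x] g1[OF x] r m_pos by (intro frac_le) auto
      moreover have "(1 / (r - m))\<^sup>2 * g' (1 / (r - m)) / r \<le> K / m"
        using K[OF x] order.trans[OF mult_nonneg_nonneg[OF zero_le_power2 g'_nn[OF x]] K[OF x]] r m_pos
        by (intro frac_le) auto
      moreover have "g (1 / (r - m)) / r\<^sup>2 \<le> C / m\<^sup>2"
        using C[OF x] g1[OF x] r m_pos by (intro frac_le power_mono) auto
      ultimately show ?thesis by (simp add: S'_def power_divide)
    qed
    then show "\<exists>K. \<forall>r>m. S r \<le> K \<and> - S' r \<le> K"
      by (intro exI[of _ "max (C / m) (K / m + C / m\<^sup>2)"]) (auto simp: le_max_iff_disj)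
  qed
qed

end

section \<open>The Kerr-Schild form of the metric\<close>

lemma det_4:
  "det (A :: 'a::comm_ring_1^4^4) =
     A$1$1 * (A$2$2 * (A$3$3 * A$4$4 - A$3$4 * A$4$3) - A$2$3 * (A$3$2 * A$4$4 - A$3$4 * A$4$2) + A$2$4 * (A$3$2 * A$4$3 - A$3$3 * A$4$2))
   - A$1$2 * (A$2$1 * (A$3$3 * A$4$4 - A$3$4 * A$4$3) - A$2$3 * (A$3$1 * A$4$4 - A$3$4 * A$4$1) + A$2$4 * (A$3$1 * A$4$3 - A$3$3 * A$4$1))
   + A$1$3 * (A$2$1 * (A$3$2 * A$4$4 - A$3$4 * A$4$2) - A$2$2 * (A$3$1 * A$4$4 - A$3$4 * A$4$1) + A$2$4 * (A$3$1 * A$4$2 - A$3$2 * A$4$1))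
   - A$1$4 * (A$2$1 * (A$3$2 * A$4$3 - A$3$3 * A$4$2) - A$2$2 * (A$3$1 * A$4$3 - A$3$3 * A$4$1) + A$2$3 * (A$3$1 * A$4$2 - A$3$2 * A$4$1))"
proof -
  have f1: "finite {2::4, 3, 4}" "1 \<notin> {2::4, 3, 4}" and f2: "finite {3::4, 4}" "2 \<notin> {3::4, 4}"
    and f3: "finite {4::4}" "3 \<notin> {4::4}"
    by auto
  show ?thesis
    unfolding det_def UNIV_4
    unfolding sum_over_permutations_insert[OF f1] sum_over_permutations_insert[OF f2]
      sum_over_permutations_insert[OF f3] permutes_sing
    by (simp add: sign_swap_id permutation_swap_id sign_compose sign_id swap_id_eq permutation_compose field_simps)
qed

lemma rad_power2: "(rad p)\<^sup>2 = (p$2)\<^sup>2 + (p$3)\<^sup>2 + (p$4)\<^sup>2"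
  by (simp add: rad_def)

lemma dr_form_nth: "dr_form p $ 1 = 0" "dr_form p $ 2 = p$2 / rad p"
   "dr_form p $ 3 = p$3 / rad p" "dr_form p $ 4 = p$4 / rad p"
  by (simp_all add: dr_form_def)

lemma dr_form_unit:
  assumes "rad p > 0"
  shows "(dr_form p $ 2)\<^sup>2 + (dr_form p $ 3)\<^sup>2 + (dr_form p $ 4)\<^sup>2 = 1"
  using assms by (simp add: dr_form_nth power_divide add_divide_distrib[symmetric] rad_power2[symmetric])

definition radial :: "real^4 \<Rightarrow> real^4 \<Rightarrow> real" where
  "radial p X = dr_form p $ 2 * X $ 2 + dr_form p $ 3 * X $ 3 + dr_form p $ 4 * X $ 4"

text \<open>The metric is of Kerr-Schild form \<open>\<eta> + (1 - D) (dt\<^sup>* + dr)\<^sup>2\<close>; hence its determinant is \<open>-1\<close>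
  and its inverse is \<open>\<eta> - (1 - D) L \<otimes> L\<close> with the null vector \<open>L = dr - dt\<^sup>*\<close>.\<close>

lemma metric_ip_ern:
  "metric_ip (ern_metric m p) X Y = - X$1 * Y$1 + X$2 * Y$2 + X$3 * Y$3 + X$4 * Y$4
     + (1 - ern_D m (rad p)) * (X$1 + radial p X) * (Y$1 + radial p Y)"
  unfolding metric_ip_def ern_metric_def sum_4 Let_def radial_def
  by (simp add: dt_form_def axis_def dr_form_nth(1) algebra_simps)

definition ern_inverse :: "real \<Rightarrow> real^4 \<Rightarrow> real^4^4" where
  "ern_inverse m p = (\<chi> i j. (if i = j then if i = 1 then - 1 else 1 else 0)
     - (1 - ern_D m (rad p)) * (dr_form p $ i - dt_form $ i) * (dr_form p $ j - dt_form $ j))"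

lemma metric_mult_inverse:
  assumes "rad p > 0"
  shows "ern_metric m p ** ern_inverse m p = mat 1"
proof -
  define e where "e = dr_form p"
  define F where "F = ern_D m (rad p)"
  have e: "e $ 1 = 0" "e $ 2 * e $ 2 = 1 - e $ 3 * e $ 3 - e $ 4 * e $ 4"
    using dr_form_unit[OF assms] by (auto simp: e_def dr_form_nth(1) power2_eq_square)
  show ?thesis
    unfolding matrix_matrix_mult_def mat_def vec_eq_iff ern_metric_def ern_inverse_def sum_4 Let_def
      e_def[symmetric] F_def[symmetric] forall_4
    apply (simp add: dt_form_def axis_def e(1))
    apply (intro conjI)
    using e(2) by algebra+
qed

lemma matrix_inv_unique:
  fixes A B :: "real^'n^'n"
  assumes "A ** B = mat 1"
  shows "matrix_inv A = B"
proof -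
  have BA: "B ** A = mat 1" using assms by (simp add: matrix_left_right_inverse)
  then have "A ** matrix_inv A = mat 1"
    unfolding matrix_inv_def using assms by (metis (mono_tags, lifting) someI_ex)
  then have "B ** (A ** matrix_inv A) = B" by simp
  then show ?thesis by (simp add: matrix_mul_assoc BA)
qed

lemma matrix_inv_ern: "rad p > 0 \<Longrightarrow> matrix_inv (ern_metric m p) = ern_inverse m p"
  by (intro matrix_inv_unique metric_mult_inverse)

lemma det_ern:
  assumes "rad p > 0"
  shows "det (ern_metric m p) = -1"
proof -
  define e where "e = dr_form p"
  define F where "F = ern_D m (rad p)"
  have e: "e $ 1 = 0" "e $ 2 * e $ 2 = 1 - e $ 3 * e $ 3 - e $ 4 * e $ 4"
    using dr_form_unit[OF assms] by (auto simp: e_def dr_form_nth(1) power2_eq_square)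
  show ?thesis
    unfolding det_4 ern_metric_def Let_def e_def[symmetric] F_def[symmetric]
    apply (simp add: dt_form_def axis_def e(1))
    using e(2) by algebra
qed

section \<open>Raising indices, the field \<open>N\<close> and the unit normal\<close>

lemma ern_D_bounds:
  assumes "0 < m" "m < r"
  shows "0 \<le> ern_D m r" "ern_D m r \<le> 1"
proof -
  have "(r - m)\<^sup>2 \<le> r\<^sup>2" using assms by (intro power_mono) auto
  then show "0 \<le> ern_D m r" "ern_D m r \<le> 1" using assms by (auto simp: ern_D_def)
qed

text \<open>In Kerr-Schild form, \<open>l\<close> is \<open>1 - D\<close> times the pairing of
  \<alpha> with the null vector \<open>L\<close>; raising an index is the Minkowski operation
  followed by subtraction of \<open>l L\<close>.\<close>

lemma sharp_ern_nth:
  fixes m :: real and p \<alpha> :: "real^4" and i :: 4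
  assumes "rad p > 0"
  defines "l \<equiv> (1 - ern_D m (rad p)) * (radial p \<alpha> - \<alpha> $ 1)"
  shows "sharp (ern_metric m p) \<alpha> $ 1 = l - \<alpha> $ 1"
    and "i \<noteq> 1 \<Longrightarrow> sharp (ern_metric m p) \<alpha> $ i = \<alpha> $ i - l * dr_form p $ i"
    and "radial p (sharp (ern_metric m p) \<alpha>) = radial p \<alpha> - l"
proof -
  define e where "e = dr_form p"
  have e: "e $ 1 = 0" "e $ 2 * e $ 2 = 1 - e $ 3 * e $ 3 - e $ 4 * e $ 4"
    using dr_form_unit[OF assms(1)] by (auto simp: e_def dr_form_nth(1) power2_eq_square)
  have s: "sharp (ern_metric m p) \<alpha> $ 1 = l - \<alpha> $ 1"
    "sharp (ern_metric m p) \<alpha> $ 2 = \<alpha> $ 2 - l * e $ 2"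
    "sharp (ern_metric m p) \<alpha> $ 3 = \<alpha> $ 3 - l * e $ 3"
    "sharp (ern_metric m p) \<alpha> $ 4 = \<alpha> $ 4 - l * e $ 4"
    unfolding sharp_def matrix_inv_ern[OF assms(1)] matrix_vector_mult_def ern_inverse_def sum_4 l_def radial_def
      e_def[symmetric]
    by (simp_all add: dt_form_def axis_def e(1) algebra_simps)
  show "sharp (ern_metric m p) \<alpha> $ 1 = l - \<alpha> $ 1" by (rule s)
  show "sharp (ern_metric m p) \<alpha> $ i = \<alpha> $ i - l * dr_form p $ i" if "i \<noteq> 1"
    using s that exhaust_4[of i] by (auto simp: e_def)
  show "radial p (sharp (ern_metric m p) \<alpha>) = radial p \<alpha> - l"
    unfolding radial_def s e_def[symmetric] using e(2) by algebra
qed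

lemma metric_ip_sharp:
  assumes "rad p > 0"
  shows "metric_ip (ern_metric m p) (sharp (ern_metric m p) \<alpha>) Y = (\<Sum>i\<in>UNIV. \<alpha> $ i * Y $ i)"
  unfolding metric_ip_ern sharp_ern_nth(3)[OF assms] sharp_ern_nth(1)[OF assms] sum_4
  by (simp add: sharp_ern_nth(2)[OF assms] radial_def algebra_simps)

lemma ern_N_nth:
  assumes "rad p > 0"
  shows "ern_N m p $ 1 = 2 - ern_D m (rad p)" "radial p (ern_N m p) = - (1 - ern_D m (rad p))"
proof -
  have "radial p dt_form = 0" "dt_form $ 1 = 1" by (simp_all add: radial_def dt_form_def axis_def)
  moreover have "radial p (- X) = - radial p X" for X by (simp add: radial_def)
  ultimately show "ern_N m p $ 1 = 2 - ern_D m (rad p)" "radial p (ern_N m p) = - (1 - ern_D m (rad p))"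
    unfolding ern_N_def by (simp_all add: sharp_ern_nth[OF assms])
qed

lemma metric_ip_uminus_left: "metric_ip G (- X) Y = - metric_ip G X Y"
  by (simp add: metric_ip_def sum_negf)

lemma metric_ip_scaleR: "metric_ip G (c *\<^sub>R X) Y = c * metric_ip G X Y" "metric_ip G X (c *\<^sub>R Y) = c * metric_ip G X Y"
  by (simp_all add: metric_ip_def sum_distrib_left mult_ac)

lemma metric_ip_commute: "metric_ip (ern_metric m p) X Y = metric_ip (ern_metric m p) Y X"
  by (simp add: metric_ip_ern mult_ac)

lemma metric_ip_N:
  assumes "rad p > 0"
  shows "metric_ip (ern_metric m p) (ern_N m p) Y = - Y $ 1"
  unfolding ern_N_def metric_ip_uminus_left metric_ip_sharp[OF assms]
  by (simp add: dt_form_def axis_def sum_4)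

lemma sharp_metric:
  assumes "rad p > 0"
  shows "sharp (ern_metric m p) (ern_metric m p *v X) = X"
proof -
  have "ern_inverse m p ** ern_metric m p = mat 1"
    using metric_mult_inverse[OF assms] by (simp add: matrix_left_right_inverse)
  then show ?thesis
    by (simp add: sharp_def matrix_inv_ern[OF assms] matrix_vector_mul_assoc)
qed

text \<open>Because g(N, Y) = - dt*(Y), the field \<open>N\<close> is normal to the slices, and g(N,
  N) = - (2 - D) fixes the scaling. Conversely, the covector of any normal is a multiple of dt*, so
  the normal is a multiple of \<open>N\<close>; its length determines the factor up to sign, and the
  time orientation determines the sign.\<close>

lemma ern_unit_normal_eq:
  assumes "0 < m" "m < rad p"
  shows "ern_unit_normal m p = (1 / sqrt (2 - ern_D m (rad p))) *\<^sub>R ern_N m p"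
proof -
  define q where "q = 2 - ern_D m (rad p)"
  have r: "rad p > 0" using assms by simp
  have q: "q > 0" using ern_D_bounds[OF assms] by (simp add: q_def)
  let ?G = "ern_metric m p" and ?N = "ern_N m p"
  have NY: "metric_ip ?G ?N Y = - Y $ 1" and YN: "metric_ip ?G Y ?N = - Y $ 1" for Y
    using metric_ip_N[OF r] metric_ip_commute by metis+
  have N1: "?N $ 1 = q" using ern_N_nth[OF r] by (simp add: q_def)
  show ?thesis
    unfolding ern_unit_normal_def q_def[symmetric]
  proof (rule the_equality, intro conjI allI impI)
    show "metric_ip ?G ((1 / sqrt q) *\<^sub>R ?N) ((1 / sqrt q) *\<^sub>R ?N) = - 1"
      using q by (simp add: metric_ip_scaleR NY N1)
    show "metric_ip ?G ((1 / sqrt q) *\<^sub>R ?N) X = 0" if "X $ 1 = 0" for X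
      using that by (simp add: metric_ip_scaleR NY)
    have "?N \<noteq> 0" using N1 q by auto
    then show "future_causal ?G ?N ((1 / sqrt q) *\<^sub>R ?N)"
      unfolding future_causal_def using q by (simp add: metric_ip_scaleR NY N1)
  next
    fix n assume n: "metric_ip ?G n n = - 1 \<and> (\<forall>X. X $ 1 = 0 \<longrightarrow> metric_ip ?G n X = 0) \<and> future_causal ?G ?N n"
    define l where "l = - (?G *v n) $ 1"
    have ip: "metric_ip ?G n X = (\<Sum>i\<in>UNIV. (?G *v n) $ i * X $ i)" for X
      using metric_ip_sharp[OF r, of m "?G *v n" X] sharp_metric[OF r] by simp
    have "(?G *v n) $ i = 0" if "i \<noteq> 1" for i
    proof -
      have "metric_ip ?G n (axis i 1) = 0" using n that by (simp add: axis_def)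
      then show ?thesis by (simp add: ip axis_def if_distrib cong: if_cong)
    qed
    then have "?G *v n = - (l *\<^sub>R dt_form)"
      by (auto simp: vec_eq_iff dt_form_def axis_def l_def)
    then have "n = sharp ?G (- (l *\<^sub>R dt_form))" using sharp_metric[OF r, of m n] by simp
    then have nl: "n = l *\<^sub>R ?N"
      by (simp add: sharp_def ern_N_def matrix_vector_mult_scaleR vec.neg)
    have "l\<^sup>2 * q = 1" using n by (simp add: nl metric_ip_scaleR NY N1 power2_eq_square)
    moreover have "l > 0"
      using n q by (simp add: nl future_causal_def metric_ip_scaleR NY N1 zero_less_mult_iff)
    ultimately have "l = 1 / sqrt q"
      using q by (metis divide_eq_eq less_irrefl nonzero_eq_divide_eq power2_eq_iff_nonneg real_sqrt_unique
          real_sqrt_divide real_sqrt_one less_imp_le)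
    then show "n = (1 / sqrt q) *\<^sub>R ?N" using nl by simp
  qed
qed

section \<open>The induced metric and the energy density\<close>

lemma slice_pt_nth: "slice_pt \<tau> y $ 1 = \<tau>" "slice_pt \<tau> y $ 2 = y $ 1"
    "slice_pt \<tau> y $ 3 = y $ 2" "slice_pt \<tau> y $ 4 = y $ 3"
  by (simp_all add: slice_pt_def vector_4_nth)

lemma rad_slice_pt: "rad (slice_pt \<tau> y) = norm y"
  by (simp add: rad_def slice_pt_nth norm_vec_def L2_set_def sum_3)

text \<open>The induced metric is the Euclidean one plus \<open>(1 - D) dr^2\<close>, a rank one
  perturbation by a unit covector.\<close>

lemma det_induced:
  assumes "norm y > 0"
  shows "det (ern_induced_metric m \<tau> y) = 2 - ern_D m (norm y)"
proof -
  define p where "p = slice_pt \<tau> y"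
  define e where "e = dr_form p"
  have r: "rad p = norm y" by (simp add: p_def rad_slice_pt)
  have e: "e $ 2 * e $ 2 = 1 - e $ 3 * e $ 3 - e $ 4 * e $ 4"
    using dr_form_unit[of p] assms r by (auto simp: e_def power2_eq_square)
  show ?thesis
    unfolding det_3 ern_induced_metric_def p_def[symmetric] metric_ip_ern radial_def e_def[symmetric] r
    apply (simp add: slice_pt_nth axis_def)
    using e by algebra
qed

lemma stress_energy_real:
  assumes "\<And>h. frechet_derivative u (at p) h = complex_of_real (d h)"
  shows "stress_energy g u p X Y = d X * d Y
    - metric_ip (g p) X Y * (\<Sum>i\<in>UNIV. \<Sum>j\<in>UNIV. matrix_inv (g p) $ i $ j * d (axis i 1) * d (axis j 1)) / 2"
proof -
  have "(\<Sum>i\<in>UNIV. \<Sum>j\<in>UNIV. complex_of_real (matrix_inv (g p) $ i $ j) * of_real (d (axis i 1)) * cnj (of_real (d (axis j 1))))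
     = of_real (\<Sum>i\<in>UNIV. \<Sum>j\<in>UNIV. matrix_inv (g p) $ i $ j * d (axis i 1) * d (axis j 1))"
    by simp
  then show ?thesis
    unfolding stress_energy_def Let_def assms
    by (simp only: complex_cnj_complex_of_real of_real_mult[symmetric] minus_complex.sel plus_complex.sel
       Re_divide_numeral Re_complex_of_real)
qed

text \<open>The volume factor \<open>sqrt (2 - D)\<close> cancels the normalisation of the unit
  normal, so the density is simply T(N, N), here for a differential A dt* + B dr. The term in
  \<open>B^2\<close> does not degenerate where \<open>D = 0\<close>; through it the energy sees the
  large radial derivative of the modes near the horizon.\<close>

lemma energy_density:
  assumes "0 < m" "m < norm y"
    and du: "(u has_derivative (\<lambda>h. complex_of_real (A * h $ 1 + B * radial (slice_pt \<tau> y) h))) (at (slice_pt \<tau> y))"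
  shows "metric_ip (ern_metric m (slice_pt \<tau> y)) (current (ern_metric m) (ern_N m) u (slice_pt \<tau> y)) (ern_unit_normal m (slice_pt \<tau> y))
               * sqrt (det (ern_induced_metric m \<tau> y))
    = (((2 - ern_D m (norm y)) * A - (1 - ern_D m (norm y)) * B)\<^sup>2 + B\<^sup>2) / 2"
proof -
  define p where "p = slice_pt \<tau> y"
  define e where "e = dr_form p"
  define F where "F = ern_D m (norm y)"
  define d where "d h = A * h $ 1 + B * radial p h" for h
  have r: "rad p = norm y" by (simp add: p_def rad_slice_pt)
  have r0: "rad p > 0" using assms(1,2) unfolding r by linarith
  have q: "2 - F > 0" using ern_D_bounds[OF assms(1,2)] by (simp add: F_def)
  have e: "e $ 1 = 0" "e $ 2 * e $ 2 = 1 - e $ 3 * e $ 3 - e $ 4 * e $ 4"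
    using dr_form_unit[OF r0] by (auto simp: e_def dr_form_nth(1) power2_eq_square)
  have fd: "frechet_derivative u (at p) h = complex_of_real (d h)" for h
    using frechet_derivative_at[OF du] by (simp add: d_def p_def fun_eq_iff)
  \<comment> \<open>This is the inverse metric applied twice to \<open>du\<close>, in the form
    \<eta> - (1 - D) L \<otimes> L.\<close>
  have W: "(\<Sum>i\<in>UNIV. \<Sum>j\<in>UNIV. matrix_inv (ern_metric m p) $ i $ j * d (axis i 1) * d (axis j 1))
      = - A\<^sup>2 + B\<^sup>2 - (1 - F) * (B - A)\<^sup>2" (is "?W = _")
    unfolding matrix_inv_ern[OF r0] ern_inverse_def d_def radial_def e_def[symmetric] sum_4 r F_def[symmetric]
    apply (simp add: dt_form_def axis_def e(1))
    using e(2) by algebra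
  have N: "ern_N m p $ 1 = 2 - F" "radial p (ern_N m p) = - (1 - F)"
    using ern_N_nth[OF r0] by (simp_all add: r F_def)
  have "metric_ip (ern_metric m p) (current (ern_metric m) (ern_N m) u p) (ern_N m p)
      = (\<Sum>j\<in>UNIV. (d (ern_N m p) * d (axis j 1) + axis j 1 $ 1 * ?W / 2) * ern_N m p $ j)"
    unfolding current_def metric_ip_sharp[OF r0]
    by (simp add: stress_energy_real[OF fd] metric_ip_N[OF r0])
  also have "\<dots> = (d (ern_N m p))\<^sup>2 + ?W / 2 * ern_N m p $ 1"
    by (simp add: sum_4 d_def radial_def axis_def dr_form_nth(1) algebra_simps power2_eq_square)
  also have "\<dots> = (((2 - F) * A - (1 - F) * B)\<^sup>2 + B\<^sup>2) / 2"
    unfolding W unfolding d_def N by (simp add: power2_eq_square field_simps)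
  finally have ip: "metric_ip (ern_metric m p) (current (ern_metric m) (ern_N m) u p) (ern_N m p)
     = (((2 - F) * A - (1 - F) * B)\<^sup>2 + B\<^sup>2) / 2" .
  have "norm y > 0" using assms(1,2) by linarith
  from det_induced[OF this] show ?thesis
    unfolding p_def[symmetric] F_def[symmetric]
    using q assms r by (simp add: ern_unit_normal_eq metric_ip_scaleR ip F_def)
qed

section \<open>Modes\<close>

lemma rad_has_derivative:
  assumes "rad p > 0"
  shows "(rad has_derivative radial p) (at p)"
proof -
  have "((\<lambda>p::real^4. (p$2)\<^sup>2 + (p$3)\<^sup>2 + (p$4)\<^sup>2) has_derivative
      (\<lambda>h. 2 * p$2 * h$2 + 2 * p$3 * h$3 + 2 * p$4 * h$4)) (at p)"
    by (auto intro!: derivative_eq_intros bounded_linear_imp_has_derivative bounded_linear_vec_nth simp: fun_eq_iff)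
  from has_derivative_real_sqrt[OF _ this]
  have "((\<lambda>p::real^4. sqrt ((p$2)\<^sup>2 + (p$3)\<^sup>2 + (p$4)\<^sup>2)) has_derivative
      (\<lambda>h. (2 * p$2 * h$2 + 2 * p$3 * h$3 + 2 * p$4 * h$4) * (inverse (rad p) / 2))) (at p)"
    using assms by (simp add: rad_def)
  then show ?thesis
    unfolding rad_def[abs_def, symmetric] rad_def[symmetric]
    by (rule has_derivative_eq_rhs)
      (use assms in \<open>simp add: fun_eq_iff radial_def dr_form_nth rad_def[symmetric] divide_simps\<close>)
qed

lemma continuous_on_rad: "continuous_on A rad"
  unfolding rad_def by (intro continuous_intros)

lemma open_exterior: "open (ern_exterior m)"
  unfolding ern_exterior_def by (intro open_Collect_less continuous_on_rad continuous_intros)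

lemma radial_axis: "radial p (axis i 1) = dr_form p $ i"
  using exhaust_4[of i] by (auto simp: radial_def axis_def dr_form_nth(1))

lemma axis_nth_1: "(axis i 1 :: real^4) $ 1 = (if i = 1 then 1 else 0)"
  by (simp add: axis_def)

lemma nth_has_derivative: "((\<lambda>p::real^4. p $ i) has_derivative (\<lambda>h. h $ i)) (at p)"
  by (intro bounded_linear_imp_has_derivative bounded_linear_vec_nth)

text \<open>The exponent contains t* + r = v, the ingoing null coordinate, which is regular at the
  horizon. The radial factor is left general because \<open>S'\<close> and the flux components of a
  mode are also products of this kind.\<close>

definition mode :: "real \<Rightarrow> (real \<Rightarrow> real) \<Rightarrow> real^4 \<Rightarrow> real" where
  "mode \<kappa> f p = exp (- \<kappa> * (p $ 1 + rad p)) * f (rad p)"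

lemma mode_has_derivative:
  assumes "rad p > 0" "(f has_real_derivative f') (at (rad p))"
  shows "(mode \<kappa> f has_derivative (\<lambda>h. exp (- \<kappa> * (p $ 1 + rad p)) *
           (- \<kappa> * f (rad p) * h $ 1 + (f' - \<kappa> * f (rad p)) * radial p h))) (at p)"
proof -
  have 1: "((\<lambda>p. f (rad p)) has_derivative (\<lambda>h. f' * radial p h)) (at p)"
    using has_derivative_compose[OF rad_has_derivative[OF assms(1)] assms(2)[unfolded has_field_derivative_def]] .
  have "((\<lambda>p. - \<kappa> * (p $ 1 + rad p)) has_derivative (\<lambda>h. - \<kappa> * (h $ 1 + radial p h))) (at p)"
    by (intro has_derivative_mult_right has_derivative_add nth_has_derivative rad_has_derivative assms)
  from has_derivative_mult[OF has_derivative_exp[OF this] 1] show ?thesis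
    unfolding mode_def[abs_def]
    by (rule has_derivative_eq_rhs) (simp add: fun_eq_iff algebra_simps)
qed

lemma partial_eq: "(f has_derivative D) (at p) \<Longrightarrow> partial i f p = D (axis i 1)"
  by (simp add: partial_def frechet_derivative_at[symmetric])

lemma has_derivative_cong_open:
  assumes "open A" "p \<in> A" "\<And>q. q \<in> A \<Longrightarrow> f q = g q"
  shows "(f has_derivative D) (at p) \<longleftrightarrow> (g has_derivative D) (at p)"
  using has_derivative_transform_within_open[OF _ assms(1,2)] assms(3) by metis

lemma partial_cong_open:
  assumes "open A" "p \<in> A" "\<And>q. q \<in> A \<Longrightarrow> f q = g q"
  shows "partial i f p = partial i g p"
  unfolding partial_def frechet_derivative_def using has_derivative_cong_open[OF assms] by simp

lemma has_derivative_complex_of_real: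
  "(f has_derivative D) F \<Longrightarrow> ((\<lambda>p. complex_of_real (f p)) has_derivative (\<lambda>h. complex_of_real (D h))) F"
  by (rule bounded_linear.has_derivative[OF bounded_linear_of_real])

text \<open>As the determinant is -1, the wave operator is the coordinate divergence of the
  gradient. The gradient has time component \<open>mode \<kappa> ft\<close> and spatial part
  \<open>mode \<kappa> fr\<close> times the position vector, so its divergence reduces to one scalar
  expression in \<open>r\<close>.\<close>

lemma wave_op_mode:
  assumes m: "0 < m" and p: "p \<in> ern_exterior m"
    and dS: "\<And>r. m < r \<Longrightarrow> (S has_real_derivative S' r) (at r)"
    and dS': "\<And>r. m < r \<Longrightarrow> (S' has_real_derivative
        (2 * \<kappa> * r * (r * S' r + S r) - 2 * (r - m) * S' r) / (r - m)\<^sup>2) (at r)"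
  shows "wave_op (ern_metric m) (\<lambda>p. complex_of_real (mode \<kappa> S p)) p = 0"
proof -
  define S'' where "S'' r = (2 * \<kappa> * r * (r * S' r + S r) - 2 * (r - m) * S' r) / (r - m)\<^sup>2" for r
  define ft where "ft r = \<kappa> * S r + (1 - ern_D m r) * S' r" for r
  \<comment> \<open>Dividing by \<open>r\<close> turns the unit radial direction into the Cartesian
    position vector, whose divergence is the 3 in the expression below.\<close>
  define fr where "fr r = (ern_D m r * S' r - \<kappa> * S r) / r" for r
  define flux where "flux i q = (if i = 1 then mode \<kappa> ft q else q $ i * mode \<kappa> fr q)" for i :: 4 and q
  let ?u = "\<lambda>p. complex_of_real (mode \<kappa> S p)"
  have pu: "partial j ?u q = complex_of_real (exp (- \<kappa> * (q $ 1 + rad q)) *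
      (- \<kappa> * S (rad q) * axis j 1 $ 1 + (S' (rad q) - \<kappa> * S (rad q)) * dr_form q $ j))"
    if "q \<in> ern_exterior m" for q j
  proof -
    have q: "rad q > 0" "rad q > m" using that m by (auto simp: ern_exterior_def)
    show ?thesis
      unfolding partial_eq[OF has_derivative_complex_of_real[OF mode_has_derivative[OF q(1) dS[OF q(2)]]]] radial_axis ..
  qed
  have fl: "(\<Sum>j\<in>UNIV. (sqrt \<bar>det (ern_metric m q)\<bar> * matrix_inv (ern_metric m q) $ i $ j) *\<^sub>R partial j ?u q)
      = complex_of_real (flux i q)" if qe: "q \<in> ern_exterior m" for q i
  proof -
    have q: "rad q > 0" "rad q > m" using that m by (auto simp: ern_exterior_def)
    define e where "e = dr_form q"
    have e: "e $ 1 = 0" "e $ 2 * e $ 2 = 1 - e $ 3 * e $ 3 - e $ 4 * e $ 4"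
      using dr_form_unit[OF q(1)] by (auto simp: e_def dr_form_nth(1) power2_eq_square)
    have qi: "q $ i = rad q * e $ i" if "i \<noteq> 1" using q that by (simp add: e_def dr_form_def)
    have fr: "rad q * fr (rad q) = ern_D m (rad q) * S' (rad q) - \<kappa> * S (rad q)" using q by (simp add: fr_def)
    define X where "X = exp (- \<kappa> * (q $ 1 + rad q))"
    have flux: "flux i q = X * (if i = 1 then ft (rad q) else e $ i * (ern_D m (rad q) * S' (rad q) - \<kappa> * S (rad q)))"
      unfolding flux_def mode_def X_def[symmetric] using qi fr by auto
    define \<alpha> where "\<alpha> = (\<chi> j. X * (- \<kappa> * S (rad q) * axis j 1 $ 1 + (S' (rad q) - \<kappa> * S (rad q)) * e $ j))"
    have \<alpha>: "\<alpha> $ 1 = - X * \<kappa> * S (rad q)" "\<And>i. i \<noteq> 1 \<Longrightarrow> \<alpha> $ i = X * (S' (rad q) - \<kappa> * S (rad q)) * e $ i"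
      by (simp_all add: \<alpha>_def e(1) axis_def)
    have "radial q \<alpha> = X * (S' (rad q) - \<kappa> * S (rad q))"
      unfolding radial_def e_def[symmetric] using \<alpha>(2)[of 2] \<alpha>(2)[of 3] \<alpha>(2)[of 4] e(2) by simp algebra
    then have "sharp (ern_metric m q) \<alpha> $ i = flux i q"
      unfolding flux ft_def using sharp_ern_nth(1,2)[OF q(1), where m=m and \<alpha>=\<alpha>]
      by (auto simp: \<alpha> e_def[symmetric] algebra_simps)
    then have "(\<Sum>j\<in>UNIV. ern_inverse m q $ i $ j * (X * (- \<kappa> * S (rad q) * axis j 1 $ 1 + (S' (rad q) - \<kappa> * S (rad q)) * e $ j)))
       = flux i q"
      by (simp add: sharp_def matrix_inv_ern[OF q(1)] matrix_vector_mult_def \<alpha>_def)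
    then show ?thesis
      unfolding pu[OF qe] e_def[symmetric] X_def[symmetric] det_ern[OF q(1)] matrix_inv_ern[OF q(1)]
      by (simp add: scaleR_conv_of_real flip: of_real_mult of_real_sum)
  qed
  have r: "rad p > 0" "rad p > m" using p m by (auto simp: ern_exterior_def)
  define e where "e = dr_form p"
  define R where "R = rad p"
  define X where "X = exp (- \<kappa> * (p $ 1 + rad p))"
  define D' where "D' = 2 * m * (R - m) / R ^ 3"
  define ft' where "ft' = \<kappa> * S' R + (- D' * S' R + (1 - ern_D m R) * S'' R)"
  define fr' where "fr' = ((D' * S' R + ern_D m R * S'' R - \<kappa> * S' R) * R - (ern_D m R * S' R - \<kappa> * S R)) / (R * R)"
  have dD: "(ern_D m has_real_derivative D') (at R)"
    unfolding ern_D_def[abs_def] using r by (auto intro!: derivative_eq_intros simp: D'_def R_def field_simps eval_nat_numeral)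
  have dR: "(S has_real_derivative S' R) (at R)" "(S' has_real_derivative S'' R) (at R)" "R \<noteq> 0"
    using dS[OF r(2)] dS'[OF r(2)] r(1) by (simp_all add: R_def S''_def)
  have dft: "(ft has_real_derivative ft') (at R)"
    unfolding ft_def[abs_def] ft'_def
    by (auto intro!: derivative_eq_intros dD dR)
  have dfr: "(fr has_real_derivative fr') (at R)"
    unfolding fr_def[abs_def] fr'_def
    by (auto intro!: derivative_eq_intros dD dR)
  have pt: "partial 1 (\<lambda>q. complex_of_real (flux 1 q)) p = complex_of_real (X * (- \<kappa> * ft R))"
    unfolding flux_def if_P[OF refl]
    using partial_eq[OF has_derivative_complex_of_real[OF mode_has_derivative[OF r(1) dft[unfolded R_def], of \<kappa>]], of 1]
    by (simp add: radial_axis dr_form_nth X_def R_def axis_nth_1)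
  have pr: "partial i (\<lambda>q. complex_of_real (flux i q)) p
      = complex_of_real (X * fr R + p $ i * (X * ((fr' - \<kappa> * fr R) * e $ i)))" if "i \<noteq> 1" for i
  proof -
    have "((\<lambda>q. q $ i * mode \<kappa> fr q) has_derivative
        (\<lambda>h. p $ i * (X * (- \<kappa> * fr R * h $ 1 + (fr' - \<kappa> * fr R) * radial p h)) + h $ i * mode \<kappa> fr p)) (at p)"
      unfolding X_def R_def
      by (intro has_derivative_mult nth_has_derivative mode_has_derivative r dfr[unfolded R_def])
    from partial_eq[OF has_derivative_complex_of_real[OF this], of i] show ?thesis
      using that by (simp add: flux_def radial_axis e_def mode_def X_def R_def axis_nth_1 axis_nth mult_ac add.commute)
  qed
  have pi: "p $ i = R * e $ i" if "i \<noteq> 1" for i using r that by (simp add: e_def dr_form_def R_def)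
  have e: "e $ 2 * e $ 2 = 1 - e $ 3 * e $ 3 - e $ 4 * e $ 4"
    using dr_form_unit[OF r(1)] by (auto simp: e_def power2_eq_square)
  have "X * (- \<kappa> * ft R) + ((X * fr R + p $ 2 * (X * ((fr' - \<kappa> * fr R) * e $ 2)))
      + (X * fr R + p $ 3 * (X * ((fr' - \<kappa> * fr R) * e $ 3)))
      + (X * fr R + p $ 4 * (X * ((fr' - \<kappa> * fr R) * e $ 4))))
      = X * (- \<kappa> * ft R + 3 * fr R + R * (fr' - \<kappa> * fr R))"
    using pi[of 2] pi[of 3] pi[of 4] e by simp algebra
  \<comment> \<open>This scalar identity is the radial equation, entering through
    \<open>S''\<close>.\<close>
  also have "- \<kappa> * ft R + 3 * fr R + R * (fr' - \<kappa> * fr R) = 0"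
  proof -
    define s where "s = R - m"
    have s: "s > 0" "R > 0" using r by (auto simp: s_def R_def)
    have mR: "m = R - s" by (simp add: s_def)
    show ?thesis
      unfolding ft_def fr_def fr'_def D'_def S''_def ern_D_def s_def[symmetric] unfolding mR using s
      by (simp add: divide_simps) algebra
  qed
  finally have total: "X * (- \<kappa> * ft R) + ((X * fr R + p $ 2 * (X * ((fr' - \<kappa> * fr R) * e $ 2)))
      + (X * fr R + p $ 3 * (X * ((fr' - \<kappa> * fr R) * e $ 3)))
      + (X * fr R + p $ 4 * (X * ((fr' - \<kappa> * fr R) * e $ 4)))) = 0"
    by (simp only: mult_zero_right)
  have "(2::4) \<noteq> 1" "(3::4) \<noteq> 1" "(4::4) \<noteq> 1" by simp_all
  note pr' = this[THEN pr]
  have "(\<Sum>i\<in>UNIV. partial i (\<lambda>q. complex_of_real (flux i q)) p) = complex_of_real 0"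
    unfolding total[symmetric] sum_4 pt pr' by (simp only: of_real_add add.assoc)
  then show ?thesis
    unfolding wave_op_def using partial_cong_open[OF open_exterior p fl] by simp
qed

text \<open>Smoothness is obtained from a family of functions that contains its own partial derivatives:
  here the algebra generated by the coordinates, \<open>r\<close>, \<open>1/r\<close>, \<open>1/(r - m)\<close> and the modes of \<open>S\<close> and \<open>S'\<close>,
  which the radial equation closes.\<close>

lemma smooth_on_closed_family:
  fixes \<F> :: "(real^4 \<Rightarrow> real) set"
  assumes "open A"
    and closed: "\<And>f. f \<in> \<F> \<Longrightarrow> \<exists>d. (\<forall>i. d i \<in> \<F>) \<and>
        (\<forall>p\<in>A. (f has_derivative (\<lambda>h. \<Sum>i\<in>UNIV. d i p * h $ i)) (at p))"
    and "f \<in> \<F>"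
  shows "smooth_on A (\<lambda>p. complex_of_real (f p))"
proof -
  \<comment> \<open>The induction runs over all functions that agree with a member of the family on
    \<open>A\<close>, because the partial derivatives are known to agree with members only
    there.\<close>
  have "Ck_on k A u" if "f \<in> \<F>" "\<And>p. p \<in> A \<Longrightarrow> u p = complex_of_real (f p)" for k f u
    using that
  proof (induction k arbitrary: f u)
    case (Suc k)
    obtain d where d: "\<And>i. d i \<in> \<F>"
      "\<And>p. p \<in> A \<Longrightarrow> (f has_derivative (\<lambda>h. \<Sum>i\<in>UNIV. d i p * h $ i)) (at p)"
      using closed[OF Suc.prems(1)] by blast
    have du: "(u has_derivative (\<lambda>h. complex_of_real (\<Sum>i\<in>UNIV. d i p * h $ i))) (at p)" if "p \<in> A" for p
      using has_derivative_cong_open[OF \<open>open A\<close> that, of u "\<lambda>p. complex_of_real (f p)"] Suc.prems(2)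
        has_derivative_complex_of_real[OF d(2)[OF that]]
      by blast
    have "partial i u p = complex_of_real (d i p)" if "p \<in> A" for i p
      using partial_eq[OF du[OF that], of i] by (simp add: axis_def if_distrib cong: if_cong)
    with Suc.IH[OF d(1)] have "Ck_on k A (partial i u)" for i by blast
    with du show ?case by (auto simp: differentiable_def)
  next
    case 0
    obtain d where "\<And>p. p \<in> A \<Longrightarrow> (f has_derivative (\<lambda>h. \<Sum>i\<in>UNIV. d i p * h $ i)) (at p)"
      using closed[OF 0(1)] by blast
    then have "continuous_on A f"
      by (meson continuous_at_imp_continuous_on has_derivative_continuous)
    then have "continuous_on A (\<lambda>p. complex_of_real (f p))" by (intro continuous_intros)
    then have "continuous_on A u" using 0(2) by (simp cong: continuous_on_cong)
    then show ?case by simp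
  qed
  with assms(3) show ?thesis by (simp add: smooth_on_def)
qed

lemma Ck_on_subset: "Ck_on k A f \<Longrightarrow> B \<subseteq> A \<Longrightarrow> Ck_on k B f"
  by (induction k arbitrary: f) (auto intro: continuous_on_subset)

lemma smooth_on_subset: "smooth_on A f \<Longrightarrow> B \<subseteq> A \<Longrightarrow> smooth_on B f"
  unfolding smooth_on_def by (blast intro: Ck_on_subset)

inductive_set generated :: "(real^4 \<Rightarrow> real) set \<Rightarrow> (real^4 \<Rightarrow> real) set" for \<G> where
  gen: "f \<in> \<G> \<Longrightarrow> f \<in> generated \<G>"
| const: "(\<lambda>p. c) \<in> generated \<G>"
| add: "f \<in> generated \<G> \<Longrightarrow> g \<in> generated \<G> \<Longrightarrow> (\<lambda>p. f p + g p) \<in> generated \<G>"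
| mult: "f \<in> generated \<G> \<Longrightarrow> g \<in> generated \<G> \<Longrightarrow> (\<lambda>p. f p * g p) \<in> generated \<G>"

lemma generated_closed:
  assumes gens: "\<And>f. f \<in> \<G> \<Longrightarrow> \<exists>d. (\<forall>i. d i \<in> generated \<G>) \<and>
      (\<forall>p\<in>A. (f has_derivative (\<lambda>h. \<Sum>i\<in>UNIV. d i p * h $ i)) (at p))"
    and "f \<in> generated \<G>"
  shows "\<exists>d. (\<forall>i. d i \<in> generated \<G>) \<and>
      (\<forall>p\<in>A. (f has_derivative (\<lambda>h. \<Sum>i\<in>UNIV. d i p * h $ i)) (at p))"
  using assms(2)
proof induction
  case (gen f)
  then show ?case by (rule gens)
next
  case (const c)
  show ?case by (rule exI[of _ "\<lambda>i p. 0"]) (auto intro: generated.const)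
next
  case (add f g)
  then obtain d e where d: "\<forall>i. d i \<in> generated \<G>" "\<forall>p\<in>A. (f has_derivative (\<lambda>h. \<Sum>i\<in>UNIV. d i p * h $ i)) (at p)"
    and e: "\<forall>i. e i \<in> generated \<G>" "\<forall>p\<in>A. (g has_derivative (\<lambda>h. \<Sum>i\<in>UNIV. e i p * h $ i)) (at p)"
    by blast
  have "((\<lambda>p. f p + g p) has_derivative (\<lambda>h. \<Sum>i\<in>UNIV. (d i p + e i p) * h $ i)) (at p)" if "p \<in> A" for p
    by (rule has_derivative_eq_rhs[OF has_derivative_add[OF d(2)[rule_format, OF that] e(2)[rule_format, OF that]]])
      (simp add: fun_eq_iff sum.distrib algebra_simps)
  with d(1) e(1) show ?case
    by (intro exI[of _ "\<lambda>i p. d i p + e i p"]) (auto intro: generated.add)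
next
  case (mult f g)
  then obtain d e where d: "\<forall>i. d i \<in> generated \<G>" "\<forall>p\<in>A. (f has_derivative (\<lambda>h. \<Sum>i\<in>UNIV. d i p * h $ i)) (at p)"
    and e: "\<forall>i. e i \<in> generated \<G>" "\<forall>p\<in>A. (g has_derivative (\<lambda>h. \<Sum>i\<in>UNIV. e i p * h $ i)) (at p)"
    by blast
  have "((\<lambda>p. f p * g p) has_derivative (\<lambda>h. \<Sum>i\<in>UNIV. (f p * e i p + d i p * g p) * h $ i)) (at p)" if "p \<in> A" for p
    by (rule has_derivative_eq_rhs[OF has_derivative_mult[OF d(2)[rule_format, OF that] e(2)[rule_format, OF that]]])
      (simp add: fun_eq_iff sum.distrib sum_distrib_left sum_distrib_right algebra_simps)
  with mult.hyps d(1) e(1) show ?case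
    by (intro exI[of _ "\<lambda>i p. f p * e i p + d i p * g p"]) (auto intro!: generated.add generated.mult)
qed

lemma smooth_on_mode:
  assumes m: "0 < m"
    and dS: "\<And>r. m < r \<Longrightarrow> (S has_real_derivative S' r) (at r)"
    and dS': "\<And>r. m < r \<Longrightarrow> (S' has_real_derivative
        (2 * \<kappa> * r * (r * S' r + S r) - 2 * (r - m) * S' r) / (r - m)\<^sup>2) (at r)"
  shows "smooth_on (ern_exterior m) (\<lambda>p. complex_of_real (mode \<kappa> S p))"
proof -
  define \<G> where "\<G> = range (\<lambda>i (p::real^4). p $ i) \<union>
    {rad, \<lambda>p. 1 / rad p, \<lambda>p. 1 / (rad p - m), mode \<kappa> S, mode \<kappa> S'}"
  have nth: "(\<lambda>p. p $ i) \<in> generated \<G>" for i by (rule generated.gen) (auto simp: \<G>_def)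
  have gens: "rad \<in> generated \<G>" "(\<lambda>p. 1 / rad p) \<in> generated \<G>" "(\<lambda>p. 1 / (rad p - m)) \<in> generated \<G>"
    "mode \<kappa> S \<in> generated \<G>" "mode \<kappa> S' \<in> generated \<G>"
    by (rule generated.gen, simp add: \<G>_def)+
  note rules = generated.add generated.mult nth gens generated.const
  have radial_sum: "(\<Sum>i\<in>UNIV. (if i = 1 then t p else p $ i * (1 / rad p) * f p) * h $ i) = t p * h $ 1 + f p * radial p h"
    for t f :: "real^4 \<Rightarrow> real" and p h
    by (simp add: sum_4 radial_def dr_form_nth algebra_simps)
  \<comment> \<open>A differential t dt* + f dr has the partial derivatives \<open>t\<close> and
    \<open>(x_i / r) f\<close>, which stay in the algebra together with \<open>t\<close> and
    \<open>f\<close>.\<close>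
  have closure: "\<exists>d. (\<forall>i. d i \<in> generated \<G>) \<and> (\<forall>p\<in>ern_exterior m. (F has_derivative (\<lambda>h. \<Sum>i\<in>UNIV. d i p * h $ i)) (at p))"
    if "t \<in> generated \<G>" "f \<in> generated \<G>"
      and dF: "\<And>p. m < rad p \<Longrightarrow> (F has_derivative (\<lambda>h. t p * h $ 1 + f p * radial p h)) (at p)" for t f F
  proof (intro exI[of _ "\<lambda>i p. if i = 1 then t p else p $ i * (1 / rad p) * f p"] conjI allI ballI)
    show "(\<lambda>p. if i = 1 then t p else p $ i * (1 / rad p) * f p) \<in> generated \<G>" for i
      using that(1) generated.mult[OF generated.mult[OF nth[of i] gens(2)] that(2)] by (cases "i = 1") simp_all
    show "(F has_derivative (\<lambda>h. \<Sum>i\<in>UNIV. (if i = 1 then t p else p $ i * (1 / rad p) * f p) * h $ i)) (at p)"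
      if "p \<in> ern_exterior m" for p
      unfolding radial_sum using that dF by (simp add: ern_exterior_def)
  qed
  have "\<exists>d. (\<forall>i. d i \<in> generated \<G>) \<and> (\<forall>p\<in>ern_exterior m. (F has_derivative (\<lambda>h. \<Sum>i\<in>UNIV. d i p * h $ i)) (at p))"
    if F: "F \<in> \<G>" for F
  proof -
    consider j where "F = (\<lambda>p. p $ j)" | "F = rad" | "F = (\<lambda>p. 1 / rad p)" | "F = (\<lambda>p. 1 / (rad p - m))"
      | "F = mode \<kappa> S" | "F = mode \<kappa> S'"
      using F unfolding \<G>_def by blast
    then show ?thesis
    proof cases
      case F: (1 j)
      show ?thesis
        unfolding F by (rule exI[of _ "\<lambda>i p. if i = j then 1 else 0"])
          (auto intro: generated.const nth_has_derivative simp: if_distrib[of "\<lambda>x. x * _"] cong: if_cong)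
    next
      case F: 2
      show ?thesis
      proof (rule closure[of "\<lambda>p. 0" "\<lambda>p. 1"])
        show "(\<lambda>p. 0) \<in> generated \<G>" "(\<lambda>p. 1) \<in> generated \<G>" by (rule generated.const)+
        show "(F has_derivative (\<lambda>h. 0 * h $ 1 + 1 * radial p h)) (at p)" if "m < rad p" for p
          using rad_has_derivative[of p] that m by (simp add: F)
      qed
    next
      case F: 3
      show ?thesis
      proof (rule closure[of "\<lambda>p. 0" "\<lambda>p. - 1 * ((1 / rad p) * (1 / rad p))"])
        show "(\<lambda>p. 0) \<in> generated \<G>" "(\<lambda>p. - 1 * ((1 / rad p) * (1 / rad p))) \<in> generated \<G>"
          by (intro rules)+
        show "(F has_derivative (\<lambda>h. 0 * h $ 1 + - 1 * ((1 / rad p) * (1 / rad p)) * radial p h)) (at p)" if "m < rad p" for p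
          unfolding F
          by (rule has_derivative_eq_rhs[OF has_derivative_divide[OF has_derivative_const rad_has_derivative]])
            (use that m in \<open>auto simp: fun_eq_iff field_simps\<close>)
      qed
    next
      case F: 4
      show ?thesis
      proof (rule closure[of "\<lambda>p. 0" "\<lambda>p. - 1 * ((1 / (rad p - m)) * (1 / (rad p - m)))"])
        show "(\<lambda>p. 0) \<in> generated \<G>" "(\<lambda>p. - 1 * ((1 / (rad p - m)) * (1 / (rad p - m)))) \<in> generated \<G>"
          by (intro rules)+
        show "(F has_derivative (\<lambda>h. 0 * h $ 1 + - 1 * ((1 / (rad p - m)) * (1 / (rad p - m))) * radial p h)) (at p)" if "m < rad p" for p
          unfolding F
          by (rule has_derivative_eq_rhs[OF has_derivative_divide[OF has_derivative_const
                has_derivative_diff[OF rad_has_derivative has_derivative_const]]])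
            (use that m in \<open>auto simp: fun_eq_iff divide_simps\<close>)
      qed
    next
      case F: 5
      show ?thesis
      proof (rule closure[of "\<lambda>p. - \<kappa> * mode \<kappa> S p" "\<lambda>p. mode \<kappa> S' p + - \<kappa> * mode \<kappa> S p"])
        show "(\<lambda>p. - \<kappa> * mode \<kappa> S p) \<in> generated \<G>" "(\<lambda>p. mode \<kappa> S' p + - \<kappa> * mode \<kappa> S p) \<in> generated \<G>"
          by (intro rules)+
        show "(F has_derivative (\<lambda>h. - \<kappa> * mode \<kappa> S p * h $ 1 + (mode \<kappa> S' p + - \<kappa> * mode \<kappa> S p) * radial p h)) (at p)"
          if "m < rad p" for p
          unfolding F by (rule has_derivative_eq_rhs[OF mode_has_derivative[OF _ dS[OF that]]])
            (use that m in \<open>auto simp: fun_eq_iff mode_def algebra_simps\<close>)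
      qed
    next
      case F: 6
      define x where "x p = 1 / (rad p - m)" for p
      have x: "x \<in> generated \<G>" using gens(3) by (simp add: x_def[abs_def])
      \<comment> \<open>The second derivative of \<open>S\<close> is eliminated by the radial
        equation; its denominator \<open>(r - m)^2\<close> is the reason for having
        \<open>1 / (r - m)\<close> among the generators.\<close>
      let ?f = "\<lambda>p. 2 * \<kappa> * ((x p * x p) * (rad p * (rad p * mode \<kappa> S' p + mode \<kappa> S p)))
        + (- 2 * (x p * mode \<kappa> S' p) + - \<kappa> * mode \<kappa> S' p)"
      show ?thesis
      proof (rule closure[of "\<lambda>p. - \<kappa> * mode \<kappa> S' p" ?f])
        show "(\<lambda>p. - \<kappa> * mode \<kappa> S' p) \<in> generated \<G>" "?f \<in> generated \<G>"
          by (intro rules x)+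
        show "(F has_derivative (\<lambda>h. - \<kappa> * mode \<kappa> S' p * h $ 1 + ?f p * radial p h)) (at p)"
          if "m < rad p" for p
        proof -
          define X where "X = exp (- \<kappa> * (p $ 1 + rad p))"
          define R where "R = rad p"
          have "?f p = X * ((2 * \<kappa> * R * (R * S' R + S R) - 2 * (R - m) * S' R) / (R - m)\<^sup>2 - \<kappa> * S' R)"
          proof -
            have mode: "mode \<kappa> f p = X * f R" for f by (simp add: mode_def X_def R_def)
            show ?thesis
              unfolding x_def mode R_def[symmetric] using that by (simp add: R_def[symmetric] divide_simps) algebra
          qed
          then show ?thesis
            unfolding F by (intro has_derivative_eq_rhs[OF mode_has_derivative[OF _ dS'[OF that]]])
              (use that m in \<open>auto simp: fun_eq_iff mode_def X_def R_def algebra_simps\<close>)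
        qed
      qed
    qed
  qed
  from smooth_on_closed_family[OF open_exterior generated_closed[OF this] gens(4)] show ?thesis .
qed

section \<open>The domain of dependence\<close>

text \<open>Integrate the derivative: the fundamental theorem tolerates finitely many exceptional
  points, which here are the breakpoints of a piecewise C^1 curve.\<close>

lemma nondecreasing_finite_exceptions:
  fixes f :: "real \<Rightarrow> real"
  assumes "finite S" "a \<le> b" "continuous_on {a..b} f"
    and "\<And>x. x \<in> {a<..<b} - S \<Longrightarrow> \<exists>d\<ge>0. (f has_real_derivative d) (at x)"
  shows "f a \<le> f b"
proof -
  obtain d where d: "\<And>x. x \<in> {a<..<b} - S \<Longrightarrow> 0 \<le> d x \<and> (f has_real_derivative d x) (at x)"
    using assms(4) by metis
  define d' where "d' x = (if x \<in> {a<..<b} - S then d x else 0)" for x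
  have "(d' has_integral f b - f a) {a..b}"
    using assms(1-3) d
    by (intro fundamental_theorem_of_calculus_interior_strong[of S])
      (auto simp: d'_def simp flip: has_real_derivative_iff_has_vector_derivative)
  then have "0 \<le> f b - f a"
    by (rule has_integral_nonneg) (use d in \<open>auto simp: d'_def\<close>)
  then show ?thesis by simp
qed

lemma mono_bounded_tendsto_at_left:
  fixes f :: "real \<Rightarrow> real"
  assumes "a < b" "\<And>x y. a \<le> x \<Longrightarrow> x \<le> y \<Longrightarrow> y < b \<Longrightarrow> f x \<le> f y" "\<And>x. a \<le> x \<Longrightarrow> x < b \<Longrightarrow> f x \<le> B"
  shows "\<exists>l. (f \<longlongrightarrow> l) (at_left b)"
proof -
  define l where "l = Sup (f ` {a..<b})"
  have bdd: "bdd_above (f ` {a..<b})" using assms(3) by (intro bdd_aboveI2[of _ _ B]) auto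
  have "(f \<longlongrightarrow> l) (at_left b)"
  proof (rule increasing_tendsto)
    show "\<forall>\<^sub>F x in at_left b. f x \<le> l"
      using eventually_at_left_real[OF assms(1)] by eventually_elim (auto simp: l_def intro!: cSUP_upper bdd)
    fix y assume "y < l"
    then obtain x where x: "a \<le> x" "x < b" "y < f x"
      using less_cSUP_iff[OF _ bdd, of y] assms(1) by (auto simp: l_def)
    show "\<forall>\<^sub>F x in at_left b. y < f x"
    proof (rule eventually_mono[OF eventually_at_left_real[OF x(2)]])
      fix z assume "z \<in> {x<..<b}"
      then have "f x \<le> f z" using assms(2)[of x z] x by simp
      with x(3) show "y < f z" by simp
    qed
  qed
  then show ?thesis by blast
qed

text \<open>Since \<open>D \<le> 1\<close>, the metric is the Minkowski metric plus a nonnegative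
  square, so its causal cones lie inside the Minkowski cones. For an outward vector with radial part
  \<open>b\<close> and time part \<open>t\<close>, causality factors as
  \<open>(t + b) ((b - t) + (1 - D) (t + b)) \<le> 0\<close>, whence \<open>b \<le> D t\<close>; and
  \<open>D \<le> (r - m) / m\<close>. This last bound, linear in \<open>r - m\<close>, prevents a
  causal curve from reaching the horizon towards the past in finite t*.\<close>

lemma metric_causal_bounds:
  assumes "0 < m" "m < rad p" and c: "future_causal (ern_metric m p) (ern_N m p) X"
  shows "0 < X $ 1" "\<And>i. \<bar>X $ i\<bar> \<le> X $ 1" "radial p X \<le> (rad p - m) / m * X $ 1"
proof -
  define D where "D = ern_D m (rad p)"
  define b where "b = radial p X"
  define e where "e = dr_form p"
  define t where "t = X $ 1"
  have D: "0 \<le> D" "D \<le> 1" using ern_D_bounds[OF assms(1,2)] by (simp_all add: D_def)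
  have r0: "rad p > 0" using assms(1,2) by linarith
  have t: "t > 0"
    using c metric_ip_N[OF r0, of m X] metric_ip_commute[of m p X "ern_N m p"] by (simp add: future_causal_def t_def)
  then show "0 < X $ 1" by (simp add: t_def)
  have g: "(X$2)\<^sup>2 + (X$3)\<^sup>2 + (X$4)\<^sup>2 + (1 - D) * (t + b)\<^sup>2 \<le> t\<^sup>2"
    using c by (simp add: future_causal_def metric_ip_ern D_def b_def t_def power2_eq_square algebra_simps)
  moreover have nn: "0 \<le> (1 - D) * (t + b)\<^sup>2" using D by simp
  ultimately have sp: "(X$2)\<^sup>2 + (X$3)\<^sup>2 + (X$4)\<^sup>2 \<le> t\<^sup>2" by linarith
  have sq: "0 \<le> (X$2)\<^sup>2" "0 \<le> (X$3)\<^sup>2" "0 \<le> (X$4)\<^sup>2" by simp_all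
  have "(X $ 2)\<^sup>2 \<le> t\<^sup>2" "(X $ 3)\<^sup>2 \<le> t\<^sup>2" "(X $ 4)\<^sup>2 \<le> t\<^sup>2" using sp sq by linarith+
  then have "\<bar>X $ 2\<bar> \<le> t" "\<bar>X $ 3\<bar> \<le> t" "\<bar>X $ 4\<bar> \<le> t" using t by (auto simp: abs_le_square_iff[symmetric])
  then show "\<bar>X $ i\<bar> \<le> X $ 1" for i
    using exhaust_4[of i] t by (auto simp: t_def)
  have e: "(e $ 2)\<^sup>2 + (e $ 3)\<^sup>2 + (e $ 4)\<^sup>2 = 1" using dr_form_unit[OF r0] by (simp add: e_def)
  have b: "b = e $ 2 * X $ 2 + e $ 3 * X $ 3 + e $ 4 * X $ 4" by (simp add: b_def e_def radial_def)
  have "b\<^sup>2 + ((e$2 * X$3 - e$3 * X$2)\<^sup>2 + (e$2 * X$4 - e$4 * X$2)\<^sup>2 + (e$3 * X$4 - e$4 * X$3)\<^sup>2)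
      = ((e $ 2)\<^sup>2 + (e $ 3)\<^sup>2 + (e $ 4)\<^sup>2) * ((X$2)\<^sup>2 + (X$3)\<^sup>2 + (X$4)\<^sup>2)"
    unfolding b by (simp add: power2_eq_square algebra_simps)
  then have bX: "b\<^sup>2 \<le> (X$2)\<^sup>2 + (X$3)\<^sup>2 + (X$4)\<^sup>2"
    unfolding e by (smt (verit) mult_1 zero_le_power2)
  have "b\<^sup>2 \<le> t\<^sup>2" using bX sp by linarith
  then have bt: "\<bar>b\<bar> \<le> t" using t by (auto simp: abs_le_square_iff[symmetric])
  have "b \<le> D * t"
  proof (cases "b \<le> 0")
    case True
    then show ?thesis using D t by (meson mult_nonneg_nonneg order.trans less_imp_le)
  next
    case False
    have "b\<^sup>2 + (1 - D) * (t + b)\<^sup>2 - t\<^sup>2 \<le> 0" using g bX by linarith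
    then have "(t + b) * ((b - t) + (1 - D) * (t + b)) \<le> 0" by (simp add: power2_eq_square algebra_simps)
    then have "(b - t) + (1 - D) * (t + b) \<le> 0" using False t by (simp add: mult_le_0_iff)
    then have "b + b * (1 - D) \<le> D * t" by (simp add: algebra_simps)
    moreover have "0 \<le> b * (1 - D)" using False D by simp
    ultimately show ?thesis by linarith
  qed
  moreover have "D \<le> (rad p - m) / m"
  proof -
    have "(rad p - m) * ((rad p - m) * m) \<le> (rad p - m) * (rad p)\<^sup>2"
      using assms(1,2) by (intro mult_left_mono) (auto simp: power2_eq_square intro!: mult_mono)
    then show ?thesis
      using assms(1,2) r0 by (simp add: D_def ern_D_def divide_simps power2_eq_square mult_ac)
  qed
  ultimately show "radial p X \<le> (rad p - m) / m * X $ 1"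
    using t unfolding b_def t_def by (meson mult_right_mono order.trans less_imp_le)
qed

text \<open>If the curve avoided the slice, t* would stay positive along it. Then t* and all
  \<plusminus>x_i - t* are monotone and bounded, so the curve converges in the ambient space.
  Moreover ln (r - m) - t* / m cannot decrease along it, which keeps \<open>r - m\<close> away from
  0. The limit lies in the exterior, contrary to inextendibility.\<close>

lemma past_causal_curve_meets_slice:
  assumes m: "0 < m" and p: "0 \<le> p $ 1"
    and \<gamma>: "inextendible_causal_curve (ern_exterior m) (ern_metric m) (ern_N m) (-1) p \<gamma>"
  shows "\<exists>s\<in>{0..<1}. \<gamma> s \<in> ern_slice m 0"
proof (rule ccontr)
  assume contra: "\<not> (\<exists>s\<in>{0..<1}. \<gamma> s \<in> ern_slice m 0)"
  have \<gamma>0: "\<gamma> 0 = p" and ext: "\<And>s. 0 \<le> s \<Longrightarrow> s < 1 \<Longrightarrow> m < rad (\<gamma> s)"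
    and pw: "\<And>b. b < 1 \<Longrightarrow> \<gamma> piecewise_C1_differentiable_on {0..b}"
    and cau: "\<And>s. 0 < s \<Longrightarrow> s < 1 \<Longrightarrow> \<gamma> differentiable (at s) \<Longrightarrow>
        future_causal (ern_metric m (\<gamma> s)) (ern_N m (\<gamma> s)) (- vector_derivative \<gamma> (at s))"
    and inext: "\<And>q. m < rad q \<Longrightarrow> \<not> (\<gamma> \<longlongrightarrow> q) (at_left 1)"
    using \<gamma> by (auto simp: inextendible_causal_curve_def ern_exterior_def image_subset_iff)
  have cont: "continuous_on {0..b} \<gamma>" if "b < 1" for b
    using pw[OF that] by (simp add: piecewise_C1_differentiable_on_def)
  define t where "t s = \<gamma> s $ 1" for s
  have t_nz: "t s \<noteq> 0" if "0 \<le> s" "s < 1" for s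
    using contra ext[OF that] that by (force simp: ern_slice_def t_def)
  have t_pos: "0 < t s" if s: "0 \<le> s" "s < 1" for s
  proof (rule ccontr)
    assume "\<not> 0 < t s"
    then have "\<exists>x\<ge>0. x \<le> s \<and> t x = 0"
      using p s cont[OF s(2)] by (intro IVT2') (auto simp: t_def \<gamma>0 intro!: continuous_intros)
    then show False using t_nz s by force
  qed
  have mono: "F (\<gamma> x) \<le> F (\<gamma> y)"
    if xy: "0 \<le> x" "x \<le> y" "y < 1" and contF: "continuous_on (ern_exterior m) F"
      and dF: "\<And>q X. m < rad q \<Longrightarrow> future_causal (ern_metric m q) (ern_N m q) X \<Longrightarrow>
        (\<exists>F'. (F has_derivative F') (at q) \<and> 0 \<le> F' (- X))" for F :: "real^4 \<Rightarrow> real" and x y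
  proof -
    obtain S where S: "finite S" "\<gamma> C1_differentiable_on ({0..y} - S)"
      using pw[OF xy(3)] by (auto simp: piecewise_C1_differentiable_on_def)
    have "(\<lambda>s. F (\<gamma> s)) x \<le> (\<lambda>s. F (\<gamma> s)) y"
    proof (rule nondecreasing_finite_exceptions[OF S(1) xy(2)])
      show "continuous_on {x..y} (\<lambda>s. F (\<gamma> s))"
        by (rule continuous_on_compose2[OF contF continuous_on_subset[OF cont[OF xy(3)]]])
          (use xy ext in \<open>auto simp: ern_exterior_def\<close>)
      fix s assume s: "s \<in> {x<..<y} - S"
      then have s': "0 < s" "s < 1" "s \<in> {0..y} - S" using xy by auto
      obtain v where v: "(\<gamma> has_vector_derivative v) (at s)"
        using S(2) s'(3) unfolding C1_differentiable_on_def by blast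
      then have "\<gamma> differentiable (at s)" "vector_derivative \<gamma> (at s) = v"
        by (auto simp: vector_derivative_at differentiableI_vector)
      then have "future_causal (ern_metric m (\<gamma> s)) (ern_N m (\<gamma> s)) (- v)" using cau s' by metis
      from dF[OF ext this] s' obtain F' where F': "(F has_derivative F') (at (\<gamma> s))" "0 \<le> F' v" by auto
      interpret F': bounded_linear F' using F'(1) by (rule has_derivative_bounded_linear)
      have "((\<lambda>s. F (\<gamma> s)) has_derivative (\<lambda>h. F' (h *\<^sub>R v))) (at s)"
        using has_derivative_compose[OF v[unfolded has_vector_derivative_def] F'(1)] .
      then have "((\<lambda>s. F (\<gamma> s)) has_real_derivative F' v) (at s)"
        unfolding has_field_derivative_def
        by (rule has_derivative_eq_rhs) (auto simp: fun_eq_iff F'.scaleR)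
      with F'(2) show "\<exists>d\<ge>0. ((\<lambda>s. F (\<gamma> s)) has_real_derivative d) (at s)" by blast
    qed
    then show ?thesis .
  qed
  have d_pm: "\<exists>F'. ((\<lambda>q. q $ i - q $ 1) has_derivative F') (at q) \<and> 0 \<le> F' (- X)"
    "\<exists>F'. ((\<lambda>q. - (q $ i) - q $ 1) has_derivative F') (at q) \<and> 0 \<le> F' (- X)"
    if "m < rad q" "future_causal (ern_metric m q) (ern_N m q) X" for q X i
  proof -
    have "((\<lambda>q. q $ i - q $ 1) has_derivative (\<lambda>h. h $ i - h $ 1)) (at q)"
      "((\<lambda>q. - (q $ i) - q $ 1) has_derivative (\<lambda>h. - (h $ i) - h $ 1)) (at q)"
      by (intro derivative_intros nth_has_derivative)+
    moreover have "\<bar>X $ i\<bar> \<le> X $ 1" using metric_causal_bounds(2)[OF m that] .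
    then have "0 \<le> (- X) $ i - (- X) $ 1" "0 \<le> - ((- X) $ i) - (- X) $ 1" by simp_all
    ultimately show "\<exists>F'. ((\<lambda>q. q $ i - q $ 1) has_derivative F') (at q) \<and> 0 \<le> F' (- X)"
      "\<exists>F'. ((\<lambda>q. - (q $ i) - q $ 1) has_derivative F') (at q) \<and> 0 \<le> F' (- X)" by blast+
  qed
  have x_mono: "\<gamma> x $ i - \<gamma> x $ 1 \<le> \<gamma> y $ i - \<gamma> y $ 1"
    "- (\<gamma> x $ i) - \<gamma> x $ 1 \<le> - (\<gamma> y $ i) - \<gamma> y $ 1" if "0 \<le> x" "x \<le> y" "y < 1" for x y i
  proof -
    have "continuous_on (ern_exterior m) (\<lambda>q. q $ i - q $ 1)" "continuous_on (ern_exterior m) (\<lambda>q. - (q $ i) - q $ 1)"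
      by (intro continuous_intros)+
    with mono[OF that, of "\<lambda>q. q $ i - q $ 1"] mono[OF that, of "\<lambda>q. - (q $ i) - q $ 1"] d_pm
    show "\<gamma> x $ i - \<gamma> x $ 1 \<le> \<gamma> y $ i - \<gamma> y $ 1"
      "- (\<gamma> x $ i) - \<gamma> x $ 1 \<le> - (\<gamma> y $ i) - \<gamma> y $ 1" by simp_all
  qed
  \<comment> \<open>For \<open>i = 1\<close> the second function is -2 t*, so monotonicity of t* is
    a special case.\<close>
  have t_mono: "- (\<gamma> x $ 1) \<le> - (\<gamma> y $ 1)" if "0 \<le> x" "x \<le> y" "y < 1" for x y
    using x_mono(2)[OF that, of 1] by linarith
  have "- (\<gamma> s $ 1) \<le> 0" if "0 \<le> s" "s < 1" for s
    using t_pos[OF that] by (simp add: t_def)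
  from mono_bounded_tendsto_at_left[of 0 1 "\<lambda>s. - (\<gamma> s $ 1)", OF zero_less_one t_mono this]
  obtain lt where lt: "((\<lambda>s. - (\<gamma> s $ 1)) \<longlongrightarrow> lt) (at_left 1)" by blast
  have "\<exists>l. ((\<lambda>s. \<gamma> s $ i - \<gamma> s $ 1) \<longlongrightarrow> l) (at_left 1)" for i
  proof -
    have "\<gamma> s $ i - \<gamma> s $ 1 \<le> p $ i + p $ 1" if "0 \<le> s" "s < 1" for s
      using x_mono(2)[of 0 s i] that t_pos[OF that] by (simp add: \<gamma>0 t_def)
    from mono_bounded_tendsto_at_left[of 0 1 "\<lambda>s. \<gamma> s $ i - \<gamma> s $ 1", OF zero_less_one x_mono(1) this] show ?thesis .
  qed
  then obtain l where l: "\<And>i. ((\<lambda>s. \<gamma> s $ i - \<gamma> s $ 1) \<longlongrightarrow> l i) (at_left 1)" by metis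
  define q where "q = (\<chi> i. l i - lt)"
  have "((\<lambda>s. \<gamma> s $ i) \<longlongrightarrow> q $ i) (at_left 1)" for i
    using tendsto_diff[OF l[of i] lt] by (simp add: q_def)
  then have lim: "(\<gamma> \<longlongrightarrow> q) (at_left 1)" by (simp add: vec_tendstoI)
  have ln_mono: "ln (rad (\<gamma> x) - m) - \<gamma> x $ 1 / m \<le> ln (rad (\<gamma> y) - m) - \<gamma> y $ 1 / m"
    if "0 \<le> x" "x \<le> y" "y < 1" for x y
  proof (rule mono[OF that, of "\<lambda>q. ln (rad q - m) - q $ 1 / m"])
    show "continuous_on (ern_exterior m) (\<lambda>q. ln (rad q - m) - q $ 1 / m)"
      using m by (intro continuous_intros continuous_on_rad) (auto simp: ern_exterior_def)
    fix q X assume q: "m < rad q" and X: "future_causal (ern_metric m q) (ern_N m q) X"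
    have "((\<lambda>q. ln (rad q - m) - q $ 1 / m) has_derivative
        (\<lambda>h. (radial q h - 0) * inverse (rad q - m) - h $ 1 * (1 / m))) (at q)"
      using q m by (auto intro!: derivative_eq_intros rad_has_derivative nth_has_derivative simp: divide_inverse)
    moreover have "0 \<le> (radial q (- X) - 0) * inverse (rad q - m) - (- X) $ 1 * (1 / m)"
      using metric_causal_bounds(3)[OF m q X] q m by (simp add: radial_def field_simps)
    ultimately show "\<exists>F'. ((\<lambda>q. ln (rad q - m) - q $ 1 / m) has_derivative F') (at q) \<and> 0 \<le> F' (- X)" by blast
  qed
  define c where "c = exp (ln (rad p - m) - p $ 1 / m)"
  have "c \<le> rad (\<gamma> s) - m" if "0 \<le> s" "s < 1" for s
  proof -
    have "ln (rad p - m) - p $ 1 / m \<le> ln (rad (\<gamma> s) - m) - \<gamma> s $ 1 / m"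
      using ln_mono[of 0 s] that by (simp add: \<gamma>0)
    also have "\<dots> \<le> ln (rad (\<gamma> s) - m)" using t_pos[OF that] m by (simp add: t_def)
    finally show ?thesis using ext[OF that] by (simp add: c_def ln_ge_iff)
  qed
  then have ev: "\<forall>\<^sub>F s in at_left 1. c + m \<le> rad (\<gamma> s)"
    using eventually_at_left_real[of 0 1] by (auto elim!: eventually_mono simp: algebra_simps)
  have "((\<lambda>s. rad (\<gamma> s)) \<longlongrightarrow> rad q) (at_left 1)"
    using continuous_on_rad[of UNIV] lim by (rule continuous_on_tendsto_compose) auto
  then have "c + m \<le> rad q"
    by (rule tendsto_lowerbound[OF _ ev]) simp
  then have "m < rad q" by (smt (verit) c_def exp_gt_zero)
  with inext lim show False by blast
qed

lemma future_of_slice_subset_dod: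
  assumes "0 < m" "0 \<le> p $ 1" "m < rad p"
  shows "p \<in> ern_dod m"
  unfolding ern_dod_def domain_of_dependence_def
  using past_causal_curve_meets_slice[OF assms(1,2)] assms(3) by (auto simp: ern_exterior_def)

text \<open>The modes solve the equation smoothly on the whole exterior, so this inclusion yields
  solutions on the domain of dependence, and the preceding one places the future slices inside it.
  The domain itself is never determined.\<close>

lemma ern_dod_subset: "ern_dod m \<subseteq> ern_exterior m"
  by (auto simp: ern_dod_def domain_of_dependence_def)

section \<open>Energy of the modes\<close>

lemma summable_cubic_exp: "summable (\<lambda>n. exp (- 2 * real n) * (real n + 1) ^ 3)"
proof (rule summable_comparison_test')
  show "summable (\<lambda>n. 27 * exp 1 * exp (- 1) ^ n :: real)"
    by (intro summable_mult summable_geometric) simp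
  fix n :: nat
  have "(real n + 1) / 3 \<le> exp ((real n + 1) / 3)"
    using exp_ge_add_one_self[of "(real n + 1) / 3"] by linarith
  then have "((real n + 1) / 3) ^ 3 \<le> exp ((real n + 1) / 3) ^ 3" by (intro power_mono) auto
  also have "exp ((real n + 1) / 3) ^ 3 = exp (real n + 1)"
    by (simp flip: exp_of_nat_mult)
  finally have "(real n + 1) ^ 3 \<le> 27 * exp (real n + 1)"
    by (simp add: power_divide)
  then have "exp (- 2 * real n) * (real n + 1) ^ 3 \<le> exp (- 2 * real n) * (27 * exp (real n + 1))"
    by (intro mult_left_mono) auto
  also have "\<dots> = 27 * exp 1 * exp (- 1) ^ n"
    by (simp add: exp_of_nat_mult[symmetric] exp_add[symmetric] mult.commute)
  finally show "norm (exp (- 2 * real n) * (real n + 1) ^ 3) \<le> 27 * exp 1 * exp (- 1) ^ n" by simp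
qed

text \<open>The power \<open>\<kappa>^-3\<close> is the scaling of volume. On each annulus
  \<open>n \<le> \<kappa> |y| < n + 1\<close> the exponential is at most \<open>exp (- 2 n)\<close>,
  and the annulus is replaced by the full ball around it, so that only ball volumes occur.\<close>

lemma nn_integral_exp_norm_le:
  "\<exists>C>0. \<forall>\<kappa>>0. (\<integral>\<^sup>+ y. ennreal (exp (- 2 * \<kappa> * norm (y::real^3))) \<partial>lborel) \<le> ennreal (C / \<kappa> ^ 3)"
proof -
  define V where "V = unit_ball_vol 3"
  define b where "b n = exp (- 2 * real n) * (real n + 1) ^ 3" for n
  have [measurable]: "ball (0::real^3) x \<in> sets borel" for x by simp
  have V: "V \<ge> 0" by (simp add: V_def)
  have b: "summable b" "\<And>n. 0 \<le> b n" using summable_cubic_exp by (simp_all add: b_def[abs_def])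
  have "(\<integral>\<^sup>+ y. ennreal (exp (- 2 * \<kappa> * norm (y::real^3))) \<partial>lborel) \<le> ennreal ((V * suminf b + 1) / \<kappa> ^ 3)"
    if \<kappa>: "\<kappa> > 0" for \<kappa>
  proof -
    have "ennreal (exp (- 2 * \<kappa> * norm y))
        \<le> (\<Sum>n. ennreal (exp (- 2 * real n)) * indicator (ball 0 ((real n + 1) / \<kappa>)) y)" for y :: "real^3"
    proof -
      define N where "N = nat \<lfloor>\<kappa> * norm y\<rfloor>"
      have N: "real N \<le> \<kappa> * norm y" "\<kappa> * norm y < real N + 1"
        using \<kappa> by (auto simp: N_def of_nat_nat)
      have "y \<in> ball 0 ((real N + 1) / \<kappa>)" using N(2) \<kappa> by (simp add: field_simps)
      then have "ennreal (exp (- 2 * \<kappa> * norm y)) \<le> ennreal (exp (- 2 * real N)) * indicator (ball 0 ((real N + 1) / \<kappa>)) y"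
        using N(1) by (simp add: ennreal_leI)
      also have "\<dots> \<le> (\<Sum>n. ennreal (exp (- 2 * real n)) * indicator (ball 0 ((real n + 1) / \<kappa>)) y)"
        using sum_le_suminf[OF summableI, of "{N}" "\<lambda>n. ennreal (exp (- 2 * real n)) * indicator (ball 0 ((real n + 1) / \<kappa>)) y"]
        by (simp del: sum_mult_indicator)
      finally show ?thesis .
    qed
    then have "(\<integral>\<^sup>+ y. ennreal (exp (- 2 * \<kappa> * norm (y::real^3))) \<partial>lborel)
        \<le> (\<integral>\<^sup>+ y. (\<Sum>n. ennreal (exp (- 2 * real n)) * indicator (ball 0 ((real n + 1) / \<kappa>)) (y::real^3)) \<partial>lborel)"
      by (rule nn_integral_mono)
    also have "\<dots> = (\<Sum>n. \<integral>\<^sup>+ y. ennreal (exp (- 2 * real n)) * indicator (ball 0 ((real n + 1) / \<kappa>)) (y::real^3) \<partial>lborel)"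
      by (rule nn_integral_suminf) measurable
    also have "\<dots> = (\<Sum>n. ennreal (V / \<kappa> ^ 3 * b n))"
    proof (rule suminf_cong)
      fix n
      have "(\<integral>\<^sup>+ y. ennreal (exp (- 2 * real n)) * indicator (ball 0 ((real n + 1) / \<kappa>)) (y::real^3) \<partial>lborel)
          = ennreal (exp (- 2 * real n)) * ennreal (V * ((real n + 1) / \<kappa>) ^ 3)"
        using \<kappa> by (simp add: nn_integral_cmult emeasure_ball V_def)
      also have "\<dots> = ennreal (V / \<kappa> ^ 3 * b n)"
        using V \<kappa> by (simp add: ennreal_mult[symmetric] b_def power_divide mult_ac)
      finally show "(\<integral>\<^sup>+ y. ennreal (exp (- 2 * real n)) * indicator (ball 0 ((real n + 1) / \<kappa>)) (y::real^3) \<partial>lborel)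
          = ennreal (V / \<kappa> ^ 3 * b n)" .
    qed
    also have "\<dots> = ennreal (\<Sum>n. V / \<kappa> ^ 3 * b n)"
      using V \<kappa> b by (intro suminf_ennreal2 summable_mult) auto
    also have "\<dots> = ennreal (V * suminf b / \<kappa> ^ 3)"
      using suminf_mult[OF b(1), of "V / \<kappa> ^ 3"] by simp
    also have "\<dots> \<le> ennreal ((V * suminf b + 1) / \<kappa> ^ 3)"
      using \<kappa> by (intro ennreal_leI divide_right_mono) auto
    finally show ?thesis .
  qed
  moreover have "V * suminf b + 1 > 0"
    using V b by (intro add_nonneg_pos mult_nonneg_nonneg suminf_nonneg) auto
  ultimately show ?thesis by blast
qed

text \<open>Three times the volume of the unit ball is the area of the unit sphere, so the bound is
  the area of the sphere of radius \<open>a\<close> times the thickness \<eta>.\<close>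

lemma emeasure_shell_ge:
  assumes "0 \<le> a" "0 \<le> \<eta>"
  shows "ennreal (unit_ball_vol 3 * (3 * a\<^sup>2 * \<eta>)) \<le> emeasure lborel {y::real^3. a + \<eta> \<le> norm y \<and> norm y < a + 2 * \<eta>}"
proof -
  have "{y::real^3. a + \<eta> \<le> norm y \<and> norm y < a + 2 * \<eta>} = ball 0 (a + 2 * \<eta>) - ball 0 (a + \<eta>)"
    by auto
  moreover have "emeasure lborel (ball (0::real^3) (a + 2 * \<eta>) - ball 0 (a + \<eta>))
      = ennreal (unit_ball_vol 3 * (a + 2 * \<eta>) ^ 3) - ennreal (unit_ball_vol 3 * (a + \<eta>) ^ 3)"
    using assms by (subst emeasure_Diff) (auto simp: emeasure_ball subset_ball)
  moreover have "\<dots> = ennreal (unit_ball_vol 3 * ((a + 2 * \<eta>) ^ 3 - (a + \<eta>) ^ 3))"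
    using assms by (simp add: ennreal_minus right_diff_distrib)
  moreover have "3 * a\<^sup>2 * \<eta> \<le> (a + 2 * \<eta>) ^ 3 - (a + \<eta>) ^ 3"
  proof -
    have "(a + 2 * \<eta>) ^ 3 - (a + \<eta>) ^ 3 = 3 * a\<^sup>2 * \<eta> + (9 * a * \<eta>\<^sup>2 + 7 * \<eta> ^ 3)"
      by (simp add: power2_eq_square power3_eq_cube algebra_simps)
    then show ?thesis using assms by simp
  qed
  ultimately show ?thesis by (simp add: ennreal_leI mult_left_mono)
qed

definition mode_density :: "real \<Rightarrow> real \<Rightarrow> (real \<Rightarrow> real) \<Rightarrow> (real \<Rightarrow> real) \<Rightarrow> real \<Rightarrow> real" where
  "mode_density m \<kappa> S S' r = exp (- 2 * \<kappa> * r) *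
     ((\<kappa> * S r + (1 - ern_D m r) * S' r)\<^sup>2 + (S' r - \<kappa> * S r)\<^sup>2) / 2"

text \<open>Nothing is known about \<open>S\<close> and \<open>S'\<close> for
  \<open>r \<le> m\<close>, hence the restriction to an open set of radii on which they are
  continuous.\<close>

lemma mode_density_measurable:
  assumes "open I" "I \<subseteq> {m<..}" "0 < m"
    and dS: "\<And>r. m < r \<Longrightarrow> (S has_real_derivative S' r) (at r)"
    and dS': "\<And>r. m < r \<Longrightarrow> (S' has_real_derivative S'' r) (at r)"
  shows "(\<lambda>y::real^3. ennreal (mode_density m \<kappa> S S' (norm y)) * indicator {y. norm y \<in> I} y) \<in> borel_measurable borel"
proof -
  have "isCont S r" "isCont S' r" if "r \<in> I" for r
    using dS dS' that assms(2) by (auto intro: DERIV_isCont)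
  then have "continuous_on I S" "continuous_on I S'"
    by (auto intro: continuous_at_imp_continuous_on)
  moreover have "r \<noteq> 0" if "r \<in> I" for r using that assms by auto
  ultimately have c: "continuous_on I (mode_density m \<kappa> S S')"
    unfolding mode_density_def ern_D_def by (intro continuous_intros) auto
  have "(\<lambda>r. indicator I r *\<^sub>R mode_density m \<kappa> S S' r) \<in> borel_measurable borel"
    using borel_measurable_continuous_on_indicator[OF _ c] assms(1) by simp
  then have "(\<lambda>y::real^3. ennreal (indicator I (norm y) *\<^sub>R mode_density m \<kappa> S S' (norm y))) \<in> borel_measurable borel"
    by measurable
  moreover have "ennreal (indicator I (norm y) *\<^sub>R mode_density m \<kappa> S S' (norm y))
      = ennreal (mode_density m \<kappa> S S' (norm y)) * indicator {y. norm y \<in> I} y" for y :: "real^3"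
    by (simp add: indicator_def)
  ultimately show ?thesis by simp
qed

lemma ern_energy_mode:
  assumes "0 < m" "open I" "I \<subseteq> {m<..}"
    and dS: "\<And>r. m < r \<Longrightarrow> (S has_real_derivative S' r) (at r)"
    and dS': "\<And>r. m < r \<Longrightarrow> (S' has_real_derivative S'' r) (at r)"
  shows "ern_energy m \<tau> {p. p $ 1 = \<tau> \<and> rad p \<in> I} (\<lambda>p. complex_of_real (mode \<kappa> S p)) =
    ennreal (exp (- 2 * \<kappa> * \<tau>)) * (\<integral>\<^sup>+ y. ennreal (mode_density m \<kappa> S S' (norm (y::real^3))) * indicator {y. norm y \<in> I} y \<partial>lborel)"
proof -
  let ?u = "\<lambda>p. complex_of_real (mode \<kappa> S p)"
  have dens: "metric_ip (ern_metric m (slice_pt \<tau> y)) (current (ern_metric m) (ern_N m) ?u (slice_pt \<tau> y)) (ern_unit_normal m (slice_pt \<tau> y))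
      * sqrt (det (ern_induced_metric m \<tau> y)) = exp (- 2 * \<kappa> * \<tau>) * mode_density m \<kappa> S S' (norm y)" if r: "m < norm y" for y
  proof -
    have r0: "0 < norm y" using r assms(1) by linarith
    let ?p = "slice_pt \<tau> y"
    define X where "X = exp (- \<kappa> * (\<tau> + norm y))"
    have "(?u has_derivative
      (\<lambda>h. complex_of_real (X * (- \<kappa> * S (norm y) * h $ 1 + (S' (norm y) - \<kappa> * S (norm y)) * radial ?p h)))) (at ?p)"
      using has_derivative_complex_of_real[OF mode_has_derivative[of ?p S "S' (norm y)" \<kappa>]] dS[OF r] r0
      by (simp only: X_def rad_slice_pt slice_pt_nth)
    then have "(?u has_derivative
      (\<lambda>h. complex_of_real ((X * (- \<kappa> * S (norm y))) * h $ 1 + (X * (S' (norm y) - \<kappa> * S (norm y))) * radial ?p h))) (at ?p)"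
      by (simp only: distrib_left mult.assoc)
    from energy_density[OF assms(1) r this]
    have "metric_ip (ern_metric m ?p) (current (ern_metric m) (ern_N m) ?u ?p) (ern_unit_normal m ?p)
             * sqrt (det (ern_induced_metric m \<tau> y))
      = X\<^sup>2 * ((\<kappa> * S (norm y) + (1 - ern_D m (norm y)) * S' (norm y))\<^sup>2 + (S' (norm y) - \<kappa> * S (norm y))\<^sup>2) / 2"
      by (simp add: power2_eq_square algebra_simps)
    also have "X\<^sup>2 = exp (- 2 * \<kappa> * \<tau>) * exp (- 2 * \<kappa> * norm y)"
      by (simp add: X_def exp_add[symmetric] exp_double[symmetric] algebra_simps)
    finally show ?thesis by (simp add: mode_density_def)
  qed
  have nonneg: "0 \<le> mode_density m \<kappa> S S' r" for r by (simp add: mode_density_def)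
  have "ern_energy m \<tau> {p. p $ 1 = \<tau> \<and> rad p \<in> I} ?u =
    (\<integral>\<^sup>+ y. ennreal (exp (- 2 * \<kappa> * \<tau>)) * (ennreal (mode_density m \<kappa> S S' (norm (y::real^3))) * indicator {y. norm y \<in> I} y) \<partial>lborel)"
    unfolding ern_energy_def Let_def
    by (rule nn_integral_cong)
      (use assms(3) in \<open>auto simp: indicator_def rad_slice_pt slice_pt_nth dens ennreal_mult nonneg\<close>)
  also have "\<dots> = ennreal (exp (- 2 * \<kappa> * \<tau>)) * (\<integral>\<^sup>+ y. ennreal (mode_density m \<kappa> S S' (norm (y::real^3))) * indicator {y. norm y \<in> I} y \<partial>lborel)"
    using mode_density_measurable[OF assms(2,3,1) dS dS'] by (intro nn_integral_cmult) simp
  finally show ?thesis .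
qed

text \<open>For small \<open>\<kappa>\<close> the energy in the shell \<open>r - m \<approx> 48 m\<^sup>2 \<kappa>\<close> is at least of order \<open>\<kappa>\<^sup>-\<^sup>3\<close>, while the
  energy in \<open>r \<ge> m + \<delta>\<close> is \<open>o(\<kappa>\<^sup>-\<^sup>3)\<close>.\<close>

lemma slowly_decaying_mode:
  assumes m: "0 < m" and \<delta>: "0 < \<delta>" and "0 \<le> \<tau>0"
  obtains u where "ern_wave_solution m u"
    "0 < ern_energy m 0 (ern_slice m 0) u" "ern_energy m 0 (ern_slice m 0) u < \<infinity>"
    "\<And>\<tau>. 0 \<le> \<tau> \<Longrightarrow> \<tau> \<le> \<tau>0 \<Longrightarrow>
      ern_energy m 0 (ern_slice m 0) u \<le> 4 * ern_energy m \<tau> {p. p $ 1 = \<tau> \<and> rad p \<in> {m<..<m + \<delta>}} u"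
proof -
  define V where "V = unit_ball_vol 3"
  have V: "V > 0" by (simp add: V_def)
  obtain C where C: "C > 0"
    and Cint: "\<And>\<kappa>. \<kappa> > 0 \<Longrightarrow> (\<integral>\<^sup>+ y. ennreal (exp (- 2 * \<kappa> * norm (y::real^3))) \<partial>lborel) \<le> ennreal (C / \<kappa> ^ 3)"
    using nn_integral_exp_norm_le by blast
  \<comment> \<open>The shell energy: thickness \<eta> = 48 m^2 \<kappa>, volume at least
    \<open>3 V m^2 \<eta>\<close>, density at least \<open>1 / (2 exp 1 * 36864 * \<eta>^4)\<close>.
    Here 36864 is the square of 48 * 4, from the bound on \<open>S'\<close> at distance at most 2
    \<eta>.\<close>
  define c0 where "c0 = 3 * V * m\<^sup>2 / (2 * exp 1 * 36864 * (48 * m\<^sup>2) ^ 3)"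
  have c0: "c0 > 0" using V m by (simp add: c0_def)
  \<comment> \<open>Beyond \<open>r = m + R\<close> the bound \<open>1 / R^4\<close> on
    \<open>(S')^2\<close> contributes at most a multiple of \<open>R^-4 \<kappa>^-3\<close>. This is
    of the same order in \<kappa> as the shell energy, so it has to be made small through
    \<open>R\<close>, before \<kappa> is chosen.\<close>
  obtain R where R: "R > 0" "2 * C / R ^ 4 \<le> c0 / 4"
  proof -
    have "((\<lambda>R. 2 * C / R ^ 4) \<longlongrightarrow> 0) at_top"
      by (intro tendsto_divide_0[OF tendsto_const] filterlim_at_top_imp_at_infinity filterlim_pow_at_top filterlim_ident) simp
    then have "\<forall>\<^sub>F R in at_top. 2 * C / R ^ 4 < c0 / 4" using c0 by (intro order_tendstoD) auto
    then have "\<forall>\<^sub>F R in at_top. 2 * C / R ^ 4 < c0 / 4 \<and> R > 0" using eventually_gt_at_top[of 0] by eventually_elim auto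
    then show ?thesis using that by (auto dest!: eventually_happens simp: trivial_limit_at_top_linorder)
  qed
  \<comment> \<open>The first two smallness conditions place the shell in \<open>r \<le> 2 m\<close>
    and inside the collar. The next two control the term with \<open>\<kappa>^2 S^2\<close> and the
    term with \<open>(S')^2\<close> up to \<open>m + R\<close>; with the share of \<open>R\<close>,
    the parts \<open>c0 / 4\<close>, \<open>c0 / 2\<close> and \<open>c0 / 4\<close> sum to
    \<open>c0\<close>. The last condition keeps the loss over the time window below a factor
    2.\<close>
  obtain \<kappa> where \<kappa>: "\<kappa> > 0" "96 * m\<^sup>2 * \<kappa> < m" "96 * m\<^sup>2 * \<kappa> < \<delta>"
    "2 * C / \<delta>\<^sup>2 * \<kappa>\<^sup>2 \<le> c0 / 4" "2 / \<delta> ^ 4 * (V * (m + R) ^ 3) * \<kappa> ^ 3 \<le> c0 / 2" "2 * \<kappa> * \<tau>0 \<le> 1 / 2"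
  proof -
    have small: "\<forall>\<^sub>F \<kappa> in at_right 0. f \<kappa> < b" if "continuous_on UNIV f" "f 0 = 0" "b > 0" for f :: "real \<Rightarrow> real" and b
    proof -
      have "(f \<longlongrightarrow> f 0) (at_right 0)"
        using that(1) by (auto simp: continuous_on_def intro: tendsto_within_subset[where S=UNIV])
      then show ?thesis using that by (auto intro: order_tendstoD)
    qed
    have "\<forall>\<^sub>F \<kappa> in at_right 0. 96 * m\<^sup>2 * \<kappa> < m" "\<forall>\<^sub>F \<kappa> in at_right 0. 96 * m\<^sup>2 * \<kappa> < \<delta>"
      "\<forall>\<^sub>F \<kappa> in at_right 0. 2 * C / \<delta>\<^sup>2 * \<kappa>\<^sup>2 < c0 / 4"
      "\<forall>\<^sub>F \<kappa> in at_right 0. 2 / \<delta> ^ 4 * (V * (m + R) ^ 3) * \<kappa> ^ 3 < c0 / 2"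
      "\<forall>\<^sub>F \<kappa> in at_right 0. 2 * \<kappa> * \<tau>0 < 1 / 2"
      by (rule small; use m \<delta> c0 in \<open>auto intro!: continuous_intros\<close>)+
    moreover have "\<forall>\<^sub>F \<kappa> in at_right 0. (0::real) < \<kappa>" by (simp add: eventually_at_right_less)
    ultimately have "\<forall>\<^sub>F \<kappa> in at_right 0. \<kappa> > 0 \<and> 96 * m\<^sup>2 * \<kappa> < m \<and> 96 * m\<^sup>2 * \<kappa> < \<delta> \<and>
      2 * C / \<delta>\<^sup>2 * \<kappa>\<^sup>2 < c0 / 4 \<and> 2 / \<delta> ^ 4 * (V * (m + R) ^ 3) * \<kappa> ^ 3 < c0 / 2 \<and> 2 * \<kappa> * \<tau>0 < 1 / 2"
      by eventually_elim simp
    then obtain \<kappa> where "\<kappa> > 0 \<and> 96 * m\<^sup>2 * \<kappa> < m \<and> 96 * m\<^sup>2 * \<kappa> < \<delta> \<and>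
      2 * C / \<delta>\<^sup>2 * \<kappa>\<^sup>2 < c0 / 4 \<and> 2 / \<delta> ^ 4 * (V * (m + R) ^ 3) * \<kappa> ^ 3 < c0 / 2 \<and> 2 * \<kappa> * \<tau>0 < 1 / 2"
      using eventually_happens trivial_limit_at_right_real by blast
    then show ?thesis by (intro that[of \<kappa>]) linarith+
  qed
  interpret ern_mode m \<kappa> using m \<kappa>(1) by unfold_locales
  obtain S S' where dS: "\<And>r. m < r \<Longrightarrow> (S has_real_derivative S' r) (at r)"
    and dS': "\<And>r. m < r \<Longrightarrow> (S' has_real_derivative
        (2 * \<kappa> * r * (r * S' r + S r) - 2 * (r - m) * S' r) / (r - m)\<^sup>2) (at r)"
    and S0: "\<And>r. m < r \<Longrightarrow> 0 \<le> S r" and S_le: "\<And>r. m < r \<Longrightarrow> S r \<le> 1 / (r - m)"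
    and S'0: "\<And>r. m < r \<Longrightarrow> S' r \<le> 0" and S'_le: "\<And>r. m < r \<Longrightarrow> - S' r \<le> 1 / (r - m)\<^sup>2"
    and S'_ge: "\<And>r. m < r \<Longrightarrow> r \<le> 2 * m \<Longrightarrow> 48 * m\<^sup>2 * \<kappa> \<le> r - m \<Longrightarrow> 1 / (48 * (r - m)\<^sup>2) \<le> - S' r"
    and bounded: "\<exists>K. \<forall>r>m. S r \<le> K \<and> - S' r \<le> K"
    by (rule radial_solution) blast
  define u where "u p = complex_of_real (mode \<kappa> S p)" for p
  define f where "f r = mode_density m \<kappa> S S' r" for r
  define near where "near = (\<integral>\<^sup>+ y. ennreal (f (norm (y::real^3))) * indicator {y. norm y \<in> {m<..<m + \<delta>}} y \<partial>lborel)"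
  define total where "total = (\<integral>\<^sup>+ y. ennreal (f (norm (y::real^3))) * indicator {y. norm y \<in> {m<..}} y \<partial>lborel)"
  have sol: "ern_wave_solution m u"
    unfolding ern_wave_solution_def u_def[abs_def]
    using smooth_on_subset[OF smooth_on_mode[OF m dS dS'] ern_dod_subset] wave_op_mode[OF m _ dS dS'] ern_dod_subset
    by blast
  have En: "ern_energy m \<tau> {p. p $ 1 = \<tau> \<and> rad p \<in> {m<..<m + \<delta>}} u = ennreal (exp (- 2 * \<kappa> * \<tau>)) * near" for \<tau>
    unfolding u_def[abs_def] near_def f_def by (rule ern_energy_mode[OF m _ _ dS dS']) auto
  have "ern_slice m 0 = {p. p $ 1 = 0 \<and> rad p \<in> {m<..}}" by (auto simp: ern_slice_def)
  then have E0: "ern_energy m 0 (ern_slice m 0) u = total"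
    using ern_energy_mode[OF m _ _ dS dS', of "{m<..}" 0] by (simp add: u_def[abs_def] total_def f_def)
  have f_upper: "f r \<le> 2 * exp (- 2 * \<kappa> * r) * (\<kappa>\<^sup>2 * (S r)\<^sup>2 + (S' r)\<^sup>2)" if "m < r" for r
  proof -
    define d where "d = (1 - ern_D m r) * S' r"
    have "\<bar>d\<bar> \<le> 1 * \<bar>S' r\<bar>"
      unfolding d_def abs_mult using ern_D_bounds[OF m that] by (intro mult_right_mono) auto
    then have d2: "d\<^sup>2 \<le> (S' r)\<^sup>2" by (simp add: abs_le_square_iff)
    have "(\<kappa> * S r + d)\<^sup>2 \<le> 2 * (\<kappa> * S r)\<^sup>2 + 2 * d\<^sup>2" "(S' r - \<kappa> * S r)\<^sup>2 \<le> 2 * (\<kappa> * S r)\<^sup>2 + 2 * (S' r)\<^sup>2"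
      using zero_le_power2[of "\<kappa> * S r - d"] zero_le_power2[of "S' r + \<kappa> * S r"]
      by (simp_all add: power2_eq_square algebra_simps)
    with d2 have "(\<kappa> * S r + d)\<^sup>2 + (S' r - \<kappa> * S r)\<^sup>2 \<le> 4 * (\<kappa>\<^sup>2 * (S r)\<^sup>2 + (S' r)\<^sup>2)"
      by (simp add: power_mult_distrib)
    then have "exp (- 2 * \<kappa> * r) * ((\<kappa> * S r + d)\<^sup>2 + (S' r - \<kappa> * S r)\<^sup>2)
       \<le> exp (- 2 * \<kappa> * r) * (4 * (\<kappa>\<^sup>2 * (S r)\<^sup>2 + (S' r)\<^sup>2))" by (intro mult_left_mono) auto
    then show ?thesis by (simp add: f_def mode_density_def d_def)
  qed
  have near_lower: "ennreal (c0 / \<kappa> ^ 3) \<le> near"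
  proof -
    define \<eta> where "\<eta> = 48 * m\<^sup>2 * \<kappa>"
    have \<eta>: "\<eta> > 0" "2 * \<eta> < m" "2 * \<eta> < \<delta>" using m \<kappa> by (simp_all add: \<eta>_def)
    define b where "b = 1 / (2 * exp 1 * 36864 * \<eta> ^ 4)"
    have b: "b \<ge> 0" using \<eta> by (simp add: b_def)
    have f_lower: "b \<le> f r" if r: "m + \<eta> \<le> r" "r < m + 2 * \<eta>" for r
    proof -
      have mr: "m < r" "r \<le> 2 * m" using r \<eta> by linarith+
      have "1 / (48 * (2 * \<eta>)\<^sup>2) \<le> 1 / (48 * (r - m)\<^sup>2)"
        using r \<eta> mr by (intro divide_left_mono mult_left_mono power_mono) auto
      also have "\<dots> \<le> - S' r" using S'_ge[OF mr] r by (simp add: \<eta>_def)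
      \<comment> \<open>Both \<open>\<kappa> S\<close> and \<open>- S'\<close> are nonnegative, so
        there is no cancellation in the transversal derivative.\<close>
      also have "\<dots> \<le> \<kappa> * S r - S' r" using S0[OF mr(1)] \<kappa>(1) by simp
      finally have "(1 / (48 * (2 * \<eta>)\<^sup>2))\<^sup>2 \<le> (\<kappa> * S r - S' r)\<^sup>2" by (intro power_mono) auto
      then have 1: "1 / (36864 * \<eta> ^ 4) \<le> (S' r - \<kappa> * S r)\<^sup>2"
        by (simp add: power2_commute power_divide power_mult_distrib)
      have "m * (96 * m * \<kappa>) < m * 1" using \<kappa>(2) by (simp add: power2_eq_square mult_ac)
      then have "96 * m * \<kappa> < 1" using m by (simp only: mult_less_cancel_left_pos)
      moreover have "2 * \<kappa> * r \<le> 2 * \<kappa> * (2 * m)" using mr \<kappa>(1) by (intro mult_left_mono) auto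
      ultimately have "2 * \<kappa> * r \<le> 1" by (simp add: mult_ac)
      then have 2: "1 / exp 1 \<le> exp (- 2 * \<kappa> * r)"
        using exp_le_cancel_iff[of "- 1" "- 2 * \<kappa> * r"] by (simp add: exp_minus inverse_eq_divide)
      have "1 / exp 1 * (1 / (36864 * \<eta> ^ 4)) \<le> exp (- 2 * \<kappa> * r) *
        ((\<kappa> * S r + (1 - ern_D m r) * S' r)\<^sup>2 + (S' r - \<kappa> * S r)\<^sup>2)"
        using 1 2 by (intro mult_mono) (auto intro: order.trans[OF _ le_add_same_cancel2[THEN iffD2]])
      then show ?thesis by (simp add: b_def f_def mode_density_def field_simps)
    qed
    have "c0 / \<kappa> ^ 3 = b * (V * (3 * m\<^sup>2 * \<eta>))"
      using m \<kappa>(1) by (simp add: c0_def b_def \<eta>_def power_mult_distrib field_simps eval_nat_numeral)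
    then have "ennreal (c0 / \<kappa> ^ 3) = ennreal b * ennreal (V * (3 * m\<^sup>2 * \<eta>))"
      using b V \<eta> by (simp add: ennreal_mult)
    also have "\<dots> \<le> ennreal b * emeasure lborel {y::real^3. m + \<eta> \<le> norm y \<and> norm y < m + 2 * \<eta>}"
      using emeasure_shell_ge[of m \<eta>] m \<eta> by (intro mult_left_mono) (auto simp: V_def)
    also have "\<dots> = (\<integral>\<^sup>+ y. ennreal b * indicator {y::real^3. m + \<eta> \<le> norm y \<and> norm y < m + 2 * \<eta>} y \<partial>lborel)"
      by (rule nn_integral_cmult_indicator[symmetric]) simp
    also have "\<dots> \<le> near"
      unfolding near_def using f_lower \<eta> by (intro nn_integral_mono) (auto simp: indicator_def ennreal_leI)
    finally show ?thesis .
  qed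
  \<comment> \<open>The constant \<open>K\<close> depends on \<kappa> without control; only
    finiteness matters, since an inequality between infinite energies would contradict
    nothing.\<close>
  have near_finite: "near < \<infinity>"
  proof -
    obtain K where K: "\<And>r. m < r \<Longrightarrow> S r \<le> K" "\<And>r. m < r \<Longrightarrow> - S' r \<le> K" using bounded by blast
    define B where "B = 2 * (\<kappa>\<^sup>2 * K\<^sup>2 + K\<^sup>2)"
    have "f r \<le> B" if r: "m < r" for r
    proof -
      have "(S r)\<^sup>2 \<le> K\<^sup>2" "(S' r)\<^sup>2 \<le> K\<^sup>2"
        using power_mono[OF K(1)[OF r] S0[OF r]] power_mono[OF K(2)[OF r], of 2] S'0[OF r] by simp_all
      then have "\<kappa>\<^sup>2 * (S r)\<^sup>2 + (S' r)\<^sup>2 \<le> \<kappa>\<^sup>2 * K\<^sup>2 + K\<^sup>2" by (intro add_mono mult_left_mono) auto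
      moreover have "exp (- 2 * \<kappa> * r) \<le> 1" using r m \<kappa>(1) by simp
      ultimately have "2 * exp (- 2 * \<kappa> * r) * (\<kappa>\<^sup>2 * (S r)\<^sup>2 + (S' r)\<^sup>2) \<le> 2 * 1 * (\<kappa>\<^sup>2 * K\<^sup>2 + K\<^sup>2)"
        by (intro mult_mono) auto
      then show ?thesis using f_upper[OF r] by (simp add: B_def)
    qed
    then have "near \<le> (\<integral>\<^sup>+ y. ennreal B * indicator (ball (0::real^3) (m + \<delta>)) y \<partial>lborel)"
      unfolding near_def by (intro nn_integral_mono) (auto simp: indicator_def ennreal_leI)
    also have "\<dots> < \<infinity>"
      using m \<delta> by (simp add: nn_integral_cmult_indicator emeasure_ball ennreal_mult_less_top)
    finally show ?thesis .
  qed
  have total_le: "total \<le> 2 * near"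
  proof -
    \<comment> \<open>A majorant of the density for \<open>r \<ge> m + \<delta>\<close>:
      \<open>(S')^2\<close> is at most \<open>1 / \<delta>^4\<close> within radius
      \<open>m + R\<close> and at most \<open>1 / R^4\<close> beyond it, while
      \<open>S \<le> 1 / \<delta>\<close> throughout.\<close>
    define h where "h y = 2 / \<delta> ^ 4 * indicator (ball 0 (m + R)) y + (2 * \<kappa>\<^sup>2 / \<delta>\<^sup>2 + 2 / R ^ 4) * exp (- 2 * \<kappa> * norm y)" for y :: "real^3"
    have [measurable]: "ball (0::real^3) x \<in> sets borel" for x by simp
    have h0: "0 \<le> h y" for y by (simp add: h_def)
    have f_h: "f (norm y) \<le> h y" if y: "m + \<delta> \<le> norm y" for y
    proof -
      define \<rho> where "\<rho> = norm y - m"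
      have \<rho>: "\<delta> \<le> \<rho>" "0 < \<rho>" and my: "m < norm y" using y \<delta> by (auto simp: \<rho>_def)
      define e where "e = exp (- 2 * \<kappa> * norm y)"
      have e: "0 \<le> e" "e \<le> 1" using m my \<kappa>(1) by (auto simp: e_def)
      have "S (norm y) \<le> 1 / \<delta>"
        using S_le[OF my] \<rho> \<delta> by (simp add: \<rho>_def[symmetric]) (smt (verit) frac_le)
      then have 1: "(S (norm y))\<^sup>2 \<le> 1 / \<delta>\<^sup>2"
        using power_mono[OF _ S0[OF my], of "1 / \<delta>" 2] by (simp add: power_divide)
      have 2: "(S' (norm y))\<^sup>2 \<le> 1 / \<rho> ^ 4"
        using power_mono[OF S'_le[OF my], of 2] S'0[OF my] by (simp add: \<rho>_def power_divide)
      have 3: "2 * e * (S' (norm y))\<^sup>2 \<le> 2 / \<delta> ^ 4 * indicator (ball 0 (m + R)) y + 2 / R ^ 4 * e"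
      proof (cases "\<rho> < R")
        case True
        have "1 / \<rho> ^ 4 \<le> 1 / \<delta> ^ 4" using \<rho> \<delta> by (intro divide_left_mono power_mono) auto
        with 2 e have "e * (S' (norm y))\<^sup>2 \<le> 1 * (1 / \<delta> ^ 4)" by (intro mult_mono) auto
        moreover have "indicator (ball 0 (m + R)) y = (1::real)" using True by (simp add: \<rho>_def)
        moreover have "0 \<le> 2 / R ^ 4 * e" using e R by simp
        ultimately show ?thesis by simp
      next
        case False
        have "1 / \<rho> ^ 4 \<le> 1 / R ^ 4" using False R by (intro divide_left_mono power_mono) auto
        with 2 e have "e * (S' (norm y))\<^sup>2 \<le> e * (1 / R ^ 4)" by (intro mult_left_mono) auto
        moreover have "indicator (ball 0 (m + R)) y = (0::real)" using False by (simp add: \<rho>_def)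
        ultimately show ?thesis by simp
      qed
      have "f (norm y) \<le> 2 * e * (\<kappa>\<^sup>2 * (S (norm y))\<^sup>2) + 2 * e * (S' (norm y))\<^sup>2"
        using f_upper[OF my] by (simp add: e_def algebra_simps)
      moreover have "2 * e * (\<kappa>\<^sup>2 * (S (norm y))\<^sup>2) \<le> 2 * e * (\<kappa>\<^sup>2 * (1 / \<delta>\<^sup>2))"
        using 1 e by (intro mult_left_mono) auto
      ultimately show ?thesis
        using 3 unfolding h_def e_def[symmetric] by (simp add: algebra_simps)
    qed
    have outer: "(\<integral>\<^sup>+ y. ennreal (h y) \<partial>lborel) \<le> ennreal (c0 / \<kappa> ^ 3)"
    proof -
      define A where "A = 2 * \<kappa>\<^sup>2 / \<delta>\<^sup>2 + 2 / R ^ 4"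
      have A: "A \<ge> 0" by (simp add: A_def)
      have "(\<integral>\<^sup>+ y. ennreal (h y) \<partial>lborel)
          = (\<integral>\<^sup>+ y. ennreal (2 / \<delta> ^ 4) * indicator (ball (0::real^3) (m + R)) y + ennreal A * ennreal (exp (- 2 * \<kappa> * norm y)) \<partial>lborel)"
        unfolding h_def A_def[symmetric] using A
        by (intro nn_integral_cong) (auto simp: indicator_def ennreal_plus ennreal_mult)
      also have "\<dots> = ennreal (2 / \<delta> ^ 4) * emeasure lborel (ball (0::real^3) (m + R))
          + ennreal A * (\<integral>\<^sup>+ y. ennreal (exp (- 2 * \<kappa> * norm (y::real^3))) \<partial>lborel)"
        by (simp add: nn_integral_add nn_integral_cmult)
      also have "\<dots> \<le> ennreal (2 / \<delta> ^ 4) * ennreal (V * (m + R) ^ 3) + ennreal A * ennreal (C / \<kappa> ^ 3)"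
        using Cint[OF \<kappa>(1)] m R by (intro add_mono mult_left_mono) (auto simp: emeasure_ball V_def)
      also have "\<dots> = ennreal (2 / \<delta> ^ 4 * (V * (m + R) ^ 3) + A * (C / \<kappa> ^ 3))"
        using A C \<kappa>(1) V m R by (subst ennreal_plus) (auto simp: ennreal_mult[symmetric])
      also have "\<dots> \<le> ennreal (c0 / \<kappa> ^ 3)"
      proof (rule ennreal_leI)
        have "2 / \<delta> ^ 4 * (V * (m + R) ^ 3) \<le> c0 / 2 / \<kappa> ^ 3"
          using \<kappa>(1,5) by (simp add: pos_le_divide_eq)
        moreover have "A * (C / \<kappa> ^ 3) \<le> c0 / 2 / \<kappa> ^ 3"
        proof -
          have "A * C = 2 * C / \<delta>\<^sup>2 * \<kappa>\<^sup>2 + 2 * C / R ^ 4" by (simp add: A_def algebra_simps)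
          then have "A * C \<le> c0 / 2" using \<kappa>(4) R(2) by linarith
          then have "A * C / \<kappa> ^ 3 \<le> c0 / 2 / \<kappa> ^ 3" using \<kappa>(1) by (intro divide_right_mono) auto
          then show ?thesis by simp
        qed
        ultimately have "2 / \<delta> ^ 4 * (V * (m + R) ^ 3) + A * (C / \<kappa> ^ 3) \<le> c0 / 2 / \<kappa> ^ 3 + c0 / 2 / \<kappa> ^ 3"
          by (rule add_mono)
        then show "2 / \<delta> ^ 4 * (V * (m + R) ^ 3) + A * (C / \<kappa> ^ 3) \<le> c0 / \<kappa> ^ 3"
          by (simp add: field_simps)
      qed
      finally show ?thesis .
    qed
    have "total \<le> (\<integral>\<^sup>+ y. ennreal (f (norm (y::real^3))) * indicator {y. norm y \<in> {m<..<m + \<delta>}} y + ennreal (h y) \<partial>lborel)"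
      unfolding total_def using f_h h0
      by (intro nn_integral_mono) (auto simp: indicator_def ennreal_leI not_less)
    also have "\<dots> = near + (\<integral>\<^sup>+ y. ennreal (h y) \<partial>lborel)"
      unfolding near_def
    proof (rule nn_integral_add)
      show "(\<lambda>y::real^3. ennreal (f (norm y)) * indicator {y. norm y \<in> {m<..<m + \<delta>}} y) \<in> borel_measurable lborel"
        unfolding f_def measurable_lborel2 by (rule mode_density_measurable[OF _ _ m dS dS']) auto
      show "(\<lambda>y. ennreal (h y)) \<in> borel_measurable lborel" unfolding h_def by measurable
    qed
    also have "\<dots> \<le> near + near" using order.trans[OF outer near_lower] by (rule add_left_mono)
    finally show ?thesis by (simp add: mult_2)
  qed
  show ?thesis
  proof (rule that[OF sol])
    have "near \<le> total"
      unfolding near_def total_def by (intro nn_integral_mono) (auto simp: indicator_def)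
    moreover have "0 < near" using near_lower c0 \<kappa>(1) by (auto intro: less_le_trans[rotated])
    ultimately show "0 < ern_energy m 0 (ern_slice m 0) u" unfolding E0 by (rule less_le_trans[rotated])
    show "ern_energy m 0 (ern_slice m 0) u < \<infinity>"
      unfolding E0 using total_le near_finite by (auto intro: le_less_trans simp: ennreal_mult_less_top)
    fix \<tau> assume \<tau>: "0 \<le> \<tau>" "\<tau> \<le> \<tau>0"
    \<comment> \<open>The factor 4 of the claim is composed of this decay by at most one half and of
      \<open>total \<le> 2 * near\<close>.\<close>
    have "2 * \<kappa> * \<tau> \<le> 1 / 2"
      using \<kappa>(6) mult_left_mono[OF \<tau>(2), of "2 * \<kappa>"] \<kappa>(1) by linarith
    then have "1 / 2 \<le> exp (- 2 * \<kappa> * \<tau>)" using exp_ge_add_one_self[of "- 2 * \<kappa> * \<tau>"] by simp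
    then have "2 \<le> 4 * ennreal (exp (- 2 * \<kappa> * \<tau>))"
      using ennreal_leI[of 2 "4 * exp (- 2 * \<kappa> * \<tau>)"] by (simp add: ennreal_mult)
    then have "2 * near \<le> 4 * ennreal (exp (- 2 * \<kappa> * \<tau>)) * near" by (rule mult_right_mono) simp
    with total_le show "ern_energy m 0 (ern_slice m 0) u
        \<le> 4 * ern_energy m \<tau> {p. p $ 1 = \<tau> \<and> rad p \<in> {m<..<m + \<delta>}} u"
      unfolding E0 En by (simp add: mult.assoc)
  qed
qed

section \<open>Collars of the horizon over bounded time windows, and the conclusion\<close>

lemma horizon_collar:
  assumes "0 < m" "open U" "ern_horizon m \<subseteq> U"
  obtains \<delta> where "0 < \<delta>" "\<And>p. 0 \<le> p $ 1 \<Longrightarrow> p $ 1 \<le> \<tau>0 \<Longrightarrow> m < rad p \<Longrightarrow> rad p < m + \<delta> \<Longrightarrow> p \<in> U"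
proof -
  \<comment> \<open>The horizon itself is not compact, but its part over the window is, and a
    compact set has a uniform distance from the complement of \<open>U\<close>.\<close>
  define K where "K = {p :: real^4. 0 \<le> p $ 1 \<and> p $ 1 \<le> \<tau>0 \<and> rad p = m}"
  have norm_eq: "norm p = sqrt ((p $ 1)\<^sup>2 + (rad p)\<^sup>2)" for p :: "real^4"
    by (simp add: norm_vec_def L2_set_def sum_4 rad_power2 add.assoc)
  have "closed K"
    unfolding K_def by (intro closed_Collect_conj closed_Collect_le closed_Collect_eq continuous_on_rad continuous_intros)
  moreover have "bounded K"
  proof (rule boundedI)
    fix p assume "p \<in> K"
    then show "norm p \<le> sqrt (\<tau>0\<^sup>2 + m\<^sup>2)"
      unfolding norm_eq K_def by (auto intro!: power_mono)
  qed
  ultimately have "compact K" by (simp add: compact_eq_bounded_closed)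
  moreover have "K \<subseteq> U" using assms(3) by (auto simp: K_def ern_horizon_def)
  ultimately obtain \<delta> where \<delta>: "\<delta> > 0" "(\<Union>x\<in>K. ball x \<delta>) \<subseteq> U"
    using compact_subset_open_imp_ball_epsilon_subset[OF _ assms(2)] by blast
  show ?thesis
  proof (rule that[OF \<delta>(1)])
    fix p :: "real^4" assume p: "0 \<le> p $ 1" "p $ 1 \<le> \<tau>0" "m < rad p" "rad p < m + \<delta>"
    define l where "l = m / rad p"
    have r: "rad p > 0" using p assms(1) by linarith
    have l: "0 < l" "l < 1" using p r assms(1) by (auto simp: l_def)
    \<comment> \<open>The radial projection of \<open>p\<close> to the horizon at the same t*, at
      Euclidean distance \<open>r - m\<close>.\<close>
    define q where "q = (\<chi> i. if i = 1 then p $ 1 else l * p $ i)"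
    have q: "q $ 1 = p $ 1" "q $ 2 = l * p $ 2" "q $ 3 = l * p $ 3" "q $ 4 = l * p $ 4" by (simp_all add: q_def)
    have rad_scale: "rad x = \<bar>k\<bar> * rad p" if "x $ 2 = k * p $ 2" "x $ 3 = k * p $ 3" "x $ 4 = k * p $ 4" for x :: "real^4" and k
    proof -
      have "rad x = sqrt (k\<^sup>2 * ((p $ 2)\<^sup>2 + (p $ 3)\<^sup>2 + (p $ 4)\<^sup>2))"
        unfolding rad_def that by (simp add: power_mult_distrib algebra_simps)
      then show ?thesis by (simp add: real_sqrt_mult rad_def)
    qed
    have "rad q = m" using rad_scale[of q l] q l r assms(1) by (simp add: l_def)
    then have "q \<in> K" using p q by (simp add: K_def)
    have "rad (q - p) = \<bar>l - 1\<bar> * rad p" by (rule rad_scale) (simp_all add: q algebra_simps)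
    then have "rad (q - p) = rad p - m" using l r by (simp add: l_def algebra_simps)
    then have "dist q p = rad p - m" using p by (simp add: dist_norm norm_eq q)
    then have "p \<in> ball q \<delta>" using p by simp
    with \<open>q \<in> K\<close> \<delta>(2) show "p \<in> U" by blast
  qed
qed

lemma ern_energy_mono: "A \<subseteq> B \<Longrightarrow> ern_energy m \<tau> A u \<le> ern_energy m \<tau> B u"
  unfolding ern_energy_def by (intro nn_integral_mono mult_left_mono) (auto simp: indicator_def)

lemma persistent_energy_near_horizon:
  assumes m: "0 < m" and "open U" "ern_horizon m \<subseteq> U" and \<tau>0: "0 \<le> \<tau>0"
  obtains u where "ern_wave_solution m u"
    "0 < ern_energy m 0 (ern_slice m 0) u" "ern_energy m 0 (ern_slice m 0) u < \<infinity>"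
    "\<And>\<tau>. 0 \<le> \<tau> \<Longrightarrow> \<tau> \<le> \<tau>0 \<Longrightarrow>
      ern_energy m 0 (ern_slice m 0) u \<le> 4 * ern_energy m \<tau> (U \<inter> ern_dod m \<inter> ern_slice m \<tau>) u"
proof -
  obtain \<delta> where \<delta>: "0 < \<delta>"
    "\<And>p. 0 \<le> p $ 1 \<Longrightarrow> p $ 1 \<le> \<tau>0 \<Longrightarrow> m < rad p \<Longrightarrow> rad p < m + \<delta> \<Longrightarrow> p \<in> U"
    using horizon_collar[OF assms(1-3)] by blast
  obtain u where u: "ern_wave_solution m u"
    "0 < ern_energy m 0 (ern_slice m 0) u" "ern_energy m 0 (ern_slice m 0) u < \<infinity>"
    "\<And>\<tau>. 0 \<le> \<tau> \<Longrightarrow> \<tau> \<le> \<tau>0 \<Longrightarrow>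
      ern_energy m 0 (ern_slice m 0) u \<le> 4 * ern_energy m \<tau> {p. p $ 1 = \<tau> \<and> rad p \<in> {m<..<m + \<delta>}} u"
    using slowly_decaying_mode[OF m \<delta>(1) \<tau>0] by blast
  show ?thesis
  proof (rule that[OF u(1-3)])
    fix \<tau> assume \<tau>: "0 \<le> \<tau>" "\<tau> \<le> \<tau>0"
    have "{p. p $ 1 = \<tau> \<and> rad p \<in> {m<..<m + \<delta>}} \<subseteq> U \<inter> ern_dod m \<inter> ern_slice m \<tau>"
      using \<tau> \<delta>(2) future_of_slice_subset_dod[OF m] by (auto simp: ern_slice_def)
    from ern_energy_mono[OF this, THEN mult_left_mono, of 4] u(4)[OF \<tau>]
    show "ern_energy m 0 (ern_slice m 0) u \<le> 4 * ern_energy m \<tau> (U \<inter> ern_dod m \<inter> ern_slice m \<tau>) u"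
      by (auto intro: order.trans)
  qed
qed

theorem mainTheorem8:
  fixes m :: real and U T :: "(real^4) set"
  assumes "m > 0"
    and "open U" and "U \<subseteq> ern_extended" and "ern_horizon m \<subseteq> U"
    and "T = U \<inter> ern_dod m"
  shows "\<not> (\<exists>P :: real \<Rightarrow> real.
             (\<forall>\<tau>\<ge>0. P \<tau> > 0) \<and> (P \<longlongrightarrow> 0) at_top \<and>
             (\<forall>u. ern_wave_solution m u \<longrightarrow>
                (\<forall>\<tau>\<ge>0. ern_energy m \<tau> (T \<inter> ern_slice m \<tau>) u
                        \<le> ennreal (P \<tau>) * ern_energy m 0 (ern_slice m 0) u)))
       \<and> \<not> (\<exists>C :: real. C > 0 \<and>
             (\<forall>u. ern_wave_solution m u \<longrightarrow>
                (\<integral>\<^sup>+ \<tau> \<in> {0..}. ern_energy m \<tau> (T \<inter> ern_slice m \<tau>) u \<partial>lborel)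
                  \<le> ennreal C * ern_energy m 0 (ern_slice m 0) u))"
proof (intro conjI notI)
  have no_half: "\<not> x \<le> ennreal k * x" if x: "0 < x" "x < \<infinity>" and k: "0 \<le> k" "k < 1" for x k
  proof
    assume le: "x \<le> ennreal k * x"
    obtain r where r: "x = ennreal r" "0 < r"
      using x by (cases x) auto
    have "r \<le> k * r" using le r k(1) by (simp add: ennreal_mult[symmetric])
    then show False using r k(2) by simp
  qed
  {
    assume "\<exists>P :: real \<Rightarrow> real.
             (\<forall>\<tau>\<ge>0. P \<tau> > 0) \<and> (P \<longlongrightarrow> 0) at_top \<and>
             (\<forall>u. ern_wave_solution m u \<longrightarrow>
                (\<forall>\<tau>\<ge>0. ern_energy m \<tau> (T \<inter> ern_slice m \<tau>) u
                        \<le> ennreal (P \<tau>) * ern_energy m 0 (ern_slice m 0) u))"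
    then obtain P :: "real \<Rightarrow> real" where P: "\<And>\<tau>. \<tau> \<ge> 0 \<Longrightarrow> P \<tau> > 0" "(P \<longlongrightarrow> 0) at_top"
      "\<And>u \<tau>. ern_wave_solution m u \<Longrightarrow> \<tau> \<ge> 0 \<Longrightarrow> ern_energy m \<tau> (T \<inter> ern_slice m \<tau>) u
                        \<le> ennreal (P \<tau>) * ern_energy m 0 (ern_slice m 0) u"
      by blast
    \<comment> \<open>Together with the factor 4 this gives x \<le> k x with
      \<open>k < 1 / 2\<close>, impossible for a positive finite energy.\<close>
    have "\<forall>\<^sub>F \<tau> in at_top. P \<tau> < 1 / 8" using P(2) by (rule order_tendstoD) simp
    then have "\<forall>\<^sub>F \<tau> in at_top. P \<tau> < 1 / 8 \<and> 0 \<le> \<tau>" using eventually_ge_at_top[of 0] by eventually_elim simp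
    then obtain \<tau> where \<tau>: "P \<tau> < 1 / 8" "0 \<le> \<tau>"
      by (auto dest!: eventually_happens simp: trivial_limit_at_top_linorder)
    obtain u where u: "ern_wave_solution m u"
      "0 < ern_energy m 0 (ern_slice m 0) u" "ern_energy m 0 (ern_slice m 0) u < \<infinity>"
      "\<And>s. 0 \<le> s \<Longrightarrow> s \<le> \<tau> \<Longrightarrow>
        ern_energy m 0 (ern_slice m 0) u \<le> 4 * ern_energy m s (U \<inter> ern_dod m \<inter> ern_slice m s) u"
      using persistent_energy_near_horizon[OF assms(1,2,4) \<tau>(2)] by blast
    have "ern_energy m 0 (ern_slice m 0) u \<le> 4 * ern_energy m \<tau> (T \<inter> ern_slice m \<tau>) u"
      using u(4)[of \<tau>] \<tau>(2) by (simp add: assms(5))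
    also have "\<dots> \<le> 4 * (ennreal (P \<tau>) * ern_energy m 0 (ern_slice m 0) u)"
      using P(3)[OF u(1) \<tau>(2)] by (rule mult_left_mono) simp
    also have "\<dots> = ennreal (4 * P \<tau>) * ern_energy m 0 (ern_slice m 0) u"
      using P(1)[OF \<tau>(2)] by (simp add: ennreal_mult mult.assoc)
    finally show False
      using no_half[OF u(2,3), of "4 * P \<tau>"] \<tau> P(1)[OF \<tau>(2)] by simp
  next
    assume "\<exists>C :: real. C > 0 \<and>
             (\<forall>u. ern_wave_solution m u \<longrightarrow>
                (\<integral>\<^sup>+ \<tau> \<in> {0..}. ern_energy m \<tau> (T \<inter> ern_slice m \<tau>) u \<partial>lborel)
                  \<le> ennreal C * ern_energy m 0 (ern_slice m 0) u)"
    then obtain C :: real where C: "C > 0" "\<And>u. ern_wave_solution m u \<Longrightarrow>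
                (\<integral>\<^sup>+ \<tau> \<in> {0..}. ern_energy m \<tau> (T \<inter> ern_slice m \<tau>) u \<partial>lborel)
                  \<le> ennreal C * ern_energy m 0 (ern_slice m 0) u"
      by blast
    \<comment> \<open>A quarter of the initial energy kept for the time \<open>8 C\<close>
      integrates to \<open>2 C\<close> times that energy, twice what the estimate allows.\<close>
    have "0 \<le> 8 * C" using C(1) by simp
    then obtain u where u: "ern_wave_solution m u"
      "0 < ern_energy m 0 (ern_slice m 0) u" "ern_energy m 0 (ern_slice m 0) u < \<infinity>"
      "\<And>s. 0 \<le> s \<Longrightarrow> s \<le> 8 * C \<Longrightarrow>
        ern_energy m 0 (ern_slice m 0) u \<le> 4 * ern_energy m s (U \<inter> ern_dod m \<inter> ern_slice m s) u"
      using persistent_energy_near_horizon[OF assms(1,2,4)] by blast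
    obtain e where e: "ern_energy m 0 (ern_slice m 0) u = ennreal e" "0 < e"
      using u(2,3) by (cases "ern_energy m 0 (ern_slice m 0) u") auto
    have low: "ennreal (e / 4) \<le> ern_energy m s (T \<inter> ern_slice m s) u" if "0 \<le> s" "s \<le> 8 * C" for s
    proof (cases "ern_energy m s (T \<inter> ern_slice m s) u")
      case (real r)
      then have "ennreal e \<le> ennreal (4 * r)"
        using u(4)[OF that] e by (simp add: assms(5) ennreal_mult)
      then show ?thesis using real e by (simp add: ennreal_le_iff)
    qed simp
    have "ennreal (2 * C * e) = ennreal (e / 4) * emeasure lborel {0..8 * C}"
      using C(1) e by (simp add: ennreal_mult[symmetric])
    also have "\<dots> = (\<integral>\<^sup>+ \<tau>. ennreal (e / 4) * indicator {0..8 * C} \<tau> \<partial>lborel)"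
      by (rule nn_integral_cmult_indicator[symmetric]) simp
    also have "\<dots> \<le> (\<integral>\<^sup>+ \<tau> \<in> {0..}. ern_energy m \<tau> (T \<inter> ern_slice m \<tau>) u \<partial>lborel)"
      by (intro nn_integral_mono) (auto simp: indicator_def low)
    also have "\<dots> \<le> ennreal C * ennreal e" using C(2)[OF u(1)] e by simp
    finally have "2 * C * e \<le> C * e"
      using C(1) e by (simp add: ennreal_mult[symmetric])
    then show False using C(1) e by simp
  }
qed

end
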